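(* Let $T$ be a triangle in the Euclidean plane, and let $\mathrm{Quads}(T)$ denote the number of quadrisections of $T$. Let $C=(h,t)$ be the unique point of $\overline{R_2}$ such that the triangle with vertices $(0,0),(1,0),C$ is similar to $T$, and let $C'$ be the inverse of $C$ about the unit circle with center $(1,0)$. With the sets $D_2$, $J_0$, the map $F$ and the point $I_1$ as defined in the context: 1. If $C'\in F(D_2)\setminus F(J_0)$, then $\mathrm{Quads}(T)=3$. 2. If $C'\in F(J_0)$ and $C'\neq I_1$, then $\mathrm{Quads}(T)=2$. 3. Otherwise (that is, if $C'\notin F(D_2)$ or $C'=I_1$), $\mathrm{Quads}(T)=1$.
   Context: A quadrisection of a (nondegenerate, closed) triangle $T$ is an unordered pair of perpendicular segments, each with its endpoints on the boundary of $T$, which intersect in a point in the interior of $T$ and divide $T$ into four regions of equal area. $\overline{R_2}=\{(h,t)\in\mathbb{R}^2 : h\ge 1/2,\ t>0,\ h^2+t^2\ge 1,\ (h-1)^2+t^2\le 1\}$. Every triangle is similar to the triangle with vertices $(0,0),(1,0),C$ for exactly one $C\in\overline{R_2}$ (the side from $(0,0)$ to $(1,0)$ then being a side of middle length). The inverse of a point $p\ne c$ about the unit circle with center $c$ is $c+(p-c)/|p-c|^2$. For $x\in[\sqrt2/2,1]$ put $y(x)=2-2x+\tfrac12\sqrt{12x^2-16x+6}$, $c(x)=x^2-y(x)^2+\tfrac12$, $r(x)=x^2+y(x)^2-\tfrac12$, $\theta(x)=\arccos\big((\tfrac12-c(x))/r(x)\big)$. Let $D=\{(x,\theta): x\in[\sqrt2/2,1],\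 \theta\in[0,\theta(x)]\}$ and let $F:D\to\mathbb{R}^2$, $F(x,\theta)=(c(x)+r(x)\cos\theta,\ r(x)\sin\theta)$. The Jacobian determinant of $F$ is $c'(x)r(x)\cos\theta+r'(x)r(x)$. Let $p(x)=(x,\arccos(-r'(x)/c'(x)))$ and let $J_0$ be the zero set in $D$ of this Jacobian determinant, i.e. $J_0=\{p(x): x\in[5/6,1]\}$. The set $D\setminus J_0$ is the union of two disjoint relatively open sets $U,V$ with $(\sqrt2/2,0)\in U$. Let $D_2=V\cup J_0$; explicitly $D_2=\{(x,\theta): x\in[5/6,1],\ \arccos(-r'(x)/c'(x))\le\theta\le\theta(x)\}$. $I_1=F(p(1))=(2-\sqrt2,\sqrt{2\sqrt2-2})$. *)

theory Defs
  imports "HOL-Analysis.Analysis"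
begin

text \<open>The Euclidean plane is \<^typ>\<open>real \<times> real\<close>, whose library norm and inner product are
  the Euclidean ones. A triangle is the closed, nondegenerate, two-dimensional region.\<close>

definition is_triangle :: "(real \<times> real) set \<Rightarrow> bool" where
  "is_triangle T \<longleftrightarrow> (\<exists>A B C. \<not> collinear {A, B, C} \<and> T = convex hull {A, B, C})"

definition similar :: "(real \<times> real) set \<Rightarrow> (real \<times> real) set \<Rightarrow> bool" where
  "similar S T \<longleftrightarrow>
     (\<exists>f k. k > 0 \<and> (\<forall>x y. dist (f x) (f y) = k * dist x y) \<and> f ` S = T)"

text \<open>The regions into which \<^term>\<open>T\<close> is divided by a set \<^term>\<open>S\<close> are the connected
  components of \<^term>\<open>T - S\<close>. The cutting segments are Lebesgue null sets, so it makes no difference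
  to the areas that the regions do not contain them.\<close>

definition divides_into_four_equal :: "(real \<times> real) set \<Rightarrow> (real \<times> real) set \<Rightarrow> bool" where
  "divides_into_four_equal T S \<longleftrightarrow>
     card (components (T - S)) = 4 \<and>
     (\<exists>a. \<forall>R \<in> components (T - S). measure lebesgue R = a)"

text \<open>A quadrisection is an unordered pair of segments, i.e. a two-element set of point sets. The
  segments are automatically nondegenerate and distinct, as they have their endpoints on the
  frontier and meet in a single interior point.\<close>

definition is_quadrisection ::
  "(real \<times> real) set \<Rightarrow> (real \<times> real) set set \<Rightarrow> bool" where
  "is_quadrisection T Q \<longleftrightarrow>
     (\<exists>a b c d. Q = {closed_segment a b, closed_segment c d} \<and>
        {a, b, c, d} \<subseteq> frontier T \<and>
        (b - a) \<bullet> (d - c) = 0 \<and>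
        (\<exists>P \<in> interior T. closed_segment a b \<inter> closed_segment c d = {P}) \<and>
        divides_into_four_equal T (closed_segment a b \<union> closed_segment c d))"

text \<open>As \<^const>\<open>card\<close> is 0 on infinite sets, a positive value of the following entails
  that there are only finitely many quadrisections.\<close>

definition Quads :: "(real \<times> real) set \<Rightarrow> nat" where
  "Quads T = card {Q. is_quadrisection T Q}"

definition R2_closure :: "(real \<times> real) set" where
  "R2_closure = {(h, t). h \<ge> 1/2 \<and> t > 0 \<and> h\<^sup>2 + t\<^sup>2 \<ge> 1 \<and> (h - 1)\<^sup>2 + t\<^sup>2 \<le> 1}"

text \<open>Inverse of \<^term>\<open>p\<close> about the unit circle with center \<^term>\<open>z\<close>.\<close>

definition unit_inverse :: "real \<times> real \<Rightarrow> real \<times> real \<Rightarrow> real \<times> real" where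
  "unit_inverse z p = z + (1 / (norm (p - z))\<^sup>2) *\<^sub>R (p - z)"

definition yf :: "real \<Rightarrow> real" where
  "yf x = 2 - 2 * x + 1/2 * sqrt (12 * x\<^sup>2 - 16 * x + 6)"

definition cf :: "real \<Rightarrow> real" where
  "cf x = x\<^sup>2 - (yf x)\<^sup>2 + 1/2"

definition rf :: "real \<Rightarrow> real" where
  "rf x = x\<^sup>2 + (yf x)\<^sup>2 - 1/2"

definition thetaf :: "real \<Rightarrow> real" where
  "thetaf x = arccos ((1/2 - cf x) / rf x)"

definition D :: "(real \<times> real) set" where
  "D = {(x, \<theta>). x \<in> {sqrt 2 / 2 .. 1} \<and> \<theta> \<in> {0 .. thetaf x}}"

text \<open>The formulas for \<^term>\<open>yf\<close>, \<^term>\<open>cf\<close>, \<^term>\<open>rf\<close> and the following map make sense, and are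
  smooth, beyond \<^term>\<open>D\<close> (the radicand above is always positive), so the ordinary two-sided
  \<^const>\<open>deriv\<close> gives the intended derivatives also at the ends of the interval for \<^term>\<open>x\<close>.\<close>

definition F :: "real \<times> real \<Rightarrow> real \<times> real" where
  "F = (\<lambda>(x, \<theta>). (cf x + rf x * cos \<theta>, rf x * sin \<theta>))"

definition jacobian_F :: "real \<times> real \<Rightarrow> real" where
  "jacobian_F = (\<lambda>(x, \<theta>). deriv cf x * rf x * cos \<theta> + deriv rf x * rf x)"

definition J0 :: "(real \<times> real) set" where
  "J0 = {q \<in> D. jacobian_F q = 0}"

definition pf :: "real \<Rightarrow> real \<times> real" where
  "pf x = (x, arccos (- deriv rf x / deriv cf x))"

definition D2 :: "(real \<times> real) set" where
  "D2 = {(x, \<theta>). x \<in> {5/6 .. 1} \<and> arccos (- deriv rf x / deriv cf x) \<le> \<theta> \<and> \<theta> \<le> thetaf x}"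

definition I1 :: "real \<times> real" where
  "I1 = F (pf 1)"

end

theory Submission
  imports Defs
begin

text \<open>Each segment of a quadrisection halves the area of the triangle, so it cuts off one corner and meets the
  two sides at that corner at the fractions s and 1/(2s) of their lengths, with s between 1/2 and 1. Two such
  segments at the same corner never produce four equal areas (\<open>quarters_same_corner\<close>); so they cut off
  two different corners, say A and B, and enclose together with the side AB a triangle. If they meet AB at the
  distances x from A and y from B, in units of AB, then the four areas are equal iff
  4(x + y - 1)^2 = 2x^2 + 2y^2 - 1. This relation does not depend on the shape of the triangle; it is the
  graph of \<^const>\<open>yf\<close>, an arc of a conic with a rational parametrization x = \<open>xcut m\<close>, y = \<open>xcut (- m)\<close>,
  where m runs from - \<open>mmax\<close> to \<open>mmax\<close> = sqrt 2 - 1. At m = \<open>mmax\<close> one of the segments is a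
  median, and the same pair belongs to the next side BC with m = - \<open>mmax\<close>. There are no other
  coincidences, so the area-quartering pairs form a closed curve made of three half-open intervals, one for
  each side, and the quadrisections are the points of this curve at which the segments are perpendicular
  (\<open>quadrisections_eq\<close>).

  Scale the side AB to the unit interval and let (h,t) be the third vertex. Perpendicularity then says that
  (h,t) lies on the circle with centre (c(x),0) and radius r(x), i.e. that the power of the point (h,t) with
  respect to this circle, \<open>gap h (h^2 + t^2) m\<close>, is zero. The derivative of the power in m is a positive
  multiple of \<open>crit m - (2h - 1)\<close>, where \<open>crit\<close> does not depend on the triangle and is strictly
  increasing (\<open>crit_strict_mono\<close>). So the power first falls and then rises, and has at most two zeros. At
  the ends of the interval it equals AC^2 - AB^2 and BC^2 - AB^2, divided by AB^2. Consequently, if the shortest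
  side is strictly shorter than the other two, the side of middle length contributes exactly one zero, the
  longest side none, and the shortest side none, one double zero, or two zeros.

  The point C' is the third vertex when the shortest side is scaled to the unit interval. At a zero m of its
  power, the inequality 2h - 1 <= \<open>crit m\<close> is the inequality cos \<theta> <= - r'(x)/c'(x) that defines
  \<^const>\<open>D2\<close>, and equality is the vanishing of the Jacobian determinant (\<open>mem_F_D2_iff\<close>,
  \<open>mem_F_J0_iff\<close>). Hence \<^const>\<open>D2\<close> detects the larger one of two zeros, and \<^const>\<open>J0\<close> a double zero. This
  gives 3, 2 and 1 quadrisections. If the two shorter sides have equal length, then C = C', the two sides have
  the same zeros, and the zero m = \<open>mmax\<close> is a pair of segments which they share. Counting the shared pair once
  leaves the result as it is, except when \<open>mmax\<close> itself is the double zero, which happens only for C' = I1: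
  then the single zero of each side is the shared one, and there is one quadrisection instead of two.\<close>

section \<open>The area of a triangle\<close>

definition cross2 :: "real \<times> real \<Rightarrow> real \<times> real \<Rightarrow> real" where
  "cross2 u v = fst u * snd v - snd u * fst v"

definition to_vec :: "real \<times> real \<Rightarrow> real ^ 2" where
  "to_vec z = vector [fst z, snd z]"

lemma to_vec_nth [simp]: "to_vec z $ 1 = fst z" "to_vec z $ 2 = snd z"
  by (simp_all add: to_vec_def)

lemma linear_to_vec: "linear to_vec"
  by (rule linearI) (simp_all add: vec_eq_iff forall_2)

lemma to_vec_measurable [measurable]: "to_vec \<in> borel_measurable borel"
  by (intro borel_measurable_continuous_onI linear_continuous_on linear_conv_bounded_linear[THEN iffD1] linear_to_vec)

text \<open>Identifying pairs with vectors of length two preserves the volume of boxes, hence Lebesgue measure. This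
  transports the determinant formula for the area of a triangle.\<close>

lemma distr_to_vec: "distr lborel borel to_vec = lborel"
proof (rule lborel_eqI[symmetric])
  fix l u :: "real ^ 2"
  assume le: "\<And>b. b \<in> Basis \<Longrightarrow> l \<bullet> b \<le> u \<bullet> b"
  have le12: "l $ 1 \<le> u $ 1" "l $ 2 \<le> u $ 2"
    using le[of "axis 1 1"] le[of "axis 2 1"] by (auto simp: inner_axis Basis_vec_def)
  have pre: "to_vec -` box l u = box (l $ 1, l $ 2) (u $ 1, u $ 2)"
    by (auto simp: mem_box_cart forall_2 mem_box Basis_prod_def)
  have "emeasure (distr lborel borel to_vec) (box l u) = emeasure lborel (to_vec -` box l u)"
    by (subst emeasure_distr) auto
  also have "\<dots> = ennreal ((u $ 1 - l $ 1) * (u $ 2 - l $ 2))"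
    unfolding pre using le12 by (subst emeasure_lborel_box) (auto simp: Basis_prod_def sum.union_disjoint prod.union_disjoint)
  also have "(u $ 1 - l $ 1) * (u $ 2 - l $ 2) = (\<Prod>b\<in>Basis. (u - l) \<bullet> b)"
    by (simp add: Basis_vec_def UNIV_2 inner_axis axis_eq_axis)
  finally show "emeasure (distr lborel borel to_vec) (box l u) = ennreal (\<Prod>b\<in>Basis. (u - l) \<bullet> b)" .
qed auto

lemma measure_triangle:
  "measure lebesgue (convex hull {A, B, C}) = \<bar>cross2 (B - A) (C - A)\<bar> / 2"
proof -
  have inj: "inj to_vec"
    by (rule injI) (metis prod_eqI to_vec_nth)
  have hull: "to_vec ` (convex hull {A, B, C}) = convex hull {to_vec A, to_vec B, to_vec C}"
    by (simp add: convex_hull_linear_image[OF linear_to_vec])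
  have cpt: "compact (convex hull {to_vec A, to_vec B, to_vec C})"
    by (intro finite_imp_compact_convex_hull) auto
  have cpt': "compact (convex hull {A, B, C})"
    by (intro finite_imp_compact_convex_hull) auto
  have "emeasure lborel (convex hull {to_vec A, to_vec B, to_vec C})
      = emeasure (distr lborel borel to_vec) (convex hull {to_vec A, to_vec B, to_vec C})"
    by (simp add: distr_to_vec)
  also have "\<dots> = emeasure lborel (to_vec -` (convex hull {to_vec A, to_vec B, to_vec C}))"
    using cpt by (subst emeasure_distr) (auto intro!: borel_compact)
  also have "to_vec -` (convex hull {to_vec A, to_vec B, to_vec C}) = convex hull {A, B, C}"
    unfolding hull[symmetric] using inj by (simp add: inj_vimage_image_eq)
  finally have "measure lborel (convex hull {A, B, C})
      = measure lborel (convex hull {to_vec A, to_vec B, to_vec C})"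
    by (simp add: Sigma_Algebra.measure_def)
  also have "\<dots> = \<bar>cross2 (B - A) (C - A)\<bar> / 2"
    unfolding content_triangle by (simp add: cross2_def algebra_simps abs_minus_commute)
  finally show ?thesis
    using cpt' by (simp add: borel_compact)
qed

section \<open>Quarters of a convex body\<close>

text \<open>Requiring \<open>n \<noteq> 0\<close> makes the zero set a line, in particular a null set.\<close>

definition affine_form :: "(real \<times> real \<Rightarrow> real) \<Rightarrow> bool" where
  "affine_form f \<longleftrightarrow> (\<exists>n k. n \<noteq> 0 \<and> f = (\<lambda>z. n \<bullet> z + k))"

lemma affine_form_uminus: "affine_form f \<Longrightarrow> affine_form (\<lambda>z. - f z)"
  unfolding affine_form_def
proof (elim exE conjE)
  fix n k assume "n \<noteq> 0" "f = (\<lambda>z. n \<bullet> z + k)"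
  then show "\<exists>n k. n \<noteq> 0 \<and> (\<lambda>z. - f z) = (\<lambda>z. n \<bullet> z + k)"
    by (intro exI[of _ "-n"] exI[of _ "-k"]) auto
qed

lemma affine_form_affine:
  assumes "affine_form f"
  shows "f ((1 - t) *\<^sub>R z + t *\<^sub>R w) = (1 - t) * f z + t * f w"
  using assms by (auto simp: affine_form_def inner_add_right algebra_simps)

lemma negligible_zero_set: "affine_form f \<Longrightarrow> negligible {z. f z = 0}"
proof -
  assume "affine_form f"
  then obtain n k where n: "n \<noteq> 0" "f = (\<lambda>z. n \<bullet> z + k)" by (auto simp: affine_form_def)
  have "{z. f z = 0} = {z. n \<bullet> z = - k}" using n by auto
  then show ?thesis using negligible_hyperplane[of n "- k"] n by simp
qed

lemma convex_half: "affine_form f \<Longrightarrow> convex {z. f z < 0}" "affine_form f \<Longrightarrow> convex {z. f z \<le> 0}"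
proof -
  assume "affine_form f"
  then obtain n k where n: "n \<noteq> 0" "f = (\<lambda>z. n \<bullet> z + k)" by (auto simp: affine_form_def)
  have "{z. f z < 0} = {z. n \<bullet> z < - k}" "{z. f z \<le> 0} = {z. n \<bullet> z \<le> - k}" using n by auto
  then show "convex {z. f z < 0}" "convex {z. f z \<le> 0}"
    using convex_halfspace_lt convex_halfspace_le by auto
qed

lemma affine_form_continuous: "affine_form f \<Longrightarrow> continuous_on S f"
  by (auto simp: affine_form_def intro!: continuous_intros)

lemma measure_split:
  assumes S: "convex S" "bounded S" and f: "affine_form f"
  shows "measure lebesgue S = measure lebesgue {z\<in>S. f z \<le> 0} + measure lebesgue {z\<in>S. - f z \<le> 0}"
proof -
  have cv: "convex {z\<in>S. f z < 0}" "convex {z\<in>S. - f z \<le> 0}"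
    using convex_Int[OF S(1) convex_half(1)[OF f]]
      convex_Int[OF S(1) convex_half(2)[OF affine_form_uminus[OF f]]]
    by (auto simp: Int_def)
  have bd: "bounded {z\<in>S. f z < 0}" "bounded {z\<in>S. - f z \<le> 0}"
    using S(2) by (auto intro: bounded_subset)
  have "measure lebesgue S = measure lebesgue ({z\<in>S. f z < 0} \<union> {z\<in>S. - f z \<le> 0})"
    by (rule arg_cong[where f = "measure lebesgue"]) auto
  also have "\<dots> = measure lebesgue {z\<in>S. f z < 0} + measure lebesgue ({z\<in>S. - f z \<le> 0} - {z\<in>S. f z < 0})"
    using cv bd by (intro measure_Un2 measurable_convex)
  also have "{z\<in>S. - f z \<le> 0} - {z\<in>S. f z < 0} = {z\<in>S. - f z \<le> 0}" by auto
  also have "measure lebesgue {z\<in>S. f z < 0} = measure lebesgue {z\<in>S. f z \<le> 0}"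
    using cv bd
    by (intro measure_negligible_symdiff[symmetric] measurable_convex negligible_subset[OF negligible_zero_set[OF f]]) auto
  finally show ?thesis .
qed

definition quadrant :: "(real \<times> real) set \<Rightarrow> (real \<times> real \<Rightarrow> real) \<Rightarrow> (real \<times> real \<Rightarrow> real) \<Rightarrow> (real \<times> real) set" where
  "quadrant T f g = {z\<in>T. f z < 0 \<and> g z < 0}"

lemma convex_quadrant:
  assumes "convex T" "affine_form f" "affine_form g"
  shows "convex (quadrant T f g)"
proof -
  have "quadrant T f g = T \<inter> {z. f z < 0} \<inter> {z. g z < 0}" by (auto simp: quadrant_def)
  then show ?thesis using assms by (auto intro!: convex_Int convex_half)
qed

text \<open>The regions of a quadrisection are open quadrants of the triangle, but it is the closed quadrants that are
  polygons. They differ by a null set.\<close>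

lemma measure_quadrant:
  assumes "convex T" "bounded T" and f: "affine_form f" and g: "affine_form g"
  shows "measure lebesgue (quadrant T f g) = measure lebesgue {z\<in>T. f z \<le> 0 \<and> g z \<le> 0}"
proof (rule measure_negligible_symdiff[symmetric])
  show "quadrant T f g \<in> lmeasurable"
    using assms by (intro measurable_convex convex_quadrant) (auto simp: quadrant_def intro: bounded_subset)
  show "negligible (quadrant T f g - {z\<in>T. f z \<le> 0 \<and> g z \<le> 0} \<union> ({z\<in>T. f z \<le> 0 \<and> g z \<le> 0} - quadrant T f g))"
    by (rule negligible_subset[OF negligible_Un[OF negligible_zero_set[OF f] negligible_zero_set[OF g]]])
      (auto simp: quadrant_def)
qed

text \<open>By additivity the areas of the two halves and of one quadrant, together with the total, determine the areas
  of all four quadrants. So only regions bounded by at most two chords have to be measured.\<close>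

lemma equal_quadrants_iff:
  assumes T: "convex T" "bounded T" and f: "affine_form f" and g: "affine_form g"
  shows "(\<exists>a. \<forall>R \<in> {quadrant T f g, quadrant T f (\<lambda>z. - g z), quadrant T (\<lambda>z. - f z) g,
             quadrant T (\<lambda>z. - f z) (\<lambda>z. - g z)}. measure lebesgue R = a)
     \<longleftrightarrow> measure lebesgue {z\<in>T. f z \<le> 0} = measure lebesgue T / 2 \<and>
         measure lebesgue {z\<in>T. g z \<le> 0} = measure lebesgue T / 2 \<and>
         measure lebesgue {z\<in>T. f z \<le> 0 \<and> g z \<le> 0} = measure lebesgue T / 4"
proof -
  have *: "measure lebesgue {z\<in>T. u z \<le> 0} = measure lebesgue {z\<in>T. u z \<le> 0 \<and> v z \<le> 0}
      + measure lebesgue {z\<in>T. u z \<le> 0 \<and> - v z \<le> 0}"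
    if uv: "affine_form u" "affine_form v" for u v
  proof -
    have "convex {z\<in>T. u z \<le> 0}"
      using convex_Int[OF T(1) convex_half(2)[OF uv(1)]] by (auto simp: Int_def)
    moreover have "bounded {z\<in>T. u z \<le> 0}" using T(2) by (auto intro: bounded_subset)
    ultimately show ?thesis
      using measure_split[of "{z\<in>T. u z \<le> 0}" v] uv by (simp add: conj_assoc)
  qed
  note f' = affine_form_uminus[OF f] and g' = affine_form_uminus[OF g]
  have "measure lebesgue T = measure lebesgue {z\<in>T. f z \<le> 0} + measure lebesgue {z\<in>T. - f z \<le> 0}"
    by (rule measure_split[OF T f])
  moreover have "measure lebesgue {z\<in>T. g z \<le> 0} = measure lebesgue {z\<in>T. f z \<le> 0 \<and> g z \<le> 0}
      + measure lebesgue {z\<in>T. - f z \<le> 0 \<and> g z \<le> 0}"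
    using *[OF g f] by (simp add: conj_commute)
  moreover have all_equal: "(\<exists>a. \<forall>R \<in> {R1, R2, R3, R4}. \<mu> R = a) \<longleftrightarrow> \<mu> R2 = \<mu> R1 \<and> \<mu> R3 = \<mu> R1 \<and> \<mu> R4 = \<mu> R1"
    for R1 R2 R3 R4 :: "(real \<times> real) set" and \<mu> :: "_ \<Rightarrow> real"
    by auto
  ultimately show ?thesis
    using *[OF f g] *[OF f' g]
    unfolding all_equal measure_quadrant[OF T f g] measure_quadrant[OF T f g']
      measure_quadrant[OF T f' g] measure_quadrant[OF T f' g'] by linarith
qed

lemma orthogonal_in_plane:
  fixes n u w :: "real \<times> real"
  assumes "n \<noteq> 0" "n \<bullet> u = 0" "n \<bullet> w = 0" "u \<noteq> 0"
  obtains t where "w = t *\<^sub>R u"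
proof -
  define t where "t = (w \<bullet> u) / (u \<bullet> u)"
  obtain n1 n2 u1 u2 w1 w2 where e: "n = (n1, n2)" "u = (u1, u2)" "w = (w1, w2)"
    by (metis surj_pair)
  have 1: "n1 * u1 + n2 * u2 = 0" "n1 * w1 + n2 * w2 = 0" using assms e by auto
  have n: "n1 \<noteq> 0 \<or> n2 \<noteq> 0" using assms e by (auto simp: zero_prod_def)
  have u: "u1 \<noteq> 0 \<or> u2 \<noteq> 0" using assms e by (auto simp: zero_prod_def)
  have cross2: "u1 * w2 = u2 * w1"
  proof -
    have "n1 * (u1 * w2 - u2 * w1) = 0" "n2 * (u1 * w2 - u2 * w1) = 0"
      using 1 by algebra+
    then show ?thesis using n by auto
  qed
  have pos: "u1 * u1 + u2 * u2 \<noteq> 0" using u by (simp add: sum_squares_eq_zero_iff)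
  have "w1 * (u1 * u1 + u2 * u2) = (w1 * u1 + w2 * u2) * u1"
    "w2 * (u1 * u1 + u2 * u2) = (w1 * u1 + w2 * u2) * u2"
    using cross2 by algebra+
  then have "w = t *\<^sub>R u" using pos e by (simp add: t_def field_simps)
  then show ?thesis using that by blast
qed

text \<open>If T contained a point of the line beyond b, then b would lie strictly between this point and the interior
  point P, and would itself be an interior point.\<close>

lemma chord_eq_line_section:
  assumes T: "convex T" "closed T" and ab: "a \<in> frontier T" "b \<in> frontier T"
    and P: "P \<in> interior T" "P \<in> closed_segment a b"
    and f: "affine_form f" "f a = 0" "f b = 0"
  shows "{z\<in>T. f z = 0} = closed_segment a b"
proof
  have ab': "a \<in> T" "b \<in> T" "a \<notin> interior T" "b \<notin> interior T"
    using ab T by (auto simp: frontier_def)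
  show "closed_segment a b \<subseteq> {z\<in>T. f z = 0}"
  proof
    fix z assume z: "z \<in> closed_segment a b"
    then have "z \<in> T" using ab' T closed_segment_subset by blast
    moreover obtain t where "z = (1 - t) *\<^sub>R a + t *\<^sub>R b" using z by (auto simp: in_segment)
    ultimately show "z \<in> {z\<in>T. f z = 0}" using affine_form_affine[OF f(1)] f by auto
  qed
  show "{z\<in>T. f z = 0} \<subseteq> closed_segment a b"
  proof
    fix z assume "z \<in> {z\<in>T. f z = 0}"
    then have z: "z \<in> T" "f z = 0" by auto
    obtain n k where n: "n \<noteq> 0" "f = (\<lambda>z. n \<bullet> z + k)" using f by (auto simp: affine_form_def)
    have "a \<noteq> b" using P ab' by auto
    have "n \<bullet> (b - a) = 0" "n \<bullet> (z - a) = 0" using f z n by (auto simp: inner_diff_right)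
    then obtain s where s: "z - a = s *\<^sub>R (b - a)"
      using orthogonal_in_plane[OF n(1)] \<open>a \<noteq> b\<close> by (metis right_minus_eq)
    have beyond: "q \<le> 1"
      if q: "z = (1 - q) *\<^sub>R c + q *\<^sub>R d" and cd: "d \<in> T" "d \<notin> interior T" "P \<in> closed_segment c d" for q c d
    proof (rule ccontr)
      assume "\<not> q \<le> 1"
      then have q1: "q > 1" by simp
      obtain p where p: "P = (1 - p) *\<^sub>R c + p *\<^sub>R d" "0 \<le> p" "p \<le> 1" using cd by (auto simp: in_segment)
      have "P \<noteq> d" using P cd by auto
      then have "p \<noteq> 1" using p by auto
      then have p1: "p < 1" using p by simp
      \<comment> \<open>d is the point at fraction v of the way from P to z\<close>
      define v where "v = (1 - p) / (q - p)"
      have v: "0 < v" "v < 1" using p1 q1 p by (auto simp: v_def field_simps)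
      have vqp: "v * (q - p) = 1 - p" using p1 q1 by (simp add: v_def)
      have "(1 - v) *\<^sub>R P + v *\<^sub>R z = c + (p + v * (q - p)) *\<^sub>R (d - c)"
        unfolding p(1) q by (simp add: algebra_simps)
      then have d: "d = (1 - v) *\<^sub>R P + v *\<^sub>R z" using vqp by simp
      have "c \<noteq> d" using \<open>P \<noteq> d\<close> p by (auto simp: algebra_simps)
      have "P \<noteq> z"
      proof
        assume "P = z"
        then have "(q - p) *\<^sub>R (d - c) = 0" using p(1) q by (simp add: algebra_simps)
        then show False using \<open>c \<noteq> d\<close> p1 q1 by simp
      qed
      then have "d \<in> open_segment P z" using d v by (auto simp: in_segment)
      then have "d \<in> interior T"
        using in_interior_closure_convex_segment[OF T(1) P(1), of z] z closure_subset by blast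
      then show False using cd by simp
    qed
    have "z = (1 - s) *\<^sub>R a + s *\<^sub>R b" using s by (simp add: algebra_simps)
    moreover from this have "s \<le> 1" using beyond[of s a b] ab' P by auto
    moreover have "z = (1 - (1 - s)) *\<^sub>R b + (1 - s) *\<^sub>R a" using s by (simp add: algebra_simps)
    then have "1 - s \<le> 1" using beyond[of "1 - s" b a] ab' P by (auto simp: closed_segment_commute)
    ultimately show "z \<in> closed_segment a b" by (auto simp: in_segment)
  qed
qed

text \<open>A connected set on which neither form vanishes cannot contain points with different signs of either form.\<close>

lemma quadrant_component:
  assumes T: "convex T" and f: "affine_form f" and g: "affine_form g" and x: "x \<in> quadrant T f g"
  shows "connected_component_set (T - {z\<in>T. f z = 0 \<or> g z = 0}) x = quadrant T f g"
proof (rule connected_component_unique)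
  show "x \<in> quadrant T f g" by fact
  show "quadrant T f g \<subseteq> T - {z\<in>T. f z = 0 \<or> g z = 0}" by (auto simp: quadrant_def)
  show "connected (quadrant T f g)" using convex_quadrant[OF T f g] by (rule convex_connected)
  fix K assume K: "x \<in> K" "K \<subseteq> T - {z\<in>T. f z = 0 \<or> g z = 0}" "connected K"
  have neg: "u z < 0" if u: "affine_form u" "u x < 0" "\<And>z. z \<in> K \<Longrightarrow> u z \<noteq> 0" and z: "z \<in> K" for u z
  proof (rule ccontr)
    assume "\<not> u z < 0"
    moreover have "connected (u ` K)"
      using connected_continuous_image[OF affine_form_continuous[OF u(1)] K(3)] .
    ultimately have "0 \<in> u ` K"
      using connectedD_interval[of "u ` K" "u x" "u z" 0] K(1) z u(2) by simp
    then show False using u(3) by auto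
  qed
  show "K \<subseteq> quadrant T f g"
  proof
    fix z assume z: "z \<in> K"
    have nz: "z \<in> T" "f z \<noteq> 0" "g z \<noteq> 0" if "z \<in> K" for z using K(2) that by blast+
    have "f z < 0" using neg[OF f _ nz(2) z] x by (simp add: quadrant_def)
    moreover have "g z < 0" using neg[OF g _ nz(3) z] x by (simp add: quadrant_def)
    ultimately show "z \<in> quadrant T f g" using nz[OF z] by (simp add: quadrant_def)
  qed
qed

text \<open>The normal vectors of the two forms are independent, since otherwise both chords would be the same section of
  T; so the values of the two forms can be prescribed. The direction w enters the quadrant in which both are
  negative.\<close>

lemma transversal_forms:
  assumes T: "convex T" "closed T" and ab: "a \<in> frontier T"
    and f: "affine_form f" "{z\<in>T. f z = 0} = closed_segment a b"
    and g: "affine_form g" "{z\<in>T. g z = 0} = closed_segment c d"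
    and P: "P \<in> interior T" "closed_segment a b \<inter> closed_segment c d = {P}"
  obtains w where "\<And>t. f (P + t *\<^sub>R w) = - t" "\<And>t. g (P + t *\<^sub>R w) = - t"
proof -
  have PP: "f P = 0" "g P = 0" using P(2) f(2) g(2) by auto
  obtain n k where n: "n \<noteq> 0" "f = (\<lambda>z. n \<bullet> z + k)" using f by (auto simp: affine_form_def)
  obtain m l where m: "m \<noteq> 0" "g = (\<lambda>z. m \<bullet> z + l)" using g by (auto simp: affine_form_def)
  obtain n1 n2 m1 m2 where e: "n = (n1, n2)" "m = (m1, m2)" by (metis surj_pair)
  have n0: "n1 \<noteq> 0 \<or> n2 \<noteq> 0" and m0: "m1 \<noteq> 0 \<or> m2 \<noteq> 0"
    using n m e by (auto simp: zero_prod_def)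
  define D where "D = n1 * m2 - n2 * m1"
  have "D \<noteq> 0"
  proof
    assume "D = 0"
    then have D: "n1 * m2 = n2 * m1" by (simp add: D_def)
    have "f z = 0 \<longleftrightarrow> g z = 0" for z
    proof -
      obtain z1 z2 where z: "z - P = (z1, z2)" by (metis surj_pair)
      have fz: "f z = n1 * z1 + n2 * z2"
        using PP n inner_diff_right[of n z P] by (simp add: e z)
      have gz: "g z = m1 * z1 + m2 * z2"
        using PP m inner_diff_right[of m z P] by (simp add: e z)
      have "n1 * g z = m1 * f z" "n2 * g z = m2 * f z" using D unfolding fz gz by algebra+
      then show ?thesis using n0 m0 by (metis mult_eq_0_iff)
    qed
    then have "closed_segment a b = closed_segment c d" using f g by auto
    then have "closed_segment a b = {P}" using P(2) by (simp del: closed_segment_eq)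
    then have "a = P" using ends_in_segment(1)[of a b] by simp
    then show False using ab P by (auto simp: frontier_def)
  qed
  define w where "w = ((n2 - m2) / D, (m1 - n1) / D)"
  have "n \<bullet> w = -1" "m \<bullet> w = -1"
    using \<open>D \<noteq> 0\<close> e by (auto simp: w_def field_simps) (auto simp: D_def algebra_simps)
  then have "f (P + t *\<^sub>R w) = - t" "g (P + t *\<^sub>R w) = - t" for t
    using PP n m by (auto simp: inner_add_right)
  then show ?thesis using that by blast
qed

lemma quadrant_nonempty:
  assumes T: "convex T" "closed T" and ab: "a \<in> frontier T"
    and f: "affine_form f" "{z\<in>T. f z = 0} = closed_segment a b"
    and g: "affine_form g" "{z\<in>T. g z = 0} = closed_segment c d"
    and P: "P \<in> interior T" "closed_segment a b \<inter> closed_segment c d = {P}"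
  shows "quadrant T f g \<noteq> {}"
proof -
  obtain w where w: "\<And>t. f (P + t *\<^sub>R w) = - t" "\<And>t. g (P + t *\<^sub>R w) = - t"
    using transversal_forms[OF assms] by blast
  obtain e where e: "e > 0" "ball P e \<subseteq> T" using P(1) by (meson mem_interior)
  define t where "t = e / (2 * (norm w + 1))"
  have nw: "norm w + 1 > 0" using norm_ge_zero[of w] by linarith
  have t: "t > 0" using e nw by (simp add: t_def)
  have "norm (t *\<^sub>R w) = e / 2 * (norm w / (norm w + 1))" using e nw by (simp add: t_def)
  also have "\<dots> \<le> e / 2 * 1" using e nw by (intro mult_left_mono) (auto simp: field_simps)
  also have "\<dots> < e" using e by simp
  finally have "P + t *\<^sub>R w \<in> T" using e by (auto simp: dist_norm)
  then have "P + t *\<^sub>R w \<in> quadrant T f g" using w t by (simp add: quadrant_def)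
  then show ?thesis by blast
qed

text \<open>Reduces the topological definition of the four regions to areas of polygons: two chords that cross in the
  interior always leave four components, namely the open quadrants.\<close>

lemma divides_iff_areas:
  assumes T: "convex T" "compact T"
    and fr: "{a, b, c, d} \<subseteq> frontier T"
    and P: "P \<in> interior T" "closed_segment a b \<inter> closed_segment c d = {P}"
    and f: "affine_form f" "f a = 0" "f b = 0"
    and g: "affine_form g" "g c = 0" "g d = 0"
  shows "divides_into_four_equal T (closed_segment a b \<union> closed_segment c d) \<longleftrightarrow>
         measure lebesgue {z\<in>T. f z \<le> 0} = measure lebesgue T / 2 \<and>
         measure lebesgue {z\<in>T. g z \<le> 0} = measure lebesgue T / 2 \<and>
         measure lebesgue {z\<in>T. f z \<le> 0 \<and> g z \<le> 0} = measure lebesgue T / 4"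
proof -
  have cl: "closed T" "bounded T" using T by (auto simp: compact_imp_closed compact_imp_bounded)
  have sf: "{z\<in>T. f z = 0} = closed_segment a b"
    using chord_eq_line_section[OF T(1) cl(1) _ _ P(1) _ f] fr P by auto
  have sg: "{z\<in>T. g z = 0} = closed_segment c d"
    using chord_eq_line_section[OF T(1) cl(1) _ _ P(1) _ g] fr P by auto
  note f' = affine_form_uminus[OF f(1)] and g' = affine_form_uminus[OF g(1)]
  have sf': "{z\<in>T. - f z = 0} = closed_segment a b" using sf by auto
  have sg': "{z\<in>T. - g z = 0} = closed_segment c d" using sg by auto
  define f2 where "f2 = (\<lambda>z. - f z)"
  define g2 where "g2 = (\<lambda>z. - g z)"
  define \<R> where "\<R> = {quadrant T f g, quadrant T f g2, quadrant T f2 g, quadrant T f2 g2}"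
  have a: "a \<in> frontier T" using fr by auto
  have ne: "quadrant T f g \<noteq> {}" "quadrant T f g2 \<noteq> {}" "quadrant T f2 g \<noteq> {}" "quadrant T f2 g2 \<noteq> {}"
    using quadrant_nonempty[OF T(1) cl(1) a f(1) sf g(1) sg P]
      quadrant_nonempty[OF T(1) cl(1) a f(1) sf g' sg' P]
      quadrant_nonempty[OF T(1) cl(1) a f' sf' g(1) sg P]
      quadrant_nonempty[OF T(1) cl(1) a f' sf' g' sg' P] by (auto simp: f2_def g2_def)
  have disj: "quadrant T f g \<inter> quadrant T f g2 = {}" "quadrant T f g \<inter> quadrant T f2 g = {}"
    "quadrant T f g \<inter> quadrant T f2 g2 = {}" "quadrant T f g2 \<inter> quadrant T f2 g = {}"
    "quadrant T f g2 \<inter> quadrant T f2 g2 = {}" "quadrant T f2 g \<inter> quadrant T f2 g2 = {}"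
    by (auto simp: quadrant_def f2_def g2_def)
  have card: "card \<R> = 4"
  proof -
    have "A \<noteq> B" if "A \<noteq> {}" "A \<inter> B = {}" for A B :: "(real \<times> real) set"
      using that by auto
    then show ?thesis
      using ne disj unfolding \<R>_def by simp
  qed
  define U where "U = T - {z\<in>T. f z = 0 \<or> g z = 0}"
  have U: "T - (closed_segment a b \<union> closed_segment c d) = U"
    using sf sg by (auto simp: U_def)
  have Ucomp: "connected_component_set U x = R" if "x \<in> R" "R \<in> \<R>" for x R
    using that quadrant_component[OF T(1) f(1) g(1), of x] quadrant_component[OF T(1) f' g(1), of x]
      quadrant_component[OF T(1) f(1) g', of x] quadrant_component[OF T(1) f' g', of x]
    by (auto simp: \<R>_def f2_def g2_def U_def)
  have Ucov: "U = \<Union>\<R>"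
    by (auto simp: U_def \<R>_def quadrant_def f2_def g2_def)
  have comp: "components U = \<R>"
  proof
    show "components U \<subseteq> \<R>"
    proof
      fix K assume "K \<in> components U"
      then obtain x where x: "x \<in> U" "K = connected_component_set U x" by (auto simp: components_iff)
      then obtain R where "x \<in> R" "R \<in> \<R>" using Ucov by auto
      then show "K \<in> \<R>" using x Ucomp by auto
    qed
    show "\<R> \<subseteq> components U"
    proof
      fix R assume R: "R \<in> \<R>"
      then obtain x where x: "x \<in> R" using ne by (auto simp: \<R>_def)
      then have "x \<in> U" using R Ucov by auto
      then show "R \<in> components U" using Ucomp[OF x R] unfolding components_iff by blast
    qed
  qed
  show ?thesis
    unfolding divides_into_four_equal_def U comp card
    using equal_quadrants_iff[OF T(1) cl(2) f(1) g(1)] by (simp add: \<R>_def f2_def g2_def)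
qed

section \<open>Barycentric coordinates\<close>

definition nondegenerate :: "real \<times> real \<Rightarrow> real \<times> real \<Rightarrow> real \<times> real \<Rightarrow> bool" where
  "nondegenerate A B C \<longleftrightarrow> cross2 (B - A) (C - A) \<noteq> 0"

text \<open>The barycentric coordinate at the vertex A, as a ratio of signed areas. Rotating the arguments gives the other
  two, so a statement about one corner or side applies to all three.\<close>

definition bary :: "real \<times> real \<Rightarrow> real \<times> real \<Rightarrow> real \<times> real \<Rightarrow> real \<times> real \<Rightarrow> real" where
  "bary A B C z = cross2 (B - z) (C - z) / cross2 (B - A) (C - A)"

lemma cross2_rotate: "cross2 (C - B) (A - B) = cross2 (B - A) (C - A)"
  by (simp add: cross2_def algebra_simps)

lemma nondegenerate_rotate: "nondegenerate A B C \<Longrightarrow> nondegenerate B C A"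
  by (simp add: nondegenerate_def cross2_rotate[of C B A])

lemma hull_rotate: "convex hull {B, C, A} = convex hull {A, B, C}"
  by (simp add: insert_commute)

lemma bary_sum:
  assumes "nondegenerate A B C"
  shows "bary A B C z + bary B C A z + bary C A B z = 1"
proof -
  have "cross2 (A - C) (B - C) = cross2 (B - A) (C - A)" by (simp add: cross2_def algebra_simps)
  moreover have "cross2 (B - z) (C - z) + cross2 (C - z) (A - z) + cross2 (A - z) (B - z) = cross2 (B - A) (C - A)"
    by (simp add: cross2_def algebra_simps)
  ultimately show ?thesis
    using assms by (simp add: bary_def nondegenerate_def cross2_rotate[of C B A] flip: add_divide_distrib)
qed

lemma bary_point:
  assumes "nondegenerate A B C"
  shows "bary A B C (A + u *\<^sub>R (B - A) + v *\<^sub>R (C - A)) = 1 - u - v"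
    and "bary B C A (A + u *\<^sub>R (B - A) + v *\<^sub>R (C - A)) = u"
    and "bary C A B (A + u *\<^sub>R (B - A) + v *\<^sub>R (C - A)) = v"
proof -
  let ?z = "A + u *\<^sub>R (B - A) + v *\<^sub>R (C - A)"
  have nz: "cross2 (B - A) (C - A) \<noteq> 0" using assms by (simp add: nondegenerate_def)
  have "cross2 (C - ?z) (A - ?z) = u * cross2 (C - B) (A - B)" "cross2 (A - ?z) (B - ?z) = v * cross2 (A - C) (B - C)"
    by (simp_all add: cross2_def algebra_simps)
  moreover have "cross2 (A - C) (B - C) = cross2 (B - A) (C - A)" by (simp add: cross2_def algebra_simps)
  ultimately show *: "bary B C A ?z = u" "bary C A B ?z = v"
    using nz by (simp_all add: bary_def cross2_rotate[of C B A])
  show "bary A B C ?z = 1 - u - v" using bary_sum[OF assms, of ?z] * by simp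
qed

lemma point_bary:
  assumes "nondegenerate A B C"
  shows "z = A + bary B C A z *\<^sub>R (B - A) + bary C A B z *\<^sub>R (C - A)"
proof -
  have nz: "cross2 (B - A) (C - A) \<noteq> 0" using assms by (simp add: nondegenerate_def)
  have "cross2 (B - A) (C - A) *\<^sub>R (z - A) = cross2 (C - z) (A - z) *\<^sub>R (B - A) + cross2 (A - z) (B - z) *\<^sub>R (C - A)"
    by (rule prod_eqI) (simp_all add: cross2_def algebra_simps)
  moreover have "cross2 (A - C) (B - C) = cross2 (B - A) (C - A)" by (simp add: cross2_def algebra_simps)
  ultimately have "cross2 (B - A) (C - A) *\<^sub>R (z - A)
      = cross2 (B - A) (C - A) *\<^sub>R (bary B C A z *\<^sub>R (B - A) + bary C A B z *\<^sub>R (C - A))"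
    using nz by (simp add: bary_def cross2_rotate[of C B A] scaleR_add_right)
  then have "z - A = bary B C A z *\<^sub>R (B - A) + bary C A B z *\<^sub>R (C - A)" using nz by simp
  then show ?thesis by (simp add: algebra_simps)
qed

lemma mem_triangle_iff:
  assumes "nondegenerate A B C"
  shows "z \<in> convex hull {A, B, C} \<longleftrightarrow> bary A B C z \<ge> 0 \<and> bary B C A z \<ge> 0 \<and> bary C A B z \<ge> 0"
proof
  assume "z \<in> convex hull {A, B, C}"
  then obtain u v where "0 \<le> u" "0 \<le> v" "u + v \<le> 1" "z = A + u *\<^sub>R (B - A) + v *\<^sub>R (C - A)"
    by (auto simp: convex_hull_3_alt)
  then show "bary A B C z \<ge> 0 \<and> bary B C A z \<ge> 0 \<and> bary C A B z \<ge> 0"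
    using bary_point[OF assms, of u v] by simp
next
  assume "bary A B C z \<ge> 0 \<and> bary B C A z \<ge> 0 \<and> bary C A B z \<ge> 0"
  then show "z \<in> convex hull {A, B, C}"
    using point_bary[OF assms, of z] bary_sum[OF assms, of z] unfolding convex_hull_3_alt
    by (intro CollectI exI[of _ "bary B C A z"] exI[of _ "bary C A B z"]) auto
qed

lemma affine_form_bary:
  assumes "nondegenerate A B C" "p \<noteq> 0 \<or> q \<noteq> 0"
  shows "affine_form (\<lambda>z. p * bary B C A z + q * bary C A B z + k)"
proof -
  define D where "D = cross2 (B - A) (C - A)"
  have D: "D \<noteq> 0" using assms by (simp add: nondegenerate_def D_def)
  have cr3: "cross2 (A - C) (B - C) = D" "cross2 (C - B) (A - B) = D" by (simp_all add: cross2_def D_def algebra_simps)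
  define n where "n = (p / D) *\<^sub>R (snd (C - A), - fst (C - A)) + (q / D) *\<^sub>R (- snd (B - A), fst (B - A))"
  have n: "n \<bullet> (z - A) = p * bary B C A z + q * bary C A B z" for z
  proof -
    have "n \<bullet> (z - A) = p / D * cross2 (C - z) (A - z) + q / D * cross2 (A - z) (B - z)"
      by (cases z; cases A; cases B; cases C)
        (simp add: n_def cross2_def inner_add_left algebra_simps add_divide_distrib diff_divide_distrib)
    then show ?thesis by (simp add: bary_def cr3)
  qed
  have eq: "p * bary B C A z + q * bary C A B z + k = n \<bullet> z + (k - n \<bullet> A)" for z
    using n[of z] by (simp add: inner_diff_right)
  have "n \<bullet> (B - A) = p" "n \<bullet> (C - A) = q"
    using n[of B] n[of C] bary_point[OF assms(1), of 1 0] bary_point[OF assms(1), of 0 1] by simp_all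
  then have "n \<noteq> 0" using assms(2) by auto
  then show ?thesis unfolding affine_form_def eq by blast
qed

lemma interior_triangle_iff:
  assumes nd: "nondegenerate A B C"
  shows "z \<in> interior (convex hull {A, B, C}) \<longleftrightarrow> bary A B C z > 0 \<and> bary B C A z > 0 \<and> bary C A B z > 0"
proof
  have pos: "bary B C A z > 0" if nd: "nondegenerate A B C" and z: "z \<in> interior (convex hull {A, B, C})" for A B C
  proof -
    have "affine_form (\<lambda>z. 1 * bary B C A z + 0 * bary C A B z + 0)" by (rule affine_form_bary[OF nd]) simp
    then obtain n k where n: "n \<noteq> 0" "bary B C A = (\<lambda>z. n \<bullet> z + k)" by (auto simp: affine_form_def)
    have "convex hull {A, B, C} \<subseteq> {z. n \<bullet> z \<ge> - k}"
    proof
      fix w assume "w \<in> convex hull {A, B, C}"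
      then have "bary B C A w \<ge> 0" using mem_triangle_iff[OF nd, of w] by simp
      then show "w \<in> {z. n \<bullet> z \<ge> - k}" using n by simp
    qed
    then have "z \<in> interior {z. n \<bullet> z \<ge> - k}" using z interior_mono by blast
    then show ?thesis using n by simp
  qed
  assume z: "z \<in> interior (convex hull {A, B, C})"
  show "bary A B C z > 0 \<and> bary B C A z > 0 \<and> bary C A B z > 0"
    using pos[OF nd z] pos[OF nondegenerate_rotate[OF nd]]
      pos[OF nondegenerate_rotate[OF nondegenerate_rotate[OF nd]]] z
    by (simp add: insert_commute)
next
  assume z: "bary A B C z > 0 \<and> bary B C A z > 0 \<and> bary C A B z > 0"
  have cont: "continuous_on UNIV (bary A B C)" if "nondegenerate A B C" for A B C
    using affine_form_continuous[OF affine_form_bary[OF nondegenerate_rotate[OF nondegenerate_rotate[OF that]], of 1 0 0]]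
    by simp
  let ?S = "{z. bary A B C z > 0} \<inter> {z. bary B C A z > 0} \<inter> {z. bary C A B z > 0}"
  have "open ?S"
    by (intro open_Int open_Collect_less continuous_on_const cont nd nondegenerate_rotate)
  moreover have "?S \<subseteq> convex hull {A, B, C}"
    using mem_triangle_iff[OF nd] by (auto intro: less_imp_le)
  ultimately show "z \<in> interior (convex hull {A, B, C})"
    using z by (auto intro: interiorI)
qed

lemma compact_triangle: "compact (convex hull {A, B, C :: real \<times> real})"
  by (intro finite_imp_compact_convex_hull) auto

lemma frontier_triangle_iff:
  assumes nd: "nondegenerate A B C"
  shows "z \<in> frontier (convex hull {A, B, C}) \<longleftrightarrow>
    bary A B C z \<ge> 0 \<and> bary B C A z \<ge> 0 \<and> bary C A B z \<ge> 0 \<and> (bary A B C z = 0 \<or> bary B C A z = 0 \<or> bary C A B z = 0)"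
proof -
  have "closure (convex hull {A, B, C}) = convex hull {A, B, C}"
    using compact_triangle by (simp add: compact_imp_closed)
  then show ?thesis
    unfolding frontier_def Diff_iff using mem_triangle_iff[OF nd] interior_triangle_iff[OF nd] by auto
qed

section \<open>Areas of the regions cut off by chords\<close>

text \<open>In the coordinates (u,v) at B and C, areas are measured in units of the area of the triangle. The assumption
  says that the region is the triangle with the vertices (u1,v1), (u2,v2), (u3,v3) in these coordinates.\<close>

lemma area_in_coordinates:
  assumes nd: "nondegenerate A B C"
    and \<Phi>: "\<And>u v. \<Phi> u v \<longleftrightarrow> (\<exists>p q. 0 \<le> p \<and> 0 \<le> q \<and> p + q \<le> 1 \<and>
      u = u1 + p * (u2 - u1) + q * (u3 - u1) \<and> v = v1 + p * (v2 - v1) + q * (v3 - v1))"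
  shows "measure lebesgue {z. \<Phi> (bary B C A z) (bary C A B z)} =
    \<bar>(u2 - u1) * (v3 - v1) - (v2 - v1) * (u3 - u1)\<bar> * measure lebesgue (convex hull {A, B, C})"
proof -
  define pt where "pt u v = A + u *\<^sub>R (B - A) + v *\<^sub>R (C - A)" for u v :: real
  have comb: "pt u1 v1 + p *\<^sub>R (pt u2 v2 - pt u1 v1) + q *\<^sub>R (pt u3 v3 - pt u1 v1)
     = pt (u1 + p * (u2 - u1) + q * (u3 - u1)) (v1 + p * (v2 - v1) + q * (v3 - v1))" for p q
    by (simp add: pt_def algebra_simps)
  have "{z. \<Phi> (bary B C A z) (bary C A B z)} = convex hull {pt u1 v1, pt u2 v2, pt u3 v3}"
  proof
    show "{z. \<Phi> (bary B C A z) (bary C A B z)} \<subseteq> convex hull {pt u1 v1, pt u2 v2, pt u3 v3}"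
    proof
      fix z assume "z \<in> {z. \<Phi> (bary B C A z) (bary C A B z)}"
      then obtain p q where pq: "0 \<le> p" "0 \<le> q" "p + q \<le> 1"
        "bary B C A z = u1 + p * (u2 - u1) + q * (u3 - u1)" "bary C A B z = v1 + p * (v2 - v1) + q * (v3 - v1)"
        unfolding \<Phi> by auto
      have "z = pt (bary B C A z) (bary C A B z)" unfolding pt_def by (rule point_bary[OF nd])
      then show "z \<in> convex hull {pt u1 v1, pt u2 v2, pt u3 v3}"
        unfolding convex_hull_3_alt using pq comb[of p q]
        by (intro CollectI exI[of _ p] exI[of _ q]) simp
    qed
    show "convex hull {pt u1 v1, pt u2 v2, pt u3 v3} \<subseteq> {z. \<Phi> (bary B C A z) (bary C A B z)}"
    proof
      fix z assume "z \<in> convex hull {pt u1 v1, pt u2 v2, pt u3 v3}"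
      then obtain p q where pq: "0 \<le> p" "0 \<le> q" "p + q \<le> 1"
        "z = pt u1 v1 + p *\<^sub>R (pt u2 v2 - pt u1 v1) + q *\<^sub>R (pt u3 v3 - pt u1 v1)"
        unfolding convex_hull_3_alt by auto
      then have "bary B C A z = u1 + p * (u2 - u1) + q * (u3 - u1)" "bary C A B z = v1 + p * (v2 - v1) + q * (v3 - v1)"
        unfolding comb by (simp_all add: pt_def bary_point[OF nd])
      then show "z \<in> {z. \<Phi> (bary B C A z) (bary C A B z)}" unfolding \<Phi> using pq by blast
    qed
  qed
  moreover have "cross2 (pt u2 v2 - pt u1 v1) (pt u3 v3 - pt u1 v1)
      = ((u2 - u1) * (v3 - v1) - (v2 - v1) * (u3 - u1)) * cross2 (B - A) (C - A)"
    by (simp add: pt_def cross2_def) algebra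
  ultimately show ?thesis
    by (simp add: measure_triangle abs_mult)
qed

lemma area_corner:
  assumes nd: "nondegenerate A B C" and st: "0 < s" "s \<le> 1" "0 < t" "t \<le> 1"
  shows "measure lebesgue {z \<in> convex hull {A, B, C}. t * bary B C A z + s * bary C A B z + - (s * t) \<le> 0}
       = s * t * measure lebesgue (convex hull {A, B, C})"
proof -
  have "measure lebesgue {z. 0 \<le> bary B C A z \<and> 0 \<le> bary C A B z \<and> t * bary B C A z + s * bary C A B z \<le> s * t}
      = \<bar>(s - 0) * (t - 0) - (0 - 0) * (0 - 0)\<bar> * measure lebesgue (convex hull {A, B, C})"
  proof (rule area_in_coordinates[OF nd])
    fix u v :: real
    show "(0 \<le> u \<and> 0 \<le> v \<and> t * u + s * v \<le> s * t) \<longleftrightarrow> (\<exists>p q. 0 \<le> p \<and> 0 \<le> q \<and> p + q \<le> 1 \<and>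
      u = 0 + p * (s - 0) + q * (0 - 0) \<and> v = 0 + p * (0 - 0) + q * (t - 0))" (is "?L \<longleftrightarrow> ?R")
    proof
      assume ?L
      then have "u / s + v / t \<le> 1" using st by (simp add: field_simps)
      then show ?R using \<open>?L\<close> st by (intro exI[of _ "u / s"] exI[of _ "v / t"]) auto
    next
      assume ?R
      then obtain p q where pq: "0 \<le> p" "0 \<le> q" "p + q \<le> 1" "u = p * s" "v = q * t" by auto
      have "(p + q) * (s * t) \<le> 1 * (s * t)" using pq st by (intro mult_right_mono) auto
      then show ?L using pq st by (auto simp: algebra_simps)
    qed
  qed
  moreover have "{z \<in> convex hull {A, B, C}. t * bary B C A z + s * bary C A B z + - (s * t) \<le> 0}
    = {z. 0 \<le> bary B C A z \<and> 0 \<le> bary C A B z \<and> t * bary B C A z + s * bary C A B z \<le> s * t}"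
  proof -
    have "bary A B C z \<ge> 0" if z: "0 \<le> bary B C A z" "0 \<le> bary C A B z" "t * bary B C A z + s * bary C A B z \<le> s * t" for z
    proof -
      have "s * t * (bary B C A z + bary C A B z) \<le> t * bary B C A z + s * bary C A B z"
      proof -
        have "s * (t * bary B C A z) \<le> 1 * (t * bary B C A z)" "t * (s * bary C A B z) \<le> 1 * (s * bary C A B z)"
          using z st by (intro mult_right_mono mult_nonneg_nonneg; simp)+
        then show ?thesis by (simp add: algebra_simps)
      qed
      then have "s * t * (bary B C A z + bary C A B z) \<le> s * t * 1" using z by simp
      then have "bary B C A z + bary C A B z \<le> 1" using st by (simp add: mult_le_cancel_left)
      then show ?thesis using bary_sum[OF nd, of z] by simp
    qed
    then show ?thesis using mem_triangle_iff[OF nd] by auto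
  qed
  ultimately show ?thesis using st by simp
qed

text \<open>The coordinate at C of the point where the chord at the corner A through the point of AB at distance x from A
  crosses the chord at the corner B through the point of AB at distance y from B.\<close>

definition crossing_height :: "real \<Rightarrow> real \<Rightarrow> real" where
  "crossing_height x y = (x + y - 1) / (2 * x\<^sup>2 + 2 * y\<^sup>2 - 1)"

lemma crossing_denominator_pos:
  assumes "(x::real) + y > 1"
  shows "2 * x\<^sup>2 + 2 * y\<^sup>2 - 1 > 0"
proof -
  have "(x + y)\<^sup>2 > 1" using assms by (simp add: one_less_power)
  moreover have "2 * x\<^sup>2 + 2 * y\<^sup>2 - (x + y)\<^sup>2 = (x - y)\<^sup>2" by (simp add: power2_eq_square algebra_simps)
  ultimately show ?thesis using zero_le_power2[of "x - y"] by linarith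
qed

lemma crossing_left_coordinate:
  fixes x y :: real
  assumes "x + y > 1"
  defines "v \<equiv> crossing_height x y"
  shows "(x - 2 * x\<^sup>2 * v) * (2 * x\<^sup>2 + 2 * y\<^sup>2 - 1) = x * (2 * y\<^sup>2 - 1 + 2 * x * (1 - y))"
    and "x - 2 * x\<^sup>2 * v = 1 - y + (2 * y\<^sup>2 - 1) * v"
proof -
  have D: "2 * x\<^sup>2 + 2 * y\<^sup>2 - 1 \<noteq> 0" using crossing_denominator_pos[OF assms(1)] by simp
  have v: "v * (2 * x\<^sup>2 + 2 * y\<^sup>2 - 1) = x + y - 1" using D by (simp add: v_def crossing_height_def)
  show "(x - 2 * x\<^sup>2 * v) * (2 * x\<^sup>2 + 2 * y\<^sup>2 - 1) = x * (2 * y\<^sup>2 - 1 + 2 * x * (1 - y))"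
    using v by algebra
  show "x - 2 * x\<^sup>2 * v = 1 - y + (2 * y\<^sup>2 - 1) * v" using v by algebra
qed

text \<open>The region is the triangle with base x + y - 1 on AB and the crossing point as apex. The bounds on x and y
  ensure that the crossing point lies in the triangle ABC.\<close>

lemma area_between_corners:
  assumes nd: "nondegenerate A B C" and xy: "1/2 \<le> x" "x \<le> 1" "1/2 \<le> y" "y \<le> 1" "x + y > 1"
  shows "measure lebesgue {z \<in> convex hull {A, B, C}. bary B C A z + 2 * x\<^sup>2 * bary C A B z \<le> x
            \<and> bary A B C z + 2 * y\<^sup>2 * bary C A B z \<le> y}
       = (x + y - 1)\<^sup>2 / (2 * x\<^sup>2 + 2 * y\<^sup>2 - 1) * measure lebesgue (convex hull {A, B, C})"
proof -
  define h where "h = crossing_height x y"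
  define l where "l = x - 2 * x\<^sup>2 * h"
  have D: "2 * x\<^sup>2 + 2 * y\<^sup>2 - 1 > 0" using xy crossing_denominator_pos by blast
  have h: "h * (2 * x\<^sup>2 + 2 * y\<^sup>2 - 1) = x + y - 1" using D by (simp add: h_def crossing_height_def)
  have hpos: "h > 0" using D xy by (simp add: h_def crossing_height_def)
  have l2: "l = 1 - y + (2 * y\<^sup>2 - 1) * h" unfolding l_def h_def using xy by (intro crossing_left_coordinate)
  have corner_nonneg: "2 * b\<^sup>2 - 1 + 2 * a * (1 - b) \<ge> 0" if "1/2 \<le> a" "1/2 \<le> b" "b \<le> 1" for a b :: real
  proof -
    have "1 * (1 - b) \<le> 2 * a * (1 - b)" using that by (intro mult_right_mono) auto
    moreover have "b * (2 * b - 1) \<ge> 0" using that by simp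
    ultimately show ?thesis by (simp add: algebra_simps power2_eq_square)
  qed
  have l0: "l \<ge> 0"
  proof -
    have "l * (2 * x\<^sup>2 + 2 * y\<^sup>2 - 1) \<ge> 0"
      unfolding l_def h_def crossing_left_coordinate(1)[OF xy(5)] using corner_nonneg[of x y] xy by simp
    then show ?thesis using D by (simp add: zero_le_mult_iff)
  qed
  have r0: "1 - l - h \<ge> 0"
  proof -
    have yx: "y + x > 1" using xy by simp
    have "crossing_height y x = h" by (simp add: h_def crossing_height_def add.commute)
    then have "(y - 2 * y\<^sup>2 * h) * (2 * y\<^sup>2 + 2 * x\<^sup>2 - 1) = y * (2 * x\<^sup>2 - 1 + 2 * y * (1 - x))"
      using crossing_left_coordinate(1)[OF yx] by simp
    then have "(y - 2 * y\<^sup>2 * h) * (2 * y\<^sup>2 + 2 * x\<^sup>2 - 1) \<ge> 0" using corner_nonneg[of y x] xy by simp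
    then have "y - 2 * y\<^sup>2 * h \<ge> 0" using D by (simp add: zero_le_mult_iff)
    then show ?thesis unfolding l2 by (simp add: algebra_simps)
  qed
  have "measure lebesgue {z. (0 \<le> bary B C A z \<and> 0 \<le> bary C A B z \<and> bary B C A z + bary C A B z \<le> 1) \<and>
          bary B C A z + 2 * x\<^sup>2 * bary C A B z \<le> x \<and> (1 - bary B C A z - bary C A B z) + 2 * y\<^sup>2 * bary C A B z \<le> y}
      = \<bar>(x - (1 - y)) * (h - 0) - (0 - 0) * (l - (1 - y))\<bar> * measure lebesgue (convex hull {A, B, C})"
  proof (rule area_in_coordinates[OF nd])
    fix u v :: real
    show "((0 \<le> u \<and> 0 \<le> v \<and> u + v \<le> 1) \<and> u + 2 * x\<^sup>2 * v \<le> x \<and> (1 - u - v) + 2 * y\<^sup>2 * v \<le> y) \<longleftrightarrow>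
      (\<exists>p q. 0 \<le> p \<and> 0 \<le> q \<and> p + q \<le> 1 \<and>
      u = (1 - y) + p * (x - (1 - y)) + q * (l - (1 - y)) \<and> v = 0 + p * (0 - 0) + q * (h - 0))" (is "?L \<longleftrightarrow> ?R")
    proof
      assume L: ?L
      define q where "q = v / h"
      define p where "p = (u - (1 - y) - (2 * y\<^sup>2 - 1) * v) / (x + y - 1)"
      have v: "v = q * h" using hpos by (simp add: q_def)
      have p: "p * (x + y - 1) = u - (1 - y) - (2 * y\<^sup>2 - 1) * v" using xy by (simp add: p_def)
      have "q \<ge> 0" using L hpos by (simp add: q_def)
      moreover have "p \<ge> 0" using L xy by (simp add: p_def algebra_simps)
      moreover have "p + q \<le> 1"
      proof -
        have "(p + q) * (x + y - 1) = u - (1 - y) + 2 * x\<^sup>2 * v" using p v h by algebra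
        also have "\<dots> \<le> 1 * (x + y - 1)" using L by simp
        finally show ?thesis using xy by (simp add: mult_le_cancel_right)
      qed
      moreover have "u = (1 - y) + p * (x - (1 - y)) + q * (l - (1 - y))" using p v l2 by algebra
      ultimately show ?R using v by (intro exI[of _ p] exI[of _ q]) auto
    next
      assume ?R
      then obtain p q where pq: "0 \<le> p" "0 \<le> q" "p + q \<le> 1"
        "u = (1 - y) + p * (x - (1 - y)) + q * (l - (1 - y))" "v = q * h" by auto
      have u: "u = (1 - p - q) * (1 - y) + p * x + q * l" using pq by algebra
      have w: "1 - u - v = (1 - p - q) * y + p * (1 - x) + q * (1 - l - h)" using pq by algebra
      have "u \<ge> 0" unfolding u using pq xy l0 by (intro add_nonneg_nonneg mult_nonneg_nonneg) auto
      moreover have "1 - u - v \<ge> 0" unfolding w using pq xy r0 by (intro add_nonneg_nonneg mult_nonneg_nonneg) auto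
      moreover have "v \<ge> 0" using pq hpos by simp
      moreover have "x - (u + 2 * x\<^sup>2 * v) = (1 - p - q) * (x + y - 1)" using pq l_def by algebra
      moreover have "(1 - p - q) * (x + y - 1) \<ge> 0" using pq xy by simp
      moreover have "y - ((1 - u - v) + 2 * y\<^sup>2 * v) = p * (x + y - 1)" using pq l2 by algebra
      moreover have "p * (x + y - 1) \<ge> 0" using pq xy by simp
      ultimately show ?L by linarith
    qed
  qed
  also have "(x - (1 - y)) * (h - 0) - (0 - 0) * (l - (1 - y)) = (x + y - 1)\<^sup>2 / (2 * x\<^sup>2 + 2 * y\<^sup>2 - 1)"
    by (simp add: h_def crossing_height_def power2_eq_square algebra_simps)
  also have "{z. (0 \<le> bary B C A z \<and> 0 \<le> bary C A B z \<and> bary B C A z + bary C A B z \<le> 1) \<and>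
          bary B C A z + 2 * x\<^sup>2 * bary C A B z \<le> x \<and> (1 - bary B C A z - bary C A B z) + 2 * y\<^sup>2 * bary C A B z \<le> y}
     = {z \<in> convex hull {A, B, C}. bary B C A z + 2 * x\<^sup>2 * bary C A B z \<le> x
            \<and> bary A B C z + 2 * y\<^sup>2 * bary C A B z \<le> y}"
  proof -
    have "bary A B C z = 1 - bary B C A z - bary C A B z" for z using bary_sum[OF nd, of z] by simp
    then show ?thesis using mem_triangle_iff[OF nd] by auto
  qed
  finally show ?thesis using D by simp
qed

text \<open>Two bisecting chords at the corner A cross in the point with coordinates xy/(x + y) at B and 1/(2(x + y)) at
  C. Together with AB they bound a triangle with base y - x.\<close>

lemma area_same_corner:
  assumes nd: "nondegenerate A B C" and xy: "1/2 \<le> x" "x < y" "y \<le> 1"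
  shows "measure lebesgue {z \<in> convex hull {A, B, C}. x \<le> bary B C A z + 2 * x\<^sup>2 * bary C A B z
            \<and> bary B C A z + 2 * y\<^sup>2 * bary C A B z \<le> y}
       = (y - x) / (2 * (x + y)) * measure lebesgue (convex hull {A, B, C})"
proof -
  define h where "h = 1 / (2 * (x + y))"
  define l where "l = x * y / (x + y)"
  have pos: "x + y > 0" using xy by simp
  have h: "2 * h * (x + y) = 1" and l: "l * (x + y) = x * y" using pos by (simp_all add: h_def l_def)
  have lx: "l = x - 2 * x\<^sup>2 * h" and ly: "l = y - 2 * y\<^sup>2 * h" using h l pos
    by (simp_all add: l_def h_def field_simps power2_eq_square)
  have hpos: "h > 0" using pos by (simp add: h_def)
  have lpos: "l > 0" using xy by (simp add: l_def)
  have r0: "1 - l - h \<ge> 0"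
  proof -
    have "(1 - l - h) * (2 * (x + y)) = 2 * x * (1 - y) + (2 * y - 1)" using h l by algebra
    moreover have "2 * x * (1 - y) \<ge> 0" using xy by simp
    ultimately have "(1 - l - h) * (2 * (x + y)) \<ge> 0" using xy by simp
    then show ?thesis using pos by (simp add: zero_le_mult_iff)
  qed
  have "measure lebesgue {z. (0 \<le> bary B C A z \<and> 0 \<le> bary C A B z \<and> bary B C A z + bary C A B z \<le> 1) \<and>
          x \<le> bary B C A z + 2 * x\<^sup>2 * bary C A B z \<and> bary B C A z + 2 * y\<^sup>2 * bary C A B z \<le> y}
      = \<bar>(y - x) * (h - 0) - (0 - 0) * (l - x)\<bar> * measure lebesgue (convex hull {A, B, C})"
  proof (rule area_in_coordinates[OF nd])
    fix u v :: real
    show "((0 \<le> u \<and> 0 \<le> v \<and> u + v \<le> 1) \<and> x \<le> u + 2 * x\<^sup>2 * v \<and> u + 2 * y\<^sup>2 * v \<le> y) \<longleftrightarrow>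
      (\<exists>p q. 0 \<le> p \<and> 0 \<le> q \<and> p + q \<le> 1 \<and>
      u = x + p * (y - x) + q * (l - x) \<and> v = 0 + p * (0 - 0) + q * (h - 0))" (is "?L \<longleftrightarrow> ?R")
    proof
      assume L: ?L
      define q where "q = v / h"
      define p where "p = (u - x + 2 * x\<^sup>2 * v) / (y - x)"
      have v: "v = q * h" using hpos by (simp add: q_def)
      have p: "p * (y - x) = u - x + 2 * x\<^sup>2 * v" using xy by (simp add: p_def)
      have "q \<ge> 0" using L hpos by (simp add: q_def)
      moreover have "p \<ge> 0" using L xy by (simp add: p_def algebra_simps)
      moreover have "p + q \<le> 1"
      proof -
        have "(p + q) * (y - x) = u - x + 2 * y\<^sup>2 * v" using p v h by algebra
        also have "\<dots> \<le> 1 * (y - x)" using L by simp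
        finally show ?thesis using xy by (simp add: mult_le_cancel_right)
      qed
      moreover have "u = x + p * (y - x) + q * (l - x)" using p v lx by algebra
      ultimately show ?R using v by (intro exI[of _ p] exI[of _ q]) auto
    next
      assume ?R
      then obtain p q where pq: "0 \<le> p" "0 \<le> q" "p + q \<le> 1"
        "u = x + p * (y - x) + q * (l - x)" "v = q * h" by auto
      have u: "u = (1 - p - q) * x + p * y + q * l" using pq by algebra
      have w: "1 - u - v = (1 - p - q) * (1 - x) + p * (1 - y) + q * (1 - l - h)" using pq by algebra
      have "u \<ge> 0" unfolding u using pq xy lpos by (intro add_nonneg_nonneg mult_nonneg_nonneg) auto
      moreover have "1 - u - v \<ge> 0" unfolding w using pq xy r0 by (intro add_nonneg_nonneg mult_nonneg_nonneg) auto
      moreover have "v \<ge> 0" using pq hpos by simp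
      moreover have "(u + 2 * x\<^sup>2 * v) - x = p * (y - x)" using pq lx by algebra
      moreover have "p * (y - x) \<ge> 0" using pq xy by simp
      moreover have "y - (u + 2 * y\<^sup>2 * v) = (1 - p - q) * (y - x)" using pq ly by algebra
      moreover have "(1 - p - q) * (y - x) \<ge> 0" using pq xy by simp
      ultimately show ?L by linarith
    qed
  qed
  also have "(y - x) * (h - 0) - (0 - 0) * (l - x) = (y - x) / (2 * (x + y))"
    by (simp add: h_def)
  also have "{z. (0 \<le> bary B C A z \<and> 0 \<le> bary C A B z \<and> bary B C A z + bary C A B z \<le> 1) \<and>
          x \<le> bary B C A z + 2 * x\<^sup>2 * bary C A B z \<and> bary B C A z + 2 * y\<^sup>2 * bary C A B z \<le> y}
     = {z \<in> convex hull {A, B, C}. x \<le> bary B C A z + 2 * x\<^sup>2 * bary C A B z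
            \<and> bary B C A z + 2 * y\<^sup>2 * bary C A B z \<le> y}"
  proof -
    have "bary A B C z = 1 - bary B C A z - bary C A B z" for z using bary_sum[OF nd, of z] by simp
    then show ?thesis using mem_triangle_iff[OF nd] by auto
  qed
  finally show ?thesis using xy pos by simp
qed

section \<open>Pairs of chords that quarter a triangle\<close>

text \<open>The part of the definition of a quadrisection that depends only on the affine structure; the right angle is
  treated separately.\<close>

definition quarters :: "(real \<times> real) set \<Rightarrow> (real \<times> real) set \<Rightarrow> (real \<times> real) set \<Rightarrow> bool" where
  "quarters T S1 S2 \<longleftrightarrow>
     (\<exists>a b c d. S1 = closed_segment a b \<and> S2 = closed_segment c d \<and> {a, b, c, d} \<subseteq> frontier T) \<and>
     (\<exists>P \<in> interior T. S1 \<inter> S2 = {P}) \<and> divides_into_four_equal T (S1 \<union> S2)"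

lemma quarters_commute: "quarters T S1 S2 \<longleftrightarrow> quarters T S2 S1"
proof -
  have "quarters T S2 S1" if q: "quarters T S1 S2" for S1 S2
  proof -
    obtain a b c d where "S1 = closed_segment a b" "S2 = closed_segment c d" "{a, b, c, d} \<subseteq> frontier T"
      using q unfolding quarters_def by blast
    then have "\<exists>a b c d. S2 = closed_segment a b \<and> S1 = closed_segment c d \<and> {a, b, c, d} \<subseteq> frontier T"
      by blast
    then show ?thesis using q unfolding quarters_def by (simp add: Int_commute Un_commute)
  qed
  then show ?thesis by blast
qed

lemma quarters_endpoints:
  assumes "quarters T (closed_segment a b) (closed_segment c d)"
  shows "{a, b, c, d} \<subseteq> frontier T"
proof -
  obtain a' b' c' d' where "closed_segment a b = closed_segment a' b'" "closed_segment c d = closed_segment c' d'"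
    "{a', b', c', d'} \<subseteq> frontier T"
    using assms unfolding quarters_def by blast
  then show ?thesis by (auto simp: doubleton_eq_iff)
qed

lemma is_quadrisection_iff:
  "is_quadrisection T Q \<longleftrightarrow> (\<exists>a b c d. Q = {closed_segment a b, closed_segment c d} \<and>
     (b - a) \<bullet> (d - c) = 0 \<and> quarters T (closed_segment a b) (closed_segment c d))"
proof -
  have "quarters T (closed_segment a b) (closed_segment c d) \<longleftrightarrow> {a, b, c, d} \<subseteq> frontier T \<and>
    (\<exists>P \<in> interior T. closed_segment a b \<inter> closed_segment c d = {P}) \<and>
    divides_into_four_equal T (closed_segment a b \<union> closed_segment c d)" for a b c d
    using quarters_endpoints[of T a b c d] unfolding quarters_def by blast
  then show ?thesis unfolding is_quadrisection_def by metis
qed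

lemma orthogonal_segments_cong:
  fixes a b c d a' b' c' d' :: "real \<times> real"
  assumes "closed_segment a b = closed_segment a' b'" "closed_segment c d = closed_segment c' d'"
  shows "(b - a) \<bullet> (d - c) = 0 \<longleftrightarrow> (b' - a') \<bullet> (d' - c') = 0"
proof -
  have "b - a = b' - a' \<or> b - a = - (b' - a')" "d - c = d' - c' \<or> d - c = - (d' - c')"
    using assms by (auto simp: doubleton_eq_iff)
  then show ?thesis by (elim disjE) (simp_all only: inner_minus_left inner_minus_right minus_minus neg_equal_0_iff_equal)
qed

lemma quarter_cancel: "p * M = M / 4 \<Longrightarrow> M > 0 \<Longrightarrow> p = 1 / 4" for p M :: real
  by (simp add: field_simps)

text \<open>Any affine forms that vanish at the ends of the segments may be used to compute areas, with either sign; this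
  selects which of the four regions is measured.\<close>

lemma quarters_areas:
  assumes q: "quarters (convex hull {A, B, C}) (closed_segment a b) (closed_segment c d)"
    and f: "affine_form f" "f a = 0" "f b = 0"
    and g: "affine_form g" "g c = 0" "g d = 0"
  shows "measure lebesgue {z\<in>convex hull {A, B, C}. f z \<le> 0} = measure lebesgue (convex hull {A, B, C}) / 2"
    and "measure lebesgue {z\<in>convex hull {A, B, C}. g z \<le> 0} = measure lebesgue (convex hull {A, B, C}) / 2"
    and "measure lebesgue {z\<in>convex hull {A, B, C}. f z \<le> 0 \<and> g z \<le> 0} = measure lebesgue (convex hull {A, B, C}) / 4"
proof -
  obtain P where P: "P \<in> interior (convex hull {A, B, C})" "closed_segment a b \<inter> closed_segment c d = {P}"
    using q unfolding quarters_def by blast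
  have "divides_into_four_equal (convex hull {A, B, C}) (closed_segment a b \<union> closed_segment c d)"
    using q unfolding quarters_def by blast
  then show "measure lebesgue {z\<in>convex hull {A, B, C}. f z \<le> 0} = measure lebesgue (convex hull {A, B, C}) / 2"
    "measure lebesgue {z\<in>convex hull {A, B, C}. g z \<le> 0} = measure lebesgue (convex hull {A, B, C}) / 2"
    "measure lebesgue {z\<in>convex hull {A, B, C}. f z \<le> 0 \<and> g z \<le> 0} = measure lebesgue (convex hull {A, B, C}) / 4"
    using divides_iff_areas[OF convex_convex_hull compact_triangle quarters_endpoints[OF q] P f g] by auto
qed

lemma measure_triangle_pos: "nondegenerate A B C \<Longrightarrow> measure lebesgue (convex hull {A, B, C}) > 0"
  by (simp add: measure_triangle nondegenerate_def)

text \<open>The chord that cuts off half of the area at the corner A, so that the product of the two fractions of the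
  sides is 1/2.\<close>

definition chord :: "real \<times> real \<Rightarrow> real \<times> real \<Rightarrow> real \<times> real \<Rightarrow> real \<Rightarrow> (real \<times> real) set" where
  "chord A B C x = closed_segment (A + x *\<^sub>R (B - A)) (A + (1 / (2 * x)) *\<^sub>R (C - A))"

lemma bary_sides:
  assumes "nondegenerate A B C"
  shows "bary B C A (A + s *\<^sub>R (B - A)) = s" "bary C A B (A + s *\<^sub>R (B - A)) = 0" "bary A B C (A + s *\<^sub>R (B - A)) = 1 - s"
    and "bary B C A (A + t *\<^sub>R (C - A)) = 0" "bary C A B (A + t *\<^sub>R (C - A)) = t" "bary A B C (A + t *\<^sub>R (C - A)) = 1 - t"
  using bary_point[OF assms, of s 0] bary_point[OF assms, of 0 t] by simp_all

lemma bary_segment: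
  assumes nd: "nondegenerate A B C"
  shows "bary A B C ((1 - t) *\<^sub>R a + t *\<^sub>R b) = (1 - t) * bary A B C a + t * bary A B C b"
  using affine_form_affine[OF affine_form_bary[OF nondegenerate_rotate[OF nondegenerate_rotate[OF nd]], of 1 0 0]]
  by simp

lemma affine_form_zero_segment:
  "affine_form f \<Longrightarrow> f a = 0 \<Longrightarrow> f b = 0 \<Longrightarrow> z \<in> closed_segment a b \<Longrightarrow> f z = 0"
proof -
  assume f: "affine_form f" "f a = 0" "f b = 0" and z: "z \<in> closed_segment a b"
  obtain t where "z = (1 - t) *\<^sub>R a + t *\<^sub>R b" using z unfolding in_segment by blast
  then show "f z = 0" using affine_form_affine[OF f(1), of t a b] f(2,3) by simp
qed

text \<open>The corner cut off at A has st times the area of the triangle, hence st = 1/2, and s <= 1, t <= 1 force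
  s >= 1/2. Neither s nor t is zero because P is an interior point.\<close>

lemma bisecting_chord_at_corner:
  assumes nd: "nondegenerate A B C"
    and a: "a \<in> frontier (convex hull {A, B, C})" "bary C A B a = 0"
    and b: "b \<in> frontier (convex hull {A, B, C})" "bary B C A b = 0"
    and P: "P \<in> interior (convex hull {A, B, C})" "P \<in> closed_segment a b"
    and half: "\<And>f. affine_form f \<Longrightarrow> f a = 0 \<Longrightarrow> f b = 0 \<Longrightarrow>
      measure lebesgue {z\<in>convex hull {A, B, C}. f z \<le> 0} = measure lebesgue (convex hull {A, B, C}) / 2"
  shows "\<exists>x\<in>{1/2..1}. closed_segment a b = chord A B C x"
proof -
  define s t where "s = bary B C A a" and "t = bary C A B b"
  have ab: "a = A + s *\<^sub>R (B - A)" "b = A + t *\<^sub>R (C - A)"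
    using point_bary[OF nd, of a] point_bary[OF nd, of b] a b by (simp_all add: s_def t_def)
  have st: "0 \<le> s" "s \<le> 1" "0 \<le> t" "t \<le> 1"
    using a b bary_sum[OF nd, of a] bary_sum[OF nd, of b] unfolding frontier_triangle_iff[OF nd] s_def t_def by auto
  obtain p where p: "0 \<le> p" "p \<le> 1" "P = (1 - p) *\<^sub>R a + p *\<^sub>R b" using P by (auto simp: in_segment)
  have "bary B C A P = (1 - p) * s" "bary C A B P = p * t"
    using p bary_segment[OF nondegenerate_rotate[OF nd]] bary_segment[OF nondegenerate_rotate[OF nondegenerate_rotate[OF nd]]] a b
    by (simp_all add: s_def t_def)
  then have "s \<noteq> 0" "t \<noteq> 0" using P(1) unfolding interior_triangle_iff[OF nd] by auto
  then have pos: "0 < s" "0 < t" using st by auto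
  have "measure lebesgue {z\<in>convex hull {A, B, C}. t * bary B C A z + s * bary C A B z + - (s * t) \<le> 0}
      = measure lebesgue (convex hull {A, B, C}) / 2"
    using pos by (intro half affine_form_bary[OF nd]) (simp_all add: ab bary_sides[OF nd])
  then have "s * t * measure lebesgue (convex hull {A, B, C}) = (1 / 2) * measure lebesgue (convex hull {A, B, C})"
    using area_corner[OF nd pos(1) st(2) pos(2) st(4)] by simp
  then have "s * t = 1 / 2" using measure_triangle_pos[OF nd] by simp
  then have t: "t = 1 / (2 * s)" using pos by (simp add: field_simps)
  have "s * t \<le> s * 1" using st pos by (intro mult_left_mono) auto
  then have "s \<ge> 1 / 2" using \<open>s * t = 1 / 2\<close> by simp
  then show ?thesis using st ab t by (intro bexI[of _ s]) (auto simp: chord_def)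
qed

definition rotations :: "'a \<Rightarrow> 'a \<Rightarrow> 'a \<Rightarrow> ('a \<times> 'a \<times> 'a) set" where
  "rotations A B C = {(A, B, C), (B, C, A), (C, A, B)}"

text \<open>The two ends of a chord through the interior lie on two different sides, which have a common vertex.\<close>

lemma bisecting_chord:
  assumes nd: "nondegenerate A B C"
    and ab: "a \<in> frontier (convex hull {A, B, C})" "b \<in> frontier (convex hull {A, B, C})"
    and P: "P \<in> interior (convex hull {A, B, C})" "P \<in> closed_segment a b"
    and half: "\<And>f. affine_form f \<Longrightarrow> f a = 0 \<Longrightarrow> f b = 0 \<Longrightarrow>
      measure lebesgue {z\<in>convex hull {A, B, C}. f z \<le> 0} = measure lebesgue (convex hull {A, B, C}) / 2"
  shows "\<exists>(U, V, W) \<in> rotations A B C. \<exists>x\<in>{1/2..1}. closed_segment a b = chord U V W x"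
proof -
  note nd2 = nondegenerate_rotate[OF nd]
  note nd3 = nondegenerate_rotate[OF nd2]
  have same: "\<not> (bary U V W a = 0 \<and> bary U V W b = 0)" if "nondegenerate U V W" "bary U V W P > 0" for U V W
  proof
    assume "bary U V W a = 0 \<and> bary U V W b = 0"
    moreover obtain p where "P = (1 - p) *\<^sub>R a + p *\<^sub>R b" using P by (auto simp: in_segment)
    ultimately show False using bary_segment[OF that(1)] that(2) by auto
  qed
  have P': "bary A B C P > 0" "bary B C A P > 0" "bary C A B P > 0" using P(1) unfolding interior_triangle_iff[OF nd] by auto
  have half': "measure lebesgue {z\<in>convex hull {A, B, C}. f z \<le> 0} = measure lebesgue (convex hull {A, B, C}) / 2"
    if "affine_form f" "f b = 0" "f a = 0" for f using half that by blast
  have P2: "P \<in> closed_segment b a" using P by (simp add: closed_segment_commute)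
  have corner: "\<exists>x\<in>{1/2..1}. closed_segment a b = chord U V W x"
    if UVW: "nondegenerate U V W" "convex hull {U, V, W} = convex hull {A, B, C}"
      and z: "bary V W U a = 0 \<and> bary W U V b = 0 \<or> bary W U V a = 0 \<and> bary V W U b = 0" for U V W
    using z
  proof
    assume z: "bary V W U a = 0 \<and> bary W U V b = 0"
    have "\<exists>x\<in>{1/2..1}. closed_segment b a = chord U V W x"
      by (rule bisecting_chord_at_corner[OF UVW(1)]; (unfold UVW(2))?)
        (fact ab P P2 conjunct1[OF z] conjunct2[OF z] | erule (2) half')+
    then show ?thesis by (simp only: closed_segment_commute[of b a])
  next
    assume z: "bary W U V a = 0 \<and> bary V W U b = 0"
    show ?thesis
      by (rule bisecting_chord_at_corner[OF UVW(1)]; (unfold UVW(2))?)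
        (fact ab P P2 conjunct1[OF z] conjunct2[OF z] | erule (2) half)+
  qed
  have za: "bary A B C a = 0 \<or> bary B C A a = 0 \<or> bary C A B a = 0" and zb: "bary A B C b = 0 \<or> bary B C A b = 0 \<or> bary C A B b = 0"
    using ab unfolding frontier_triangle_iff[OF nd] by blast+
  consider "bary B C A a = 0 \<and> bary C A B b = 0 \<or> bary C A B a = 0 \<and> bary B C A b = 0"
    | "bary C A B a = 0 \<and> bary A B C b = 0 \<or> bary A B C a = 0 \<and> bary C A B b = 0"
    | "bary A B C a = 0 \<and> bary B C A b = 0 \<or> bary B C A a = 0 \<and> bary A B C b = 0"
    using za zb same[OF nd P'(1)] same[OF nd2 P'(2)] same[OF nd3 P'(3)] by blast
  then show ?thesis
  proof cases
    case 1 then show ?thesis using corner[OF nd] unfolding rotations_def by blast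
  next
    case 2 then show ?thesis using corner[OF nd2 hull_rotate] unfolding rotations_def by blast
  next
    case 3 then show ?thesis using corner[OF nd3 hull_rotate[symmetric]] unfolding rotations_def by blast
  qed
qed

text \<open>The line of the chord at the corner A; the form is negative on the side of A.\<close>

lemma corner_form:
  assumes nd: "nondegenerate A B C" and x: "x \<noteq> 0"
  shows "affine_form (\<lambda>z. bary B C A z + 2 * x\<^sup>2 * bary C A B z - x)"
    and "bary B C A (A + x *\<^sub>R (B - A)) + 2 * x\<^sup>2 * bary C A B (A + x *\<^sub>R (B - A)) - x = 0"
    and "bary B C A (A + (1 / (2 * x)) *\<^sub>R (C - A)) + 2 * x\<^sup>2 * bary C A B (A + (1 / (2 * x)) *\<^sub>R (C - A)) - x = 0"
  using affine_form_bary[OF nd, of 1 "2 * x\<^sup>2" "- x"] x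
  by (simp_all add: bary_sides[OF nd] power2_eq_square del: scaleR_left_diff_distrib scaleR_right_diff_distrib)

text \<open>The line of the chord at the corner B, written with its distance y from B along the side AB.\<close>

lemma corner_form_opposite:
  assumes nd: "nondegenerate A B C" and y: "y \<noteq> 0"
  shows "affine_form (\<lambda>z. bary A B C z + 2 * y\<^sup>2 * bary C A B z - y)"
    and "bary A B C (B + (1 / (2 * y)) *\<^sub>R (C - B)) + 2 * y\<^sup>2 * bary C A B (B + (1 / (2 * y)) *\<^sub>R (C - B)) - y = 0"
    and "bary A B C (B + y *\<^sub>R (A - B)) + 2 * y\<^sup>2 * bary C A B (B + y *\<^sub>R (A - B)) - y = 0"
proof -
  note nd2 = nondegenerate_rotate[OF nd]
  show "affine_form (\<lambda>z. bary A B C z + 2 * y\<^sup>2 * bary C A B z - y)"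
    using affine_form_bary[OF nd2, of "2 * y\<^sup>2" 1 "- y"] y by (simp add: add.commute)
  show "bary A B C (B + (1 / (2 * y)) *\<^sub>R (C - B)) + 2 * y\<^sup>2 * bary C A B (B + (1 / (2 * y)) *\<^sub>R (C - B)) - y = 0"
    "bary A B C (B + y *\<^sub>R (A - B)) + 2 * y\<^sup>2 * bary C A B (B + y *\<^sub>R (A - B)) - y = 0"
    using y by (simp_all add: bary_sides[OF nd2] power2_eq_square)
qed

lemma quarters_not_equal:
  assumes "quarters T S S" shows False
proof -
  obtain a b where ab: "S = closed_segment a b" "a \<in> frontier T" using assms unfolding quarters_def by auto
  obtain P where "P \<in> interior T" "S = {P}" using assms unfolding quarters_def by auto
  then have "a \<in> interior T" using ab ends_in_segment(1)[of a b] by auto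
  then show False using ab by (auto simp: frontier_def)
qed

text \<open>If x < y, the region at the side AB has a quarter of the area only for y = 3x, which is impossible because
  both parameters lie between 1/2 and 1.\<close>

lemma quarters_same_corner:
  assumes nd: "nondegenerate A B C" and x: "x \<in> {1/2..1}" and y: "y \<in> {1/2..1}"
  shows "\<not> quarters (convex hull {A, B, C}) (chord A B C x) (chord A B C y)"
proof -
  have less: False if xy: "1/2 \<le> x" "x < y" "y \<le> 1" and
    q: "quarters (convex hull {A, B, C}) (chord A B C x) (chord A B C y)" for x y
  proof -
    have nz: "x \<noteq> 0" "y \<noteq> 0" using xy by auto
    define f where "f = (\<lambda>z. - (bary B C A z + 2 * x\<^sup>2 * bary C A B z - x))"
    define g where "g = (\<lambda>z. bary B C A z + 2 * y\<^sup>2 * bary C A B z - y)"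
    have f: "affine_form f" "f (A + x *\<^sub>R (B - A)) = 0" "f (A + (1 / (2 * x)) *\<^sub>R (C - A)) = 0"
      using corner_form(2,3)[OF nd nz(1)] affine_form_uminus[OF corner_form(1)[OF nd nz(1)]]
      unfolding f_def by simp_all
    have g: "affine_form g" "g (A + y *\<^sub>R (B - A)) = 0" "g (A + (1 / (2 * y)) *\<^sub>R (C - A)) = 0"
      using corner_form[OF nd nz(2)] by (simp_all add: g_def)
    have "measure lebesgue {z\<in>convex hull {A, B, C}. f z \<le> 0 \<and> g z \<le> 0} = measure lebesgue (convex hull {A, B, C}) / 4"
      using quarters_areas(3)[OF q[unfolded chord_def] f g] .
    moreover have "{z\<in>convex hull {A, B, C}. f z \<le> 0 \<and> g z \<le> 0} = {z \<in> convex hull {A, B, C}. x \<le> bary B C A z + 2 * x\<^sup>2 * bary C A B z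
            \<and> bary B C A z + 2 * y\<^sup>2 * bary C A B z \<le> y}"
      by (auto simp: f_def g_def)
    ultimately have m: "measure lebesgue {z \<in> convex hull {A, B, C}. x \<le> bary B C A z + 2 * x\<^sup>2 * bary C A B z
            \<and> bary B C A z + 2 * y\<^sup>2 * bary C A B z \<le> y} = measure lebesgue (convex hull {A, B, C}) / 4"
      by (simp only:)
    have "(y - x) / (2 * (x + y)) = 1 / 4"
      by (rule quarter_cancel[OF trans[OF area_same_corner[OF nd xy, symmetric] m] measure_triangle_pos[OF nd]])
    then have "y = 3 * x" using xy by (simp add: field_simps)
    then show False using xy by simp
  qed
  show ?thesis
    using less[of x y] less[of y x] x y quarters_not_equal quarters_commute
    by (metis atLeastAtMost_iff linorder_neqE_linordered_idom)
qed

text \<open>The condition on the positions of the chords at two different corners. For x = y = 1/2 both chords would be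
  the median from the third vertex, which x + y > 1 excludes.\<close>

definition quarter_relation :: "real \<Rightarrow> real \<Rightarrow> bool" where
  "quarter_relation x y \<longleftrightarrow> x \<in> {1/2..1} \<and> y \<in> {1/2..1} \<and> x + y > 1 \<and> 4 * (x + y - 1)\<^sup>2 = 2 * x\<^sup>2 + 2 * y\<^sup>2 - 1"

text \<open>The region at the side AB has (x + y - 1)^2 / (2x^2 + 2y^2 - 1) times the area of the triangle.\<close>

lemma quarters_imp_relation:
  assumes nd: "nondegenerate A B C" and x: "x \<in> {1/2..1}" and y: "y \<in> {1/2..1}"
    and q: "quarters (convex hull {A, B, C}) (chord A B C x) (chord B C A (1 / (2 * y)))"
  shows "quarter_relation x y"
proof -
  have nz: "x \<noteq> 0" "y \<noteq> 0" using x y by auto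
  define f where "f = (\<lambda>z. bary B C A z + 2 * x\<^sup>2 * bary C A B z - x)"
  define g where "g = (\<lambda>z. bary A B C z + 2 * y\<^sup>2 * bary C A B z - y)"
  have f: "affine_form f" "f (A + x *\<^sub>R (B - A)) = 0" "f (A + (1 / (2 * x)) *\<^sub>R (C - A)) = 0"
    using corner_form[OF nd nz(1)] by (simp_all add: f_def)
  have g: "affine_form g" "g (B + (1 / (2 * y)) *\<^sub>R (C - B)) = 0" "g (B + y *\<^sub>R (A - B)) = 0"
    using corner_form_opposite[OF nd nz(2)] by (simp_all add: g_def)
  have ch: "chord B C A (1 / (2 * y)) = closed_segment (B + (1 / (2 * y)) *\<^sub>R (C - B)) (B + y *\<^sub>R (A - B))"
    using nz by (simp add: chord_def)
  note q' = q[unfolded ch, unfolded chord_def]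
  obtain P where P: "P \<in> interior (convex hull {A, B, C})"
    "P \<in> chord A B C x" "P \<in> chord B C A (1 / (2 * y))"
    using q unfolding quarters_def by blast
  have fP: "f P = 0" using affine_form_zero_segment[OF f] P(2) unfolding chord_def by blast
  have gP: "g P = 0" using affine_form_zero_segment[OF g] P(3) unfolding ch by blast
  have "bary C A B P > 0" using P(1) unfolding interior_triangle_iff[OF nd] by simp
  moreover have "(2 * x\<^sup>2 + 2 * y\<^sup>2 - 1) * bary C A B P = x + y - 1"
    using fP gP bary_sum[OF nd, of P] unfolding f_def g_def by algebra
  moreover have "x + y > 1"
  proof (rule ccontr)
    assume "\<not> x + y > 1"
    \<comment> \<open>then both chords are the median from C\<close>
    then have "x = 1/2" "y = 1/2" using x y by auto
    then have "chord B C A (1 / (2 * y)) = chord A B C x"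
      by (simp add: chord_def closed_segment_commute insert_commute doubleton_eq_iff algebra_simps flip: scaleR_add_left)
    then show False using q quarters_not_equal by metis
  qed
  ultimately have "2 * x\<^sup>2 + 2 * y\<^sup>2 - 1 > 0" using crossing_denominator_pos by blast
  have "measure lebesgue {z\<in>convex hull {A, B, C}. f z \<le> 0 \<and> g z \<le> 0} = measure lebesgue (convex hull {A, B, C}) / 4"
    using quarters_areas(3)[OF q' f g] .
  moreover have "{z\<in>convex hull {A, B, C}. f z \<le> 0 \<and> g z \<le> 0} = {z \<in> convex hull {A, B, C}. bary B C A z + 2 * x\<^sup>2 * bary C A B z \<le> x
            \<and> bary A B C z + 2 * y\<^sup>2 * bary C A B z \<le> y}"
    by (auto simp: f_def g_def)
  ultimately have m: "measure lebesgue {z \<in> convex hull {A, B, C}. bary B C A z + 2 * x\<^sup>2 * bary C A B z \<le> x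
            \<and> bary A B C z + 2 * y\<^sup>2 * bary C A B z \<le> y} = measure lebesgue (convex hull {A, B, C}) / 4"
    by (simp only:)
  have xy: "1/2 \<le> x" "x \<le> 1" "1/2 \<le> y" "y \<le> 1" using x y by auto
  have "(x + y - 1)\<^sup>2 / (2 * x\<^sup>2 + 2 * y\<^sup>2 - 1) = 1 / 4"
    by (rule quarter_cancel[OF trans[OF area_between_corners[OF nd xy \<open>x + y > 1\<close>, symmetric] m] measure_triangle_pos[OF nd]])
  then show ?thesis
    using x y \<open>x + y > 1\<close> \<open>2 * x\<^sup>2 + 2 * y\<^sup>2 - 1 > 0\<close> by (simp add: quarter_relation_def field_simps)
qed

lemma area_half_corner:
  assumes nd: "nondegenerate A B C" and x: "x \<in> {1/2..1}"
  shows "measure lebesgue {z \<in> convex hull {A, B, C}. bary B C A z + 2 * x\<^sup>2 * bary C A B z - x \<le> 0}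
       = measure lebesgue (convex hull {A, B, C}) / 2"
proof -
  have x0: "0 < x" "x \<le> 1" "1 / (2 * x) \<le> 1" "0 < 1 / (2 * x)" using x by (auto simp: field_simps)
  have "1 / (2 * x) * u + x * v + - (x * (1 / (2 * x))) = (u + 2 * x\<^sup>2 * v - x) / (2 * x)" for u v
    using x0 by (simp add: field_simps power2_eq_square)
  then have "1 / (2 * x) * u + x * v + - (x * (1 / (2 * x))) \<le> 0 \<longleftrightarrow> u + 2 * x\<^sup>2 * v - x \<le> 0" for u v
    using x0 by (simp add: divide_le_0_iff)
  then show ?thesis using area_corner[OF nd x0(1,2,4,3)] x0 by simp
qed

text \<open>The lower bounds on x^2 and y^2 ensure that the crossing point is an interior point. They follow from the
  quartering relation, as its parametrization below shows.\<close>

lemma relation_imp_quarters: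
  assumes nd: "nondegenerate A B C" and xy: "quarter_relation x y" "2 * x\<^sup>2 \<ge> 1" "2 * y\<^sup>2 \<ge> 1"
  shows "quarters (convex hull {A, B, C}) (chord A B C x) (chord B C A (1 / (2 * y)))"
proof -
  have x: "1/2 \<le> x" "x \<le> 1" and y: "1/2 \<le> y" "y \<le> 1" and sum: "x + y > 1"
    and rel: "4 * (x + y - 1)\<^sup>2 = 2 * x\<^sup>2 + 2 * y\<^sup>2 - 1"
    using xy(1) by (auto simp: quarter_relation_def)
  have nz: "x \<noteq> 0" "y \<noteq> 0" using x y by auto
  let ?T = "convex hull {A, B, C}"
  define f where "f = (\<lambda>z. bary B C A z + 2 * x\<^sup>2 * bary C A B z - x)"
  define g where "g = (\<lambda>z. bary A B C z + 2 * y\<^sup>2 * bary C A B z - y)"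
  define a b c d where "a = A + x *\<^sub>R (B - A)" and "b = A + (1 / (2 * x)) *\<^sub>R (C - A)"
    and "c = B + (1 / (2 * y)) *\<^sub>R (C - B)" and "d = B + y *\<^sub>R (A - B)"
  have f: "affine_form f" "f a = 0" "f b = 0"
    using corner_form[OF nd nz(1)] by (simp_all add: f_def a_def b_def)
  have g: "affine_form g" "g c = 0" "g d = 0"
    using corner_form_opposite[OF nd nz(2)] by (simp_all add: g_def c_def d_def)
  have ch1: "chord A B C x = closed_segment a b" by (simp add: chord_def a_def b_def)
  have ch2: "chord B C A (1 / (2 * y)) = closed_segment c d" using nz by (simp add: chord_def c_def d_def)
  have half: "1 / (2 * x) \<le> 1" "1 / (2 * y) \<le> 1" using x y by (simp_all add: field_simps)
  note nd2 = nondegenerate_rotate[OF nd]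
  have fr: "{a, b, c, d} \<subseteq> frontier ?T"
    using x y half nz unfolding frontier_triangle_iff[OF nd] insert_subset a_def b_def c_def d_def
    by (simp add: bary_sides[OF nd] bary_sides[OF nd2])
  define h where "h = crossing_height x y"
  define l where "l = x - 2 * x\<^sup>2 * h"
  define P where "P = A + l *\<^sub>R (B - A) + h *\<^sub>R (C - A)"
  have D: "2 * x\<^sup>2 + 2 * y\<^sup>2 - 1 > 0" using crossing_denominator_pos[OF sum] .
  have h: "h * (2 * x\<^sup>2 + 2 * y\<^sup>2 - 1) = x + y - 1" "h > 0" using D sum by (simp_all add: h_def crossing_height_def)
  have strict: "2 * v\<^sup>2 - 1 + 2 * u * (1 - v) > 0" if "u > 0" "v \<le> 1" "2 * v\<^sup>2 \<ge> 1" for u v :: real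
    using that by (cases "v = 1") (auto intro: add_nonneg_pos)
  have l0: "l > 0"
  proof -
    have "l * (2 * x\<^sup>2 + 2 * y\<^sup>2 - 1) > 0"
      unfolding l_def h_def crossing_left_coordinate(1)[OF sum] using strict[of x y] x y xy(3) by simp
    then show ?thesis using D by (simp add: zero_less_mult_iff)
  qed
  have l2: "l = 1 - y + (2 * y\<^sup>2 - 1) * h" unfolding l_def h_def using sum by (intro crossing_left_coordinate)
  have r: "1 - l - h = y - 2 * y\<^sup>2 * h" unfolding l2 by (simp add: algebra_simps)
  have r0: "1 - l - h > 0"
  proof -
    have yx: "y + x > 1" using sum by simp
    have "crossing_height y x = h" by (simp add: h_def crossing_height_def add.commute)
    then have "(y - 2 * y\<^sup>2 * h) * (2 * y\<^sup>2 + 2 * x\<^sup>2 - 1) = y * (2 * x\<^sup>2 - 1 + 2 * y * (1 - x))"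
      using crossing_left_coordinate(1)[OF yx] by simp
    then have "(y - 2 * y\<^sup>2 * h) * (2 * y\<^sup>2 + 2 * x\<^sup>2 - 1) > 0" using strict[of y x] x y xy(2) by simp
    then show ?thesis unfolding r using D by (simp add: zero_less_mult_iff)
  qed
  have bcP: "bary A B C P = 1 - l - h" "bary B C A P = l" "bary C A B P = h"
    using bary_point[OF nd, of l h] by (simp_all add: P_def)
  have Pint: "P \<in> interior ?T" unfolding interior_triangle_iff[OF nd] bcP using l0 r0 h by simp
  have Pab: "P \<in> closed_segment a b"
  proof -
    have "2 * x * h \<le> 1"
    proof -
      have "x * (1 - 2 * x * h) = l" by (simp add: l_def algebra_simps power2_eq_square)
      then have "0 < x * (1 - 2 * x * h)" using l0 by simp
      then show ?thesis using x by (simp add: zero_less_mult_iff)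
    qed
    moreover have "P = (1 - 2 * x * h) *\<^sub>R a + (2 * x * h) *\<^sub>R b"
    proof -
      have "(1 - 2 * x * h) *\<^sub>R a + (2 * x * h) *\<^sub>R b
          = A + ((1 - 2 * x * h) * x) *\<^sub>R (B - A) + (2 * x * h * (1 / (2 * x))) *\<^sub>R (C - A)"
        unfolding a_def b_def by (simp add: algebra_simps)
      also have "(1 - 2 * x * h) * x = l" by (simp add: l_def algebra_simps power2_eq_square)
      also have "2 * x * h * (1 / (2 * x)) = h" using nz by simp
      finally show ?thesis by (simp add: P_def)
    qed
    ultimately show ?thesis unfolding in_segment using h x by (intro conjI exI[of _ "2 * x * h"]) auto
  qed
  have Pcd: "P \<in> closed_segment c d"
  proof -
    have "2 * y * h \<le> 1"
    proof -
      have "y * (1 - 2 * y * h) = 1 - l - h" unfolding r by (simp add: algebra_simps power2_eq_square)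
      then have "0 < y * (1 - 2 * y * h)" using r0 by simp
      then show ?thesis using y by (simp add: zero_less_mult_iff)
    qed
    moreover have "P = (1 - 2 * y * h) *\<^sub>R d + (2 * y * h) *\<^sub>R c"
    proof -
      have "(1 - 2 * y * h) *\<^sub>R d + (2 * y * h) *\<^sub>R c
          = B + ((1 - 2 * y * h) * y) *\<^sub>R (A - B) + (2 * y * h * (1 / (2 * y))) *\<^sub>R (C - B)"
        unfolding c_def d_def by (simp add: algebra_simps)
      also have "(1 - 2 * y * h) * y = 1 - l - h" unfolding r by (simp add: algebra_simps power2_eq_square)
      also have "2 * y * h * (1 / (2 * y)) = h" using nz by simp
      finally show ?thesis by (simp add: P_def algebra_simps)
    qed
    ultimately have "P \<in> closed_segment d c"
      unfolding in_segment using h y by (intro conjI exI[of _ "2 * y * h"]) auto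
    then show ?thesis by (simp add: closed_segment_commute)
  qed
  have inter: "closed_segment a b \<inter> closed_segment c d = {P}"
  proof -
    have "z = P" if z: "z \<in> closed_segment a b" "z \<in> closed_segment c d" for z
    proof -
      have fz: "f z = 0" using affine_form_zero_segment[OF f z(1)] .
      have gz: "g z = 0" using affine_form_zero_segment[OF g z(2)] .
      have "(2 * x\<^sup>2 + 2 * y\<^sup>2 - 1) * bary C A B z = x + y - 1"
        using fz gz bary_sum[OF nd, of z] unfolding f_def g_def by algebra
      then have "(2 * x\<^sup>2 + 2 * y\<^sup>2 - 1) * bary C A B z = (2 * x\<^sup>2 + 2 * y\<^sup>2 - 1) * h"
        using h by (simp add: mult.commute)
      then have "bary C A B z = h" using D by simp
      moreover from this have "bary B C A z = l" using fz by (simp add: f_def l_def)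
      ultimately show ?thesis using point_bary[OF nd, of z] by (simp add: P_def)
    qed
    then show ?thesis using Pab Pcd by blast
  qed
  have "divides_into_four_equal ?T (closed_segment a b \<union> closed_segment c d)"
    unfolding divides_iff_areas[OF convex_convex_hull compact_triangle fr Pint inter f g]
  proof (intro conjI)
    show "measure lebesgue {z \<in> ?T. f z \<le> 0} = measure lebesgue ?T / 2"
      unfolding f_def using area_half_corner[OF nd] x by simp
    have "1 / (2 * y) \<in> {1/2..1}" using y half by (simp add: field_simps)
    then have "measure lebesgue {z \<in> ?T. bary C A B z + 2 * (1 / (2 * y))\<^sup>2 * bary A B C z - 1 / (2 * y) \<le> 0} = measure lebesgue ?T / 2"
      using area_half_corner[OF nd2, of "1 / (2 * y)", unfolded hull_rotate[of B C A]] by blast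
    moreover have "bary C A B z + 2 * (1 / (2 * y))\<^sup>2 * bary A B C z - 1 / (2 * y) = g z / (2 * y\<^sup>2)" for z
      using nz by (simp add: g_def field_simps power2_eq_square)
    ultimately show "measure lebesgue {z \<in> ?T. g z \<le> 0} = measure lebesgue ?T / 2"
      using nz by (simp add: divide_le_0_iff)
    have "measure lebesgue {z \<in> ?T. f z \<le> 0 \<and> g z \<le> 0} = (x + y - 1)\<^sup>2 / (2 * x\<^sup>2 + 2 * y\<^sup>2 - 1) * measure lebesgue ?T"
      using area_between_corners[OF nd x y sum] by (simp add: f_def g_def)
    also have "(x + y - 1)\<^sup>2 / (2 * x\<^sup>2 + 2 * y\<^sup>2 - 1) = 1 / 4" using rel D by (simp add: field_simps)
    finally show "measure lebesgue {z \<in> ?T. f z \<le> 0 \<and> g z \<le> 0} = measure lebesgue ?T / 4" by simp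
  qed
  then show ?thesis unfolding quarters_def ch1 ch2 using fr Pint inter by blast
qed

text \<open>By exchanging the two segments, a pair of different corners can be written as two corners that are
  consecutive in the cyclic order of the vertices. So three sides suffice, each with one orientation.\<close>

lemma quarters_classification:
  assumes nd: "nondegenerate A B C" and q: "quarters (convex hull {A, B, C}) S1 S2"
  shows "\<exists>(U, V, W) \<in> rotations A B C. \<exists>x y. quarter_relation x y \<and> {S1, S2} = {chord U V W x, chord V W U (1 / (2 * y))}"
proof -
  obtain a b c d where S: "S1 = closed_segment a b" "S2 = closed_segment c d" "{a, b, c, d} \<subseteq> frontier (convex hull {A, B, C})"
    using q unfolding quarters_def by blast
  obtain P where P: "P \<in> interior (convex hull {A, B, C})" "closed_segment a b \<inter> closed_segment c d = {P}"
    using q S unfolding quarters_def by blast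
  note nd2 = nondegenerate_rotate[OF nd]
  note nd3 = nondegenerate_rotate[OF nd2]
  \<comment> \<open>forms for the lines of the given segments, before their position is known\<close>
  have line: "\<exists>f. affine_form f \<and> f u = 0 \<and> f v = 0" for u v :: "real \<times> real"
  proof (cases "u = v")
    case True
    show ?thesis
      using True unfolding affine_form_def
      by (intro exI[of _ "\<lambda>z. (1, 0) \<bullet> z + - ((1, 0) \<bullet> u)"] exI[of _ "(1, 0)"] exI[of _ "- ((1, 0) \<bullet> u)"] conjI refl)
        (simp_all add: zero_prod_def)
  next
    case False
    define n where "n = (snd (v - u), - fst (v - u))"
    have "n \<noteq> 0" using False by (auto simp: n_def zero_prod_def prod_eq_iff)
    moreover have "n \<bullet> v + - (n \<bullet> u) = 0"
      by (cases u; cases v) (simp add: n_def algebra_simps)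
    ultimately show ?thesis
      unfolding affine_form_def
      by (intro exI[of _ "\<lambda>z. n \<bullet> z + - (n \<bullet> u)"] exI[of _ n] exI[of _ "- (n \<bullet> u)"] conjI refl) simp_all
  qed
  obtain f0 where f0: "affine_form f0" "f0 a = 0" "f0 b = 0" using line[of a b] by blast
  obtain g0 where g0: "affine_form g0" "g0 c = 0" "g0 d = 0" using line[of c d] by blast
  have P1: "P \<in> closed_segment a b" "P \<in> closed_segment c d" using P by auto
  note q' = q[unfolded S]
  have "\<exists>(U, V, W) \<in> rotations A B C. \<exists>x\<in>{1/2..1}. S1 = chord U V W x"
    using bisecting_chord[OF nd _ _ P(1) P1(1)] quarters_areas(1)[OF q' _ _ _ g0] S by auto
  then obtain U V W x where 1: "(U, V, W) \<in> rotations A B C" "x \<in> {1/2..1}" "S1 = chord U V W x" by auto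
  have "\<exists>(U, V, W) \<in> rotations A B C. \<exists>x\<in>{1/2..1}. S2 = chord U V W x"
    using bisecting_chord[OF nd _ _ P(1) P1(2)] quarters_areas(2)[OF q' f0] S by auto
  then obtain U' V' W' z where 2: "(U', V', W') \<in> rotations A B C" "z \<in> {1/2..1}" "S2 = chord U' V' W' z" by auto
  have adj: "\<exists>x y. quarter_relation x y \<and> {R1, R2} = {chord U V W x, chord V W U (1 / (2 * y))}"
    if r: "nondegenerate U V W" "convex hull {U, V, W} = convex hull {A, B, C}"
      and R: "R1 = chord U V W x" "R2 = chord V W U z" "x \<in> {1/2..1}" "z \<in> {1/2..1}"
      and qR: "quarters (convex hull {A, B, C}) R1 R2" for U V W R1 R2 x z
  proof -
    have z: "1 / (2 * (1 / (2 * z))) = z" "1 / (2 * z) \<in> {1/2..1}" using R(4) by (auto simp: field_simps)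
    have "quarter_relation x (1 / (2 * z))"
      using quarters_imp_relation[OF r(1) R(3) z(2)] qR unfolding z(1) r(2) R(1,2) by blast
    then show ?thesis using R z(1) by metis
  qed
  have no: "\<not> quarters (convex hull {A, B, C}) (chord U V W x) (chord U V W z)"
    if "(U, V, W) \<in> rotations A B C" for U V W
    using that quarters_same_corner[OF nd 1(2) 2(2)] quarters_same_corner[OF nd2 1(2) 2(2)]
      quarters_same_corner[OF nd3 1(2) 2(2)]
    by (auto simp: rotations_def insert_commute)
  have qs: "quarters (convex hull {A, B, C}) S2 S1" using q quarters_commute by metis
  have h2: "convex hull {B, C, A} = convex hull {A, B, C}" and h3: "convex hull {C, A, B} = convex hull {A, B, C}"
    by (simp_all add: insert_commute)
  have ne: "\<not> (U = U' \<and> V = V' \<and> W = W')" using no[OF 1(1)] q 1 2 by auto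
  have rot: "(A, B, C) \<in> rotations A B C" "(B, C, A) \<in> rotations A B C" "(C, A, B) \<in> rotations A B C"
    by (simp_all add: rotations_def)
  note xz = 1(2) 2(2)
  have found: ?thesis
    if "(U, V, W) \<in> rotations A B C"
      and "\<exists>x y. quarter_relation x y \<and> {S1, S2} = {chord U V W x, chord V W U (1 / (2 * y))}" for U V W
    using that by (intro bexI[of _ "(U, V, W)"]) (simp only: prod.case)
  consider
      "S1 = chord A B C x" "S2 = chord B C A z" | "S1 = chord B C A x" "S2 = chord C A B z" | "S1 = chord C A B x" "S2 = chord A B C z"
    | "S2 = chord A B C z" "S1 = chord B C A x" | "S2 = chord B C A z" "S1 = chord C A B x" | "S2 = chord C A B z" "S1 = chord A B C x"
    using 1(1,3) 2(1,3) ne unfolding rotations_def by (elim insertE emptyE; auto)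
  then show ?thesis
  proof cases
    case 1
    show ?thesis by (rule found[OF rot(1) adj[OF nd refl 1 xz q]])
  next
    case 2
    show ?thesis by (rule found[OF rot(2) adj[OF nd2 h2 2 xz q]])
  next
    case 3
    show ?thesis by (rule found[OF rot(3) adj[OF nd3 h3 3 xz q]])
  next
    case 4
    show ?thesis
      by (rule found[OF rot(1) adj[OF nd refl 4 xz(2,1) qs, unfolded insert_commute[of S2 S1]]])
  next
    case 5
    show ?thesis
      by (rule found[OF rot(2) adj[OF nd2 h2 5 xz(2,1) qs, unfolded insert_commute[of S2 S1]]])
  next
    case 6
    show ?thesis
      by (rule found[OF rot(3) adj[OF nd3 h3 6 xz(2,1) qs, unfolded insert_commute[of S2 S1]]])
  qed
qed

section \<open>The quartering relation and its rational parametrization\<close>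

definition mmax :: real where "mmax = sqrt 2 - 1"

text \<open>The conic of the quartering relation passes through (1/2,1/2), and \<open>m = (x - y) / (x + y - 1)\<close> is
  the parameter given by the lines through this point. The quantities below are x + y - 1, x, c(x) - 1/2 and r(x) as
  functions of m; the exchange of x and y is the reflection m to -m.\<close>

definition excess :: "real \<Rightarrow> real" where "excess m = 2 / (3 - m\<^sup>2)"
definition xcut :: "real \<Rightarrow> real" where "xcut m = (1 + excess m * (1 + m)) / 2"
definition shift :: "real \<Rightarrow> real" where "shift m = m * excess m * (1 + excess m)"
definition radius :: "real \<Rightarrow> real" where "radius m = 2 * (excess m)\<^sup>2"

lemma mmax_pos: "0 < mmax" "mmax < 1/2" and mmax_sq: "mmax\<^sup>2 = 1 - 2 * mmax"
proof -
  have "1 < sqrt 2" by simp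
  have "sqrt 2 < 3/2" by (rule real_less_lsqrt) (auto simp: power2_eq_square)
  then show "0 < mmax" "mmax < 1/2" using \<open>1 < sqrt 2\<close> by (auto simp: mmax_def)
  show "mmax\<^sup>2 = 1 - 2 * mmax" by (simp add: mmax_def power2_eq_square algebra_simps)
qed

lemma le_mmax_iff:
  assumes "m > -1" shows "m \<le> mmax \<longleftrightarrow> (m + 1)\<^sup>2 \<le> 2"
proof -
  have "m \<le> mmax \<longleftrightarrow> m + 1 \<le> sqrt 2" by (auto simp: mmax_def)
  also have "\<dots> \<longleftrightarrow> (m + 1)\<^sup>2 \<le> 2"
  proof -
    have "sqrt ((m + 1)\<^sup>2) = m + 1" using assms by simp
    then show ?thesis using real_sqrt_le_iff[of "(m + 1)\<^sup>2" 2] by simp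
  qed
  finally show ?thesis .
qed

text \<open>The relation \<open>m\<^sup>2 * excess m = 3 * excess m - 2\<close> eliminates m from expressions that are even in m.\<close>

lemma excess_facts:
  assumes "m \<in> {-mmax..mmax}"
  shows "excess m * (3 - m\<^sup>2) = 2" "2/3 \<le> excess m" "(excess m)\<^sup>2 \<le> 1/2" "m\<^sup>2 * excess m = 3 * excess m - 2" "m\<^sup>2 \<le> 1 - 2 * mmax"
proof -
  have "\<bar>m\<bar> \<le> mmax" using assms by auto
  then have "m\<^sup>2 \<le> mmax\<^sup>2" by (metis abs_ge_zero power2_abs power_mono)
  then show sq: "m\<^sup>2 \<le> 1 - 2 * mmax" by (simp add: mmax_sq)
  then have pos: "3 - m\<^sup>2 \<ge> 2 * sqrt 2" by (simp add: mmax_def)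
  have s2: "sqrt 2 > 0" by simp
  have pos0: "3 - m\<^sup>2 > 0" using pos s2 by linarith
  then have "3 - m\<^sup>2 \<noteq> 0" by simp
  then show 1: "excess m * (3 - m\<^sup>2) = 2" unfolding excess_def by (metis nonzero_eq_divide_eq)
  show "m\<^sup>2 * excess m = 3 * excess m - 2" using 1 by (simp add: algebra_simps)
  have "2 / 3 \<le> 2 / (3 - m\<^sup>2)" using pos0 by (intro divide_left_mono) auto
  then show "2/3 \<le> excess m" by (simp add: excess_def)
  have "excess m \<le> 2 / (2 * sqrt 2)" unfolding excess_def using pos pos0 by (intro divide_left_mono) auto
  moreover have "excess m \<ge> 0" using pos0 by (simp add: excess_def)
  ultimately have "(excess m)\<^sup>2 \<le> (2 / (2 * sqrt 2))\<^sup>2" by (intro power_mono)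
  then show "(excess m)\<^sup>2 \<le> 1/2" by (simp add: power_divide)
qed

lemma excess_minus [simp]: "excess (- m) = excess m" by (simp add: excess_def)
lemma shift_minus [simp]: "shift (- m) = - shift m" by (simp add: shift_def)
lemma radius_minus [simp]: "radius (- m) = radius m" by (simp add: radius_def)

lemma xcut_sum: "xcut m + xcut (- m) = 1 + excess m" and xcut_diff: "xcut m - xcut (- m) = m * excess m"
  by (simp_all add: xcut_def field_simps)

lemma xcut_squares:
  assumes "m \<in> {-mmax..mmax}"
  shows "(xcut m)\<^sup>2 - (xcut (- m))\<^sup>2 = shift m" "(xcut m)\<^sup>2 + (xcut (- m))\<^sup>2 - 1/2 = radius m"
proof -
  show "(xcut m)\<^sup>2 - (xcut (- m))\<^sup>2 = shift m"
    using xcut_sum[of m] xcut_diff[of m] unfolding shift_def by algebra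
  have "2 * ((xcut m)\<^sup>2 + (xcut (- m))\<^sup>2 - 1/2) = (xcut m + xcut (-m))\<^sup>2 + (xcut m - xcut (-m))\<^sup>2 - 1" by algebra
  also have "\<dots> = (1 + excess m)\<^sup>2 + m\<^sup>2 * excess m * excess m - 1" unfolding xcut_sum xcut_diff by algebra
  also have "\<dots> = 2 * radius m" unfolding excess_facts(4)[OF assms] radius_def by algebra
  finally show "(xcut m)\<^sup>2 + (xcut (- m))\<^sup>2 - 1/2 = radius m" by simp
qed

lemma xcut_le_one_iff:
  assumes "3 - m\<^sup>2 > 0" "m > -1"
  shows "xcut m \<le> 1 \<longleftrightarrow> m \<le> mmax"
proof -
  have "xcut m \<le> 1 \<longleftrightarrow> 2 * (1 + m) \<le> 3 - m\<^sup>2" using assms by (simp add: xcut_def excess_def field_simps)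
  also have "\<dots> \<longleftrightarrow> (m + 1)\<^sup>2 \<le> 2" by (auto simp: power2_eq_square algebra_simps)
  finally show ?thesis using le_mmax_iff[OF assms(2)] by simp
qed

lemma xcut_mmax [simp]: "xcut mmax = 1" "xcut (- mmax) = sqrt 2 / 2"
proof -
  have "3 - mmax\<^sup>2 = 2 * sqrt 2" "2 * sqrt 2 = 2 * (1 + mmax)" by (simp_all add: mmax_sq) (simp_all add: mmax_def)
  then have e: "excess mmax * (1 + mmax) = 1" using mmax_pos by (simp add: excess_def)
  show "xcut mmax = 1" using e by (simp add: xcut_def)
  have "excess mmax = sqrt 2 / 2" unfolding excess_def \<open>3 - mmax\<^sup>2 = 2 * sqrt 2\<close> by (simp add: real_div_sqrt field_simps)
  then show "xcut (- mmax) = sqrt 2 / 2" using xcut_sum[of mmax] \<open>xcut mmax = 1\<close> by simp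
qed

lemma xcut_ge:
  assumes "m \<in> {-mmax..mmax}"
  shows "xcut m \<ge> sqrt 2 / 2" "xcut m \<le> 1" "2 * (xcut m)\<^sup>2 \<ge> 1" "m < mmax \<Longrightarrow> xcut m < 1"
proof -
  have e: "excess m * (3 - m\<^sup>2) = 2" "2/3 \<le> excess m" using excess_facts[OF assms] by auto
  have pos: "3 - m\<^sup>2 > 0" using excess_facts(5)[OF assms] mmax_pos by simp
  have m1: "m > -1" using assms mmax_pos by auto
  show "xcut m \<le> 1" using xcut_le_one_iff[OF pos m1] assms by auto
  show "xcut m < 1" if "m < mmax"
  proof -
    have "xcut m \<noteq> 1"
    proof
      assume "xcut m = 1"
      then have "(m + 1)\<^sup>2 = 2" using e pos by (simp add: xcut_def excess_def field_simps power2_eq_square)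
      then have "m + 1 = sqrt 2" using m1 real_sqrt_unique[of "m + 1" 2] by simp
      then show False using that by (simp add: mmax_def)
    qed
    then show ?thesis using \<open>xcut m \<le> 1\<close> by simp
  qed
  have "(m + mmax) * (2 + mmax * (m - mmax)) \<ge> 0"
  proof -
    have "mmax * (m - mmax) \<ge> mmax * (- 2 * mmax)" using assms mmax_pos by (intro mult_left_mono) auto
    moreover have "mmax * (- 2 * mmax) = 4 * mmax - 2" using mmax_sq by algebra
    ultimately show ?thesis using assms mmax_pos by (intro mult_nonneg_nonneg) auto
  qed
  moreover have "2 * (1 + m) - mmax * (3 - m\<^sup>2) = (m + mmax) * (2 + mmax * (m - mmax))" using mmax_sq by algebra
  ultimately have "2 * (1 + m) \<ge> mmax * (3 - m\<^sup>2)" by simp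
  then have "excess m * (1 + m) \<ge> mmax" using pos by (simp add: excess_def field_simps)
  then show ge: "xcut m \<ge> sqrt 2 / 2" by (simp add: xcut_def mmax_def)
  have "(xcut m)\<^sup>2 \<ge> (sqrt 2 / 2)\<^sup>2" using ge by (intro power_mono) auto
  then show "2 * (xcut m)\<^sup>2 \<ge> 1" by (simp add: power_divide)
qed

lemma sqrt_half_bounds: "sqrt 2 / 2 > 7/10"
proof -
  have "sqrt 2 > 7/5" by (rule real_less_rsqrt) (simp add: power2_eq_square)
  then show ?thesis by simp
qed

lemma quarter_relation_xcut:
  assumes "m \<in> {-mmax..mmax}"
  shows "quarter_relation (xcut m) (xcut (- m))"
proof -
  have m': "- m \<in> {-mmax..mmax}" using assms by auto
  have "4 * (xcut m + xcut (- m) - 1)\<^sup>2 = 2 * ((xcut m)\<^sup>2 + (xcut (- m))\<^sup>2 - 1/2)"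
    unfolding xcut_squares(2)[OF assms] xcut_sum radius_def by simp
  then show ?thesis
    using xcut_ge[OF assms] xcut_ge[OF m'] sqrt_half_bounds by (auto simp: quarter_relation_def)
qed

text \<open>In terms of e = x + y - 1 and x - y = m e the relation becomes e (3 - m^2) = 2 after division by e.\<close>

lemma quarter_relation_imp_xcut:
  assumes "quarter_relation x y"
  obtains m where "m \<in> {-mmax..mmax}" "x = xcut m" "y = xcut (- m)"
proof -
  have x: "x \<le> 1" and y: "y \<le> 1" and sum: "x + y > 1" and x2: "x \<ge> 1/2" and y2: "y \<ge> 1/2"
    and rel: "4 * (x + y - 1)\<^sup>2 = 2 * x\<^sup>2 + 2 * y\<^sup>2 - 1"
    using assms by (auto simp: quarter_relation_def)
  define e m where "e = x + y - 1" and "m = (x - y) / e"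
  have e0: "e > 0" using sum by (simp add: e_def)
  have d: "x - y = m * e" using e0 by (simp add: m_def)
  have "e * (e * (3 - m\<^sup>2)) = e * 2" using rel d unfolding e_def by algebra
  then have em: "e * (3 - m\<^sup>2) = 2" using e0 by simp
  then have pos: "3 - m\<^sup>2 > 0" using e0 by (metis zero_less_mult_pos zero_less_numeral)
  have e: "e = excess m" using em pos by (simp add: excess_def field_simps)
  have "x = xcut m" "y = xcut (- m)" using d by (simp_all add: xcut_def flip: e) (simp_all add: e_def algebra_simps)
  have "m < 1" "m > -1"
  proof -
    have "u \<noteq> 1/2" if u: "4 * (u + v - 1)\<^sup>2 = 2 * u\<^sup>2 + 2 * v\<^sup>2 - 1" "u + v > 1" "v \<le> 1" for u v :: real
    proof
      assume "u = 1/2"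
      then have "(2 * v - 1) * (2 * v - 3) = 0" using u(1) by algebra
      then show False using u(2,3) \<open>u = 1/2\<close> by auto
    qed
    from this[of x y] this[of y x] have "x \<noteq> 1/2" "y \<noteq> 1/2"
      using rel sum x y by (auto simp: algebra_simps)
    then have "x - y < e" "y - x < e" using x2 y2 unfolding e_def by auto
    then show "m < 1" "m > -1" using e0 by (simp_all add: m_def field_simps)
  qed
  have "m \<le> mmax" using xcut_le_one_iff[OF pos \<open>m > -1\<close>] x \<open>x = xcut m\<close> by simp
  moreover have "- m \<le> mmax" using xcut_le_one_iff[of "- m"] pos \<open>m < 1\<close> y \<open>y = xcut (- m)\<close> by simp
  ultimately have "m \<in> {-mmax..mmax}" by auto
  then show ?thesis using \<open>x = xcut m\<close> \<open>y = xcut (- m)\<close> by (rule that)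
qed

lemma radicand: "(12 * x\<^sup>2 - 16 * x + 6 :: real) > 0"
proof -
  have "12 * x\<^sup>2 - 16 * x + 6 = 12 * (x - 2/3)\<^sup>2 + 2/3" by (simp add: power2_eq_square algebra_simps)
  then show ?thesis by (smt (verit) zero_le_power2 divide_pos_pos)
qed

lemma yf_relation: "4 * (x + yf x - 1)\<^sup>2 = 2 * x\<^sup>2 + 2 * (yf x)\<^sup>2 - 1"
proof -
  have "(2 * (yf x - 2 + 2 * x))\<^sup>2 = 12 * x\<^sup>2 - 16 * x + 6" using radicand[of x] by (simp add: yf_def)
  then show ?thesis by algebra
qed

text \<open>As an equation for y, the quartering relation is quadratic; \<^const>\<open>yf\<close> is its larger solution.\<close>

lemma yf_eqI:
  assumes rel: "4 * (x + y - 1)\<^sup>2 = 2 * x\<^sup>2 + 2 * y\<^sup>2 - 1" and ge: "y - 2 + 2 * x \<ge> 0"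
  shows "yf x = y"
proof -
  have "(2 * (y - 2 + 2 * x))\<^sup>2 = 12 * x\<^sup>2 - 16 * x + 6" using rel by algebra
  then have "sqrt (12 * x\<^sup>2 - 16 * x + 6) = 2 * (y - 2 + 2 * x)" using ge by (intro real_sqrt_unique) auto
  then show ?thesis by (simp add: yf_def field_simps)
qed

lemma yf_xcut:
  assumes "m \<in> {-mmax..mmax}"
  shows "yf (xcut m) = xcut (- m)"
proof (rule yf_eqI)
  have m': "- m \<in> {-mmax..mmax}" using assms by auto
  show "4 * (xcut m + xcut (- m) - 1)\<^sup>2 = 2 * (xcut m)\<^sup>2 + 2 * (xcut (- m))\<^sup>2 - 1"
    using quarter_relation_xcut[OF assms] by (simp add: quarter_relation_def)
  show "xcut (- m) - 2 + 2 * xcut m \<ge> 0" using xcut_ge(1)[OF assms] xcut_ge(1)[OF m'] sqrt_half_bounds by linarith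
qed

text \<open>For x between sqrt 2 / 2 and 1 the value of \<^const>\<open>yf\<close> lies between 1/2 and 1, so that x and it satisfy the
  quartering relation.\<close>

lemma xcut_onto:
  assumes "x \<in> {sqrt 2 / 2..1}"
  obtains m where "m \<in> {-mmax..mmax}" "x = xcut m"
proof -
  have x: "x \<le> 1" "x > 7/10" using assms sqrt_half_bounds by auto
  have sq: "x\<^sup>2 \<ge> 1/2" using power_mono[of "sqrt 2 / 2" x 2] assms by (simp add: power_divide)
  let ?s = "sqrt (12 * x\<^sup>2 - 16 * x + 6)"
  have "?s \<le> 2 * (2 * x - 1)"
    using x sq by (intro real_le_lsqrt) (auto simp: power2_eq_square algebra_simps)
  then have y1: "yf x \<le> 1" by (simp add: yf_def)
  have "(2 * x - 1) * (3 - 2 * x) \<ge> 0" using x by simp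
  then have "?s \<ge> 4 * x - 3" by (intro real_le_rsqrt) (auto simp: power2_eq_square algebra_simps)
  then have y2: "yf x \<ge> 1/2" by (simp add: yf_def)
  have "quarter_relation x (yf x)"
    using x y1 y2 yf_relation[of x] by (auto simp: quarter_relation_def)
  then show ?thesis using quarter_relation_imp_xcut that by metis
qed

lemma xcut_inj:
  assumes "m \<in> {-mmax..mmax}" "n \<in> {-mmax..mmax}" "xcut m = xcut n"
  shows "m = n"
proof -
  have "xcut (- m) = xcut (- n)" using assms yf_xcut by metis
  then have "excess m = excess n" "m * excess m = n * excess n" using xcut_sum[of m] xcut_sum[of n] xcut_diff[of m] xcut_diff[of n] assms(3) by linarith+
  moreover have "excess m > 0" using excess_facts(2)[OF assms(1)] by simp
  ultimately show ?thesis by simp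
qed

lemma xcut_ge_iff:
  assumes "m \<in> {-mmax..mmax}"
  shows "5/6 \<le> xcut m \<longleftrightarrow> 0 \<le> m"
proof -
  have pos: "3 - m\<^sup>2 > 0" using excess_facts(5)[OF assms] mmax_pos by simp
  have "5/6 \<le> xcut m \<longleftrightarrow> 0 \<le> m * (3 + m)"
  proof -
    have "6 * xcut m - 5 = 2 * (m * (3 + m)) / (3 - m\<^sup>2)"
      using pos by (simp add: xcut_def excess_def field_simps power2_eq_square)
    then have "0 \<le> 6 * xcut m - 5 \<longleftrightarrow> 0 \<le> m * (3 + m)" using pos by (simp add: zero_le_divide_iff)
    then show ?thesis by auto
  qed
  also have "\<dots> \<longleftrightarrow> 0 \<le> m" using assms mmax_pos by (auto simp: zero_le_mult_iff)
  finally show ?thesis .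
qed

lemma cf_xcut: "m \<in> {-mmax..mmax} \<Longrightarrow> cf (xcut m) = 1/2 + shift m"
  and rf_xcut: "m \<in> {-mmax..mmax} \<Longrightarrow> rf (xcut m) = radius m"
  using xcut_squares[of m] yf_xcut[of m] by (simp_all add: cf_def rf_def)

text \<open>The quotient r'(x) / c'(x) of the derivatives.\<close>

definition slope :: "real \<Rightarrow> real" where "slope m = 4 * m * (excess m)\<^sup>2 / (6 * (excess m)\<^sup>2 - 1)"

lemma slope_denominator_pos: "m \<in> {-mmax..mmax} \<Longrightarrow> 6 * (excess m)\<^sup>2 - 1 > 0"
  using power_mono[of "2/3" "excess m" 2] excess_facts(2)[of m] by (simp add: power2_eq_square)

text \<open>Implicit differentiation of the quartering relation gives y' = - (x + 2y - 2) / (y + 2x - 2), where the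
  denominator is half the square root in the definition of \<^const>\<open>yf\<close>.\<close>

lemma deriv_cf_rf:
  assumes "m \<in> {-mmax..mmax}"
  shows "deriv cf (xcut m) > 0" "deriv rf (xcut m) = slope m * deriv cf (xcut m)"
proof -
  define x y where "x = xcut m" and "y = xcut (- m)"
  have y: "yf x = y" using yf_xcut[OF assms] by (simp add: x_def y_def)
  have m': "- m \<in> {-mmax..mmax}" using assms by auto
  define q where "q = y - 2 + 2 * x"
  have q: "q > 0" using xcut_ge(1)[OF assms] xcut_ge(1)[OF m'] sqrt_half_bounds unfolding q_def x_def y_def by linarith
  have s: "sqrt (12 * x\<^sup>2 - 16 * x + 6) = 2 * q" using y by (simp add: yf_def q_def)
  define y' where "y' = - (x + 2 * y - 2) / q"
  have dy: "(yf has_real_derivative y') (at x)"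
  proof -
    have "((\<lambda>x. 12 * x\<^sup>2 - 16 * x + 6) has_real_derivative (24 * x - 16)) (at x)"
      by (auto intro!: derivative_eq_intros)
    from DERIV_chain2[OF DERIV_real_sqrt[OF radicand] this]
    have "((\<lambda>x. 2 - 2 * x + 1/2 * sqrt (12 * x\<^sup>2 - 16 * x + 6)) has_real_derivative
        (0 - 2 * 1 + 1/2 * (inverse (sqrt (12 * x\<^sup>2 - 16 * x + 6)) / 2 * (24 * x - 16)))) (at x)"
      by (intro DERIV_add DERIV_diff DERIV_cmult DERIV_const DERIV_ident)
    moreover have "0 - 2 * 1 + 1/2 * (inverse (sqrt (12 * x\<^sup>2 - 16 * x + 6)) / 2 * (24 * x - 16)) = y'"
      unfolding s y'_def using q by (simp add: field_simps) (simp add: q_def algebra_simps)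
    ultimately show ?thesis unfolding yf_def[abs_def] by simp
  qed
  have "(cf has_real_derivative (2 * x - 2 * y * y')) (at x)"
    unfolding cf_def[abs_def] by (rule derivative_eq_intros dy refl | simp)+ (simp add: y)
  then have c: "deriv cf x = 2 * x - 2 * y * y'" by (rule DERIV_imp_deriv)
  have "(rf has_real_derivative (2 * x + 2 * y * y')) (at x)"
    unfolding rf_def[abs_def] by (rule derivative_eq_intros dy refl | simp)+ (simp add: y)
  then have r: "deriv rf x = 2 * x + 2 * y * y'" by (rule DERIV_imp_deriv)
  have q': "q * y' = - (x + 2 * y - 2)" using q by (simp add: y'_def)
  have sum: "x + y = 1 + excess m" and diff: "x - y = m * excess m" using xcut_sum xcut_diff by (simp_all add: x_def y_def)
  have "q * deriv cf x = 3 * (x + y)\<^sup>2 - 4 * (x + y) + (x - y)\<^sup>2" unfolding c using q' q_def by algebra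
  also have "\<dots> = 3 * (1 + excess m)\<^sup>2 - 4 * (1 + excess m) + m\<^sup>2 * excess m * excess m" unfolding sum diff by algebra
  also have "\<dots> = 6 * (excess m)\<^sup>2 - 1" unfolding excess_facts(4)[OF assms] by algebra
  finally have qc: "q * deriv cf x = 6 * (excess m)\<^sup>2 - 1" .
  have "q * deriv rf x = 4 * (x - y) * (x + y - 1)" unfolding r using q' q_def by algebra
  also have "\<dots> = 4 * m * (excess m)\<^sup>2" unfolding sum diff by algebra
  finally have qr: "q * deriv rf x = 4 * m * (excess m)\<^sup>2" .
  have D: "6 * (excess m)\<^sup>2 - 1 > 0" by (rule slope_denominator_pos[OF assms])
  show "deriv cf (xcut m) > 0" using qc q D unfolding x_def[symmetric] by (metis zero_less_mult_pos)
  have "q * (slope m * deriv cf x) = slope m * (q * deriv cf x)" by simp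
  also have "\<dots> = q * deriv rf x" unfolding qc qr using D by (simp add: slope_def)
  finally have "q * deriv rf x = q * (slope m * deriv cf x)" by (rule sym)
  moreover have "q \<noteq> 0" using q by simp
  ultimately have "deriv rf x = slope m * deriv cf x" by (metis mult_left_cancel)
  then show "deriv rf (xcut m) = slope m * deriv cf (xcut m)" unfolding x_def .
qed

section \<open>Quadrisections as zeros of a function\<close>

definition pair :: "real \<times> real \<Rightarrow> real \<times> real \<Rightarrow> real \<times> real \<Rightarrow> real \<Rightarrow> (real \<times> real) set set" where
  "pair A B C m = {chord A B C (xcut m), chord B C A (1 / (2 * xcut (- m)))}"

text \<open>Defined for the pair of point sets, so that it does not depend on the order and orientation of the segments
  or on the side to which the pair is assigned.\<close>

definition orthogonal_pair :: "(real \<times> real) set set \<Rightarrow> bool" where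
  "orthogonal_pair Q \<longleftrightarrow> (\<exists>a b c d. Q = {closed_segment a b, closed_segment c d} \<and> (b - a) \<bullet> (d - c) = 0)"

lemma orthogonal_pair_segments:
  "orthogonal_pair {closed_segment a b, closed_segment c d} \<longleftrightarrow> (b - a) \<bullet> (d - c) = 0"
proof
  assume "orthogonal_pair {closed_segment a b, closed_segment c d}"
  then obtain a' b' c' d' where eq: "{closed_segment a b, closed_segment c d} = {closed_segment a' b', closed_segment c' d'}"
    and o: "(b' - a') \<bullet> (d' - c') = 0" unfolding orthogonal_pair_def by blast
  from eq consider "closed_segment a b = closed_segment a' b'" "closed_segment c d = closed_segment c' d'"
    | "closed_segment a b = closed_segment c' d'" "closed_segment c d = closed_segment a' b'"
    by (meson doubleton_eq_iff)
  then show "(b - a) \<bullet> (d - c) = 0"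
    by cases (use o orthogonal_segments_cong in \<open>metis inner_commute\<close>)+
next
  assume "(b - a) \<bullet> (d - c) = 0"
  then show "orthogonal_pair {closed_segment a b, closed_segment c d}"
    unfolding orthogonal_pair_def by blast
qed

text \<open>The power of the point (h,t) with respect to the circle with centre (c,0) and radius r belonging to m, where
  N = h^2 + t^2. In this form it is affine in h and N, which avoids t.\<close>

definition gap :: "real \<Rightarrow> real \<Rightarrow> real \<Rightarrow> real" where
  "gap h N m = N - (1 + 2 * shift m) * h + (1/2 + shift m)\<^sup>2 - (radius m)\<^sup>2"

text \<open>If AB is mapped to the unit interval by a similarity, then C is mapped to a point with first coordinate h and
  squared norm N.\<close>

definition shape :: "real \<times> real \<Rightarrow> real \<times> real \<Rightarrow> real \<times> real \<Rightarrow> real \<Rightarrow> real \<Rightarrow> bool" where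
  "shape A B C h N \<longleftrightarrow> (\<exists>s>0. (B - A) \<bullet> (B - A) = s \<and> (B - A) \<bullet> (C - A) = s * h \<and> (C - A) \<bullet> (C - A) = s * N)"

text \<open>With u = B - A and v = C - A the segments have the directions v - 2x^2 u and v - (1 - 2y^2) u. The
  points 2x^2 and 1 - 2y^2 on the line AB are the ends c + r and c - r of a diameter, so that
  perpendicularity is the theorem of Thales.\<close>

lemma orthogonal_pair_iff_gap:
  assumes m: "m \<in> {-mmax..mmax}" and s: "shape A B C h N"
  shows "orthogonal_pair (pair A B C m) \<longleftrightarrow> gap h N m = 0"
proof -
  have m': "- m \<in> {-mmax..mmax}" using m by auto
  define x y where "x = xcut m" and "y = xcut (- m)"
  have nz: "x \<noteq> 0" "y \<noteq> 0" using xcut_ge(1)[OF m] xcut_ge(1)[OF m'] sqrt_half_bounds by (auto simp: x_def y_def)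
  define u v where "u = B - A" and "v = C - A"
  obtain k where k: "k > 0" "u \<bullet> u = k" "u \<bullet> v = k * h" "v \<bullet> v = k * N"
    using s unfolding shape_def u_def v_def by blast
  have ch1: "chord A B C x = closed_segment (A + x *\<^sub>R u) (A + (1 / (2 * x)) *\<^sub>R v)"
    by (simp add: chord_def u_def v_def)
  have ch2: "chord B C A (1 / (2 * y)) = closed_segment (A + u + (1 / (2 * y)) *\<^sub>R (v - u)) (A + u - y *\<^sub>R u)"
  proof -
    have dirs: "C - B = v - u" "A - B = - u" and BA: "A + u = B" by (simp_all add: u_def v_def)
    show ?thesis unfolding chord_def dirs BA using nz by simp
  qed
  have d1: "(A + (1 / (2 * x)) *\<^sub>R v) - (A + x *\<^sub>R u) = (1 / (2 * x)) *\<^sub>R (v - (2 * x\<^sup>2) *\<^sub>R u)"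
    using nz by (simp add: scaleR_diff_right power2_eq_square)
  have d2: "(A + u - y *\<^sub>R u) - (A + u + (1 / (2 * y)) *\<^sub>R (v - u)) = (- 1 / (2 * y)) *\<^sub>R (v - (1 - 2 * y\<^sup>2) *\<^sub>R u)"
  proof -
    have "(- 1 / (2 * y)) *\<^sub>R (v - (1 - 2 * y\<^sup>2) *\<^sub>R u) = (- 1 / (2 * y)) *\<^sub>R v - ((- 1 / (2 * y)) * (1 - 2 * y\<^sup>2)) *\<^sub>R u"
      by (simp add: scaleR_diff_right)
    also have "(- 1 / (2 * y)) * (1 - 2 * y\<^sup>2) = y - 1 / (2 * y)" using nz by (simp add: field_simps power2_eq_square)
    finally have e: "(- 1 / (2 * y)) *\<^sub>R (v - (1 - 2 * y\<^sup>2) *\<^sub>R u) = (- 1 / (2 * y)) *\<^sub>R v - (y - 1 / (2 * y)) *\<^sub>R u" .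
    show ?thesis unfolding e by (simp add: scaleR_diff_right scaleR_diff_left)
  qed
  have "orthogonal_pair (pair A B C m) \<longleftrightarrow>
     ((1 / (2 * x)) *\<^sub>R (v - (2 * x\<^sup>2) *\<^sub>R u)) \<bullet> ((- 1 / (2 * y)) *\<^sub>R (v - (1 - 2 * y\<^sup>2) *\<^sub>R u)) = 0"
    unfolding pair_def x_def[symmetric] y_def[symmetric] ch1 ch2 orthogonal_pair_segments d1 d2 ..
  also have "\<dots> \<longleftrightarrow> (v - (2 * x\<^sup>2) *\<^sub>R u) \<bullet> (v - (1 - 2 * y\<^sup>2) *\<^sub>R u) = 0" using nz by simp
  also have "(v - (2 * x\<^sup>2) *\<^sub>R u) \<bullet> (v - (1 - 2 * y\<^sup>2) *\<^sub>R u)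
     = v \<bullet> v - (2 * x\<^sup>2 + (1 - 2 * y\<^sup>2)) * (u \<bullet> v) + 2 * x\<^sup>2 * (1 - 2 * y\<^sup>2) * (u \<bullet> u)"
    by (simp add: inner_diff_left inner_diff_right inner_commute[of v u] algebra_simps)
  also have "\<dots> = k * (N - (2 * x\<^sup>2 + (1 - 2 * y\<^sup>2)) * h + 2 * x\<^sup>2 * (1 - 2 * y\<^sup>2))"
    unfolding k by (simp add: algebra_simps)
  also have "N - (2 * x\<^sup>2 + (1 - 2 * y\<^sup>2)) * h + 2 * x\<^sup>2 * (1 - 2 * y\<^sup>2) = gap h N m"
  proof -
    have e: "2 * x\<^sup>2 = 1/2 + shift m + radius m" "1 - 2 * y\<^sup>2 = 1/2 + shift m - radius m"
      using xcut_squares[OF m] by (simp_all add: x_def y_def)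
    show ?thesis unfolding e gap_def by (simp add: power2_eq_square algebra_simps)
  qed
  finally show ?thesis using k by simp
qed

definition endpoints :: "(real \<times> real) set set \<Rightarrow> (real \<times> real) set" where
  "endpoints Q = {z. \<exists>w. closed_segment z w \<in> Q}"

text \<open>The side AB with A and without B. The three half-open sides partition the frontier of the triangle, and the
  side to which a pair with m < \<open>mmax\<close> is assigned is the only one that contains two endpoints, also if
  one of the chords is a median.\<close>

definition half_open_side :: "real \<times> real \<Rightarrow> real \<times> real \<Rightarrow> real \<times> real \<Rightarrow> (real \<times> real) set" where
  "half_open_side A B C = {z. bary C A B z = 0 \<and> bary A B C z > 0}"

lemma endpoints_segments: "endpoints {closed_segment a b, closed_segment c d} = {a, b, c, d}"
proof
  show "endpoints {closed_segment a b, closed_segment c d} \<subseteq> {a, b, c, d}"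
    unfolding endpoints_def by (auto simp: doubleton_eq_iff)
  have "closed_segment b a = closed_segment a b" "closed_segment d c = closed_segment c d"
    by (simp_all only: closed_segment_commute)
  then show "{a, b, c, d} \<subseteq> endpoints {closed_segment a b, closed_segment c d}"
    unfolding endpoints_def by blast
qed

lemma endpoints_on_sides:
  assumes nd: "nondegenerate A B C" and m: "m \<in> {-mmax..<mmax}"
  shows "endpoints (pair A B C m) \<inter> half_open_side A B C = {A + xcut m *\<^sub>R (B - A), B + xcut (- m) *\<^sub>R (A - B)}"
    and "\<exists>z. endpoints (pair A B C m) \<inter> half_open_side B C A = {z}"
    and "\<exists>z. endpoints (pair A B C m) \<inter> half_open_side C A B = {z}"
proof -
  have mm: "m \<in> {-mmax..mmax}" "- m \<in> {-mmax..mmax}" using m by auto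
  define x y where "x = xcut m" and "y = xcut (- m)"
  have x: "7/10 < x" "x < 1" and y: "7/10 < y" "y \<le> 1"
    using xcut_ge[OF mm(1)] xcut_ge[OF mm(2)] m sqrt_half_bounds by (auto simp: x_def y_def)
  have i: "0 < 1 / (2 * x)" "1 / (2 * x) < 1" "0 < 1 / (2 * y)" "1 / (2 * y) < 1" using x y by (auto simp: field_simps)
  note nd2 = nondegenerate_rotate[OF nd]
  have E: "endpoints (pair A B C m)
      = {A + x *\<^sub>R (B - A), A + (1 / (2 * x)) *\<^sub>R (C - A), B + (1 / (2 * y)) *\<^sub>R (C - B), B + y *\<^sub>R (A - B)}"
    using y unfolding pair_def chord_def x_def[symmetric] y_def[symmetric] endpoints_segments by simp
  have in_AB: "A + x *\<^sub>R (B - A) \<in> half_open_side A B C" "A + (1 / (2 * x)) *\<^sub>R (C - A) \<notin> half_open_side A B C"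
    "B + (1 / (2 * y)) *\<^sub>R (C - B) \<notin> half_open_side A B C" "B + y *\<^sub>R (A - B) \<in> half_open_side A B C"
    using x y i unfolding half_open_side_def mem_Collect_eq bary_sides[OF nd] bary_sides[OF nd2] by simp_all
  have in_BC: "A + x *\<^sub>R (B - A) \<notin> half_open_side B C A" "A + (1 / (2 * x)) *\<^sub>R (C - A) \<notin> half_open_side B C A"
    "B + (1 / (2 * y)) *\<^sub>R (C - B) \<in> half_open_side B C A" "B + y *\<^sub>R (A - B) \<notin> half_open_side B C A"
    using x y i unfolding half_open_side_def mem_Collect_eq bary_sides[OF nd] bary_sides[OF nd2] by simp_all
  have in_CA: "A + x *\<^sub>R (B - A) \<notin> half_open_side C A B" "A + (1 / (2 * x)) *\<^sub>R (C - A) \<in> half_open_side C A B"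
    "B + (1 / (2 * y)) *\<^sub>R (C - B) \<notin> half_open_side C A B" "B + y *\<^sub>R (A - B) \<notin> half_open_side C A B"
    using x y i unfolding half_open_side_def mem_Collect_eq bary_sides[OF nd] bary_sides[OF nd2] by simp_all
  show "endpoints (pair A B C m) \<inter> half_open_side A B C = {A + xcut m *\<^sub>R (B - A), B + xcut (- m) *\<^sub>R (A - B)}"
    unfolding E x_def[symmetric] y_def[symmetric] using in_AB by blast
  show "\<exists>z. endpoints (pair A B C m) \<inter> half_open_side B C A = {z}"
    unfolding E using in_BC by blast
  show "\<exists>z. endpoints (pair A B C m) \<inter> half_open_side C A B = {z}"
    unfolding E using in_CA by blast
qed

lemma pair_endpoints_ordered:
  assumes nd: "nondegenerate A B C" and m: "m \<in> {-mmax..mmax}"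
  shows "bary B C A (A + xcut m *\<^sub>R (B - A)) = xcut m" "bary B C A (B + xcut (- m) *\<^sub>R (A - B)) = 1 - xcut (- m)"
    "xcut m > 1/2" "1 - xcut (- m) < 1/2"
proof -
  have mm: "- m \<in> {-mmax..mmax}" using m by auto
  show "bary B C A (A + xcut m *\<^sub>R (B - A)) = xcut m" by (rule bary_sides(1)[OF nd])
  show "bary B C A (B + xcut (- m) *\<^sub>R (A - B)) = 1 - xcut (- m)" by (rule bary_sides(6)[OF nondegenerate_rotate[OF nd]])
  show "xcut m > 1/2" "1 - xcut (- m) < 1/2" using xcut_ge(1)[OF m] xcut_ge(1)[OF mm] sqrt_half_bounds by auto
qed

lemma pair_inj:
  assumes nd: "nondegenerate A B C"
  shows "inj_on (pair A B C) {-mmax..<mmax}"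
proof (rule inj_onI)
  fix m n assume m: "m \<in> {-mmax..<mmax}" and n: "n \<in> {-mmax..<mmax}" and eq: "pair A B C m = pair A B C n"
  have m': "m \<in> {-mmax..mmax}" and n': "n \<in> {-mmax..mmax}" using m n by auto
  let ?a = "\<lambda>m. A + xcut m *\<^sub>R (B - A)" and ?d = "\<lambda>m. B + xcut (- m) *\<^sub>R (A - B)"
  have "{?a m, ?d m} = {?a n, ?d n}"
    using endpoints_on_sides(1)[OF nd m] endpoints_on_sides(1)[OF nd n] eq by metis
  then have "?a m = ?a n \<or> ?a m = ?d n" by (auto simp: doubleton_eq_iff)
  then have "xcut m = xcut n \<or> xcut m = 1 - xcut (- n)"
    using pair_endpoints_ordered[OF nd m'] pair_endpoints_ordered[OF nd n'] by metis
  then have "xcut m = xcut n" using pair_endpoints_ordered[OF nd m'] pair_endpoints_ordered[OF nd n'] by auto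
  then show "m = n" using xcut_inj m' n' by blast
qed

text \<open>The half-open side BC contains one endpoint of the first pair, but two of the second one.\<close>

lemma pair_rotate_neq:
  assumes nd: "nondegenerate A B C" and m: "m \<in> {-mmax..<mmax}" and n: "n \<in> {-mmax..<mmax}"
  shows "pair A B C m \<noteq> pair B C A n"
proof
  assume eq: "pair A B C m = pair B C A n"
  note nd2 = nondegenerate_rotate[OF nd]
  obtain z where z: "endpoints (pair A B C m) \<inter> half_open_side B C A = {z}"
    using endpoints_on_sides(2)[OF nd m] by blast
  have "{B + xcut n *\<^sub>R (C - B), C + xcut (- n) *\<^sub>R (B - C)} = {z}"
    using endpoints_on_sides(1)[OF nd2 n] z eq by simp
  then have "B + xcut n *\<^sub>R (C - B) = C + xcut (- n) *\<^sub>R (B - C)" by (metis doubleton_eq_iff insert_absorb2 singleton_insert_inj_eq')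
  moreover have "n \<in> {-mmax..mmax}" using n by auto
  ultimately show False using pair_endpoints_ordered[OF nd2] by (metis less_asym)
qed

text \<open>Here the chord at the corner A is the median from B, which is also a chord at the corner C. So the pair belongs
  both to AB and to BC.\<close>

lemma pair_mmax: "pair A B C mmax = pair B C A (- mmax)"
proof -
  have s: "1 / (2 * (sqrt 2 / 2)) = sqrt 2 / 2" by (simp add: real_div_sqrt field_simps)
  have "chord A B C 1 = chord C A B (1 / (2 * 1))"
  proof -
    have "A + (1 / 2) *\<^sub>R (C - A) = C + (1 / 2) *\<^sub>R (A - C)"
      by (rule prod_eqI) (simp_all add: field_simps)
    then show ?thesis by (simp add: chord_def closed_segment_commute)
  qed
  then show ?thesis unfolding pair_def minus_minus xcut_mmax s by (simp add: insert_commute)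
qed

text \<open>The half-open parameter interval counts the pairs that belong to two sides only once.\<close>

lemma quadrisections_eq:
  assumes nd: "nondegenerate A B C"
  shows "{Q. is_quadrisection (convex hull {A, B, C}) Q} =
    (\<Union>(U, V, W) \<in> rotations A B C. pair U V W ` {m \<in> {-mmax..<mmax}. orthogonal_pair (pair U V W m)})"
proof
  let ?T = "convex hull {A, B, C}"
  have rot_nd: "nondegenerate U V W \<and> convex hull {U, V, W} = ?T \<and> (V, W, U) \<in> rotations A B C"
    if "(U, V, W) \<in> rotations A B C" for U V W
    using that nd nondegenerate_rotate[OF nd] nondegenerate_rotate[OF nondegenerate_rotate[OF nd]]
    by (auto simp: rotations_def insert_commute)
  show "{Q. is_quadrisection ?T Q} \<subseteq> (\<Union>(U, V, W) \<in> rotations A B C. pair U V W ` {m \<in> {-mmax..<mmax}. orthogonal_pair (pair U V W m)})"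
  proof
    fix Q assume "Q \<in> {Q. is_quadrisection ?T Q}"
    then obtain a b c d where Q: "Q = {closed_segment a b, closed_segment c d}" "(b - a) \<bullet> (d - c) = 0"
      "quarters ?T (closed_segment a b) (closed_segment c d)"
      unfolding is_quadrisection_iff by blast
    have o: "orthogonal_pair Q" using Q(1,2) unfolding orthogonal_pair_def by blast
    obtain p where p: "p \<in> rotations A B C" "case p of (U, V, W) \<Rightarrow> \<exists>x y. quarter_relation x y \<and>
        {closed_segment a b, closed_segment c d} = {chord U V W x, chord V W U (1 / (2 * y))}"
      using quarters_classification[OF nd Q(3)] by blast
    obtain U V W where pUVW: "p = (U, V, W)" by (cases p)
    have UVW: "(U, V, W) \<in> rotations A B C" using p(1) pUVW by simp
    obtain x y where xy: "quarter_relation x y"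
      "{closed_segment a b, closed_segment c d} = {chord U V W x, chord V W U (1 / (2 * y))}"
      using p(2) unfolding pUVW prod.case by blast
    obtain m where m: "m \<in> {-mmax..mmax}" "x = xcut m" "y = xcut (- m)" using quarter_relation_imp_xcut[OF xy(1)] by blast
    have Qm: "Q = pair U V W m" using Q(1) xy(2) m by (simp add: pair_def)
    show "Q \<in> (\<Union>(U, V, W) \<in> rotations A B C. pair U V W ` {m \<in> {-mmax..<mmax}. orthogonal_pair (pair U V W m)})"
    \<comment> \<open>the right end of the interval is moved to the next side\<close>
    proof (cases "m = mmax")
      case False
      then have "m \<in> {-mmax..<mmax}" using m by auto
      then show ?thesis using UVW o Qm by blast
    next
      case True
      then have "Q = pair V W U (- mmax)" using Qm pair_mmax by simp
      moreover have "- mmax \<in> {-mmax..<mmax}" using mmax_pos by simp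
      ultimately show ?thesis using rot_nd[OF UVW] o by blast
    qed
  qed
  show "(\<Union>(U, V, W) \<in> rotations A B C. pair U V W ` {m \<in> {-mmax..<mmax}. orthogonal_pair (pair U V W m)}) \<subseteq> {Q. is_quadrisection ?T Q}"
  proof clarify
    fix U V W m assume UVW: "(U, V, W) \<in> rotations A B C" and m: "m \<in> {-mmax..<mmax}" and o: "orthogonal_pair (pair U V W m)"
    have m': "m \<in> {-mmax..mmax}" and m'': "- m \<in> {-mmax..mmax}" using m by auto
    have nd': "nondegenerate U V W" and hull: "convex hull {U, V, W} = ?T" using rot_nd[OF UVW] by auto
    have q: "quarters ?T (chord U V W (xcut m)) (chord V W U (1 / (2 * xcut (- m))))"
      using relation_imp_quarters[OF nd' quarter_relation_xcut[OF m'] xcut_ge(3)[OF m'] xcut_ge(3)[OF m'']] unfolding hull .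
    show "is_quadrisection ?T (pair U V W m)"
      using o q unfolding is_quadrisection_iff pair_def chord_def orthogonal_pair_segments by blast
  qed
qed

definition zeros :: "real \<Rightarrow> real \<Rightarrow> real set" where
  "zeros h N = {m \<in> {-mmax..<mmax}. gap h N m = 0}"

lemma Quads_eq_zero_count:
  assumes nd: "nondegenerate A B C"
    and s: "shape A B C h1 N1" "shape B C A h2 N2" "shape C A B h3 N3"
    and fin: "finite (zeros h1 N1)" "finite (zeros h2 N2)" "finite (zeros h3 N3)"
  shows "Quads (convex hull {A, B, C}) = card (zeros h1 N1) + card (zeros h2 N2) + card (zeros h3 N3)"
proof -
  note nd2 = nondegenerate_rotate[OF nd]
  note nd3 = nondegenerate_rotate[OF nd2]
  have z: "{m \<in> {-mmax..<mmax}. orthogonal_pair (pair U V W m)} = zeros h N" if "shape U V W h N" for U V W h N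
    using orthogonal_pair_iff_gap[OF _ that] by (auto simp: zeros_def)
  define X Y Z where "X = pair A B C ` zeros h1 N1" and "Y = pair B C A ` zeros h2 N2" and "Z = pair C A B ` zeros h3 N3"
  have eq: "{Q. is_quadrisection (convex hull {A, B, C}) Q} = X \<union> (Y \<union> Z)"
    unfolding quadrisections_eq[OF nd] rotations_def X_def Y_def Z_def
    by (simp only: UN_insert UN_empty prod.case z[OF s(1)] z[OF s(2)] z[OF s(3)] Un_empty_right)
  have card: "card (pair U V W ` zeros h N) = card (zeros h N)" if "nondegenerate U V W" for U V W h N
    by (rule card_image, rule inj_on_subset[OF pair_inj[OF that]]) (auto simp: zeros_def)
  have disj: "pair U V W ` zeros h N \<inter> pair V W U ` zeros h' N' = {}" if "nondegenerate U V W" for U V W h N h' N'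
    using pair_rotate_neq[OF that] by (auto simp: zeros_def)
  have "X \<inter> Y = {}" "Y \<inter> Z = {}" "Z \<inter> X = {}"
    unfolding X_def Y_def Z_def by (rule disj[OF nd] disj[OF nd2] disj[OF nd3])+
  then have "X \<inter> (Y \<union> Z) = {}" "Y \<inter> Z = {}" by blast+
  moreover have "finite X" "finite Y" "finite Z" using fin by (simp_all add: X_def Y_def Z_def)
  ultimately have "card (X \<union> (Y \<union> Z)) = card X + (card Y + card Z)" by (simp add: card_Un_disjoint)
  then show ?thesis
    unfolding Quads_def eq by (simp add: X_def Y_def Z_def card[OF nd] card[OF nd2] card[OF nd3])
qed

section \<open>Monotonicity and zeros of the power function\<close>

text \<open>If the power of (h,t) is regarded as a function of m, its critical point is the solution of
  \<open>crit m = 2 * h - 1\<close>.\<close>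

definition crit :: "real \<Rightarrow> real" where "crit m = 2 * shift m - 2 * radius m * slope m"

definition crit_factor :: "real \<Rightarrow> real" where "crit_factor e = 1 + e - 8 * e ^ 3 / (6 * e\<^sup>2 - 1)"

lemma crit_eq: "crit m = 2 * (m * excess m) * crit_factor (excess m)"
  by (simp add: crit_def crit_factor_def shift_def radius_def slope_def algebra_simps power2_eq_square power3_eq_cube)

text \<open>The function e^3 / (6 e^2 - 1) is decreasing as long as e^2 <= 1/2, because its difference quotient has the sign
  of 6 e^2 f^2 - (e^2 + ef + f^2), and 6 e^2 f^2 <= 3 ef <= e^2 + ef + f^2.\<close>

lemma crit_factor_mono:
  assumes "2/3 \<le> e" "e \<le> f" "f\<^sup>2 \<le> 1/2"
  shows "crit_factor e \<le> crit_factor f" "0 < crit_factor e"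
proof -
  have ef: "0 < e" "0 < f" using assms by auto
  have De: "6 * e\<^sup>2 - 1 > 0" using power_mono[of "2/3" e 2] assms by (simp add: power2_eq_square)
  have Df: "6 * f\<^sup>2 - 1 > 0" using power_mono[of "2/3" f 2] assms by (simp add: power2_eq_square)
  have mono: "8 * f ^ 3 / (6 * f\<^sup>2 - 1) \<le> 8 * e ^ 3 / (6 * e\<^sup>2 - 1)" if "e \<le> f" "f\<^sup>2 \<le> 1/2" "0 < e" "6 * e\<^sup>2 - 1 > 0" "6 * f\<^sup>2 - 1 > 0" for e f :: real
  proof -
    have "e * f \<le> f * f" using that by (intro mult_right_mono) auto
    then have "e * f \<le> 1/2" using that(2) unfolding power2_eq_square by linarith
    then have "(e * f) * (e * f) \<le> (1/2) * (e * f)" using that by (intro mult_right_mono) auto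
    moreover have "0 \<le> (f - e)\<^sup>2" by simp
    then have "3 * (e * f) \<le> f * f + e * f + e * e" by (simp add: power2_eq_square algebra_simps)
    ultimately have "0 \<le> f * f + e * f + e * e - 6 * (e * f) * (e * f)" by linarith
    then have "0 \<le> (f - e) * (f * f + e * f + e * e - 6 * (e * f) * (e * f))" using that by simp
    also have "\<dots> = e ^ 3 * (6 * f\<^sup>2 - 1) - f ^ 3 * (6 * e\<^sup>2 - 1)" by algebra
    finally have "8 * f ^ 3 * (6 * e\<^sup>2 - 1) \<le> 8 * e ^ 3 * (6 * f\<^sup>2 - 1)" by simp
    then show ?thesis using that by (simp add: divide_le_eq le_divide_eq mult.commute mult.left_commute)
  qed
  show "crit_factor e \<le> crit_factor f" using mono[of e f] assms ef De Df by (simp add: crit_factor_def)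
  have "e\<^sup>2 \<le> f\<^sup>2" using assms ef by (intro power_mono) auto
  then have "e\<^sup>2 \<le> 1/2" using assms(3) by linarith
  then have "8 * e ^ 3 / (6 * e\<^sup>2 - 1) \<le> 8 * (2/3) ^ 3 / (6 * (2/3)\<^sup>2 - 1)"
    using mono[of "2/3" e] assms De by (simp add: power2_eq_square)
  also have "\<dots> < 1 + e" using assms by (simp add: power2_eq_square power3_eq_cube)
  finally show "0 < crit_factor e" by (simp add: crit_factor_def)
qed

lemma crit_minus: "crit (- m) = - crit m"
  by (simp add: crit_eq)

text \<open>For nonnegative arguments this is a product of increasing factors; the function is odd.\<close>

lemma crit_strict_mono:
  assumes "m \<in> {-mmax..mmax}" "n \<in> {-mmax..mmax}" "m < n"
  shows "crit m < crit n"
proof -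
  have pos: "crit m < crit n" if mn: "0 \<le> m" "m < n" "m \<in> {-mmax..mmax}" "n \<in> {-mmax..mmax}" for m n
  proof -
    have "m\<^sup>2 \<le> n\<^sup>2" using mn by (intro power_mono) auto
    moreover have "3 - n\<^sup>2 > 0" using excess_facts(5)[OF mn(4)] mmax_pos by simp
    ultimately have le: "excess m \<le> excess n" unfolding excess_def by (intro divide_left_mono mult_pos_pos) auto
    have b: "crit_factor (excess m) \<le> crit_factor (excess n)" "0 < crit_factor (excess m)"
      using crit_factor_mono[OF excess_facts(2)[OF mn(3)] le excess_facts(3)[OF mn(4)]] by auto
    have "m * excess m < n * excess n"
      using mn le excess_facts(2)[OF mn(3)] by (intro mult_less_le_imp_less) auto
    then have "(m * excess m) * crit_factor (excess m) < (n * excess n) * crit_factor (excess n)"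
      by (rule mult_less_le_imp_less) (use b mn excess_facts(2)[OF mn(3)] in auto)
    then show ?thesis by (simp add: crit_eq)
  qed
  consider "0 \<le> m" | "m < 0" "0 < n" | "n \<le> 0" by linarith
  then show ?thesis
  proof cases
    case 1 then show ?thesis using pos assms by blast
  next
    case 2
    have "crit 0 < crit n" using pos[of 0 n] 2 assms by auto
    moreover have "crit 0 < crit (- m)" using pos[of 0 "- m"] 2 assms by auto
    ultimately show ?thesis by (simp add: crit_minus crit_eq[of 0])
  next
    case 3
    have "crit (- n) < crit (- m)" using pos[of "- n" "- m"] 3 assms by auto
    then show ?thesis by (simp add: crit_minus)
  qed
qed

text \<open>The derivative of c is e (6 e^2 - 1) with e = \<open>excess m\<close>, and that of r is \<open>slope m\<close> times it. The
  positive factor is the derivative of c.\<close>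

lemma has_derivative_gap:
  assumes m: "m \<in> {-mmax..mmax}"
  shows "(gap h N has_real_derivative (excess m * (6 * (excess m)\<^sup>2 - 1) * (crit m - (2 * h - 1)))) (at m)"
proof -
  have D: "3 - m\<^sup>2 \<noteq> 0" using excess_facts(5)[OF m] mmax_pos by simp
  have "((\<lambda>m. 2 / (3 - m\<^sup>2)) has_real_derivative (4 * m / (3 - m\<^sup>2)\<^sup>2)) (at m)"
    using D by (auto intro!: derivative_eq_intros simp: power2_eq_square)
  also have "4 * m / (3 - m\<^sup>2)\<^sup>2 = m * (excess m)\<^sup>2" by (simp add: excess_def power_divide)
  finally have e: "(excess has_real_derivative m * (excess m)\<^sup>2) (at m)" by (simp add: excess_def[abs_def])
  have m2: "m\<^sup>2 * excess m = 3 * excess m - 2" by (rule excess_facts(4)[OF m])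
  define w' where "w' = excess m * (6 * (excess m)\<^sup>2 - 1)"
  have w: "(shift has_real_derivative w') (at m)"
  proof -
    have "(shift has_real_derivative ((1 * excess m + m * (excess m)\<^sup>2 * m) * (1 + excess m) + (0 + m * (excess m)\<^sup>2) * (m * excess m))) (at m)"
      unfolding shift_def[abs_def] by (intro DERIV_mult DERIV_add DERIV_const DERIV_ident e)
    also have "(1 * excess m + m * (excess m)\<^sup>2 * m) * (1 + excess m) + (0 + m * (excess m)\<^sup>2) * (m * excess m) = w'"
      using m2 unfolding w'_def by algebra
    finally show ?thesis .
  qed
  have r: "(radius has_real_derivative (4 * m * (excess m) ^ 3)) (at m)"
    unfolding radius_def[abs_def]
    by (rule derivative_eq_intros e refl)+ (simp add: power2_eq_square power3_eq_cube)
  have slope: "4 * m * (excess m) ^ 3 = slope m * w'"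
    using slope_denominator_pos[OF m] by (simp add: slope_def w'_def power2_eq_square power3_eq_cube)
  have "(gap h N has_real_derivative (0 - (0 + 2 * w') * h + 2 * (1/2 + shift m) * w' - 2 * radius m * (slope m * w'))) (at m)"
    unfolding gap_def[abs_def]
    by (rule derivative_eq_intros w r[unfolded slope] refl)+ simp
  also have "0 - (0 + 2 * w') * h + 2 * (1/2 + shift m) * w' - 2 * radius m * (slope m * w') = w' * (crit m - (2 * h - 1))"
    by (simp add: crit_def algebra_simps)
  finally show ?thesis unfolding w'_def .
qed

lemma gap_continuous: "S \<subseteq> {-mmax..mmax} \<Longrightarrow> continuous_on S (gap h N)"
  by (intro DERIV_atLeastAtMost_imp_continuous_on continuous_at_imp_continuous_on ballI DERIV_isCont[OF has_derivative_gap]) auto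

lemma gap_speed_pos: "m \<in> {-mmax..mmax} \<Longrightarrow> excess m * (6 * (excess m)\<^sup>2 - 1) > 0"
  using slope_denominator_pos[of m] excess_facts(2)[of m] by simp

lemma gap_increasing:
  assumes "-mmax \<le> a" "a < b" "b \<le> mmax" "2 * h - 1 \<le> crit a"
  shows "gap h N a < gap h N b"
proof (rule DERIV_pos_imp_increasing_open[OF assms(2)])
  fix x assume x: "a < x" "x < b"
  have I: "x \<in> {-mmax..mmax}" "a \<in> {-mmax..mmax}" using x assms by auto
  have "crit x - (2 * h - 1) > 0" using crit_strict_mono[OF I(2,1) x(1)] assms by simp
  then show "\<exists>y. (gap h N has_real_derivative y) (at x) \<and> 0 < y"
    using has_derivative_gap[OF I(1), of h N] gap_speed_pos[OF I(1)] by (metis mult_pos_pos)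
qed (use assms in \<open>auto intro: gap_continuous\<close>)

lemma gap_decreasing:
  assumes "-mmax \<le> a" "a < b" "b \<le> mmax" "crit b \<le> 2 * h - 1"
  shows "gap h N b < gap h N a"
proof (rule DERIV_neg_imp_decreasing_open[OF assms(2)])
  fix x assume x: "a < x" "x < b"
  have I: "x \<in> {-mmax..mmax}" "b \<in> {-mmax..mmax}" using x assms by auto
  have "crit x - (2 * h - 1) < 0" using crit_strict_mono[OF I(1,2) x(2)] assms by simp
  then show "\<exists>y. (gap h N has_real_derivative y) (at x) \<and> y < 0"
    using has_derivative_gap[OF I(1), of h N] gap_speed_pos[OF I(1)] by (metis mult_pos_neg)
qed (use assms in \<open>auto intro: gap_continuous\<close>)

text \<open>The qualitative consequence of the monotonicity that bounds the number of zeros from above.\<close>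

lemma gap_quasiconvex:
  assumes "-mmax \<le> a" "a < b" "b < c" "c \<le> mmax"
  shows "gap h N b < gap h N a \<or> gap h N b < gap h N c"
  using gap_increasing[of b c h N] gap_decreasing[of a b h N] assms by linarith

lemma gap_IVT:
  assumes "-mmax \<le> a" "a < b" "b \<le> mmax" "gap h N a \<le> 0 \<and> 0 \<le> gap h N b \<or> gap h N b \<le> 0 \<and> 0 \<le> gap h N a"
  shows "\<exists>x. a \<le> x \<and> x \<le> b \<and> gap h N x = 0"
proof -
  have "continuous_on {a..b} (gap h N)" using assms by (intro gap_continuous) auto
  then show ?thesis using IVT'[of "gap h N" a 0 b] IVT2'[of "gap h N" b 0 a] assms by auto
qed

lemma at_most_two_zeros:
  assumes "m < n" "gap h N m = 0" "gap h N n = 0" "m \<in> {-mmax..mmax}" "n \<in> {-mmax..mmax}"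
  shows "{x \<in> {-mmax..mmax}. gap h N x = 0} = {m, n}"
proof -
  have "x = m \<or> x = n" if x: "x \<in> {-mmax..mmax}" "gap h N x = 0" for x
  proof (rule ccontr)
    assume "\<not> (x = m \<or> x = n)"
    then consider "x < m" | "m < x" "x < n" | "n < x" by linarith
    then show False
      by cases (use gap_quasiconvex[of x m n h N] gap_quasiconvex[of m x n h N] gap_quasiconvex[of m n x h N] assms x in auto)
  qed
  then show ?thesis using assms by auto
qed

lemma finite_all_zeros: "finite {x \<in> {-mmax..mmax}. gap h N x = 0}"
proof (cases "\<exists>m n. m < n \<and> gap h N m = 0 \<and> gap h N n = 0 \<and> m \<in> {-mmax..mmax} \<and> n \<in> {-mmax..mmax}")
  case True
  then obtain m n where "m < n" "gap h N m = 0" "gap h N n = 0" "m \<in> {-mmax..mmax}" "n \<in> {-mmax..mmax}" by blast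
  from at_most_two_zeros[OF this] show ?thesis by simp
next
  case False
  then have "x = y" if "x \<in> {x \<in> {-mmax..mmax}. gap h N x = 0}" "y \<in> {x \<in> {-mmax..mmax}. gap h N x = 0}" for x y
    using that by (metis (mono_tags, lifting) linorder_neqE_linordered_idom mem_Collect_eq)
  then show ?thesis by (metis (no_types, lifting) finite.simps finite_subset subsetI singletonI emptyE insertI1 finite_insert)
qed

lemma finite_zeros: "finite (zeros h N)"
  by (rule finite_subset[OF _ finite_all_zeros[of h N]]) (auto simp: zeros_def)

lemma critical_zero_unique:
  assumes "m \<in> {-mmax..mmax}" "gap h N m = 0" "crit m = 2 * h - 1"
  shows "{x \<in> {-mmax..mmax}. gap h N x = 0} = {m}"
proof -
  have "gap h N x \<noteq> 0" if "x \<in> {-mmax..mmax}" "x \<noteq> m" for x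
  proof (cases "x < m")
    case True then show ?thesis using gap_decreasing[of x m h N] assms that by auto
  next
    case False then show ?thesis using gap_increasing[of m x h N] assms that by auto
  qed
  then show ?thesis using assms by auto
qed

text \<open>Just before m the power is negative, while at the left end it is nonnegative.\<close>

lemma zero_before_increasing_zero:
  assumes m: "m \<in> {-mmax..mmax}" "gap h N m = 0" "2 * h - 1 < crit m" and h: "h \<ge> 1/2" and e: "gap h N (- mmax) \<ge> 0"
  shows "\<exists>n. -mmax \<le> n \<and> n < m \<and> gap h N n = 0"
proof -
  have m0: "0 < m"
  proof (rule ccontr)
    assume "\<not> 0 < m"
    then have "crit m \<le> crit 0" using crit_strict_mono[of m 0] m mmax_pos by (cases "m = 0") auto
    then show False using m h by (simp add: crit_eq[of 0])
  qed
  have "eventually (\<lambda>b. gap h N b < 0) (at_left m)"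
  proof -
    have "excess m * (6 * (excess m)\<^sup>2 - 1) * (crit m - (2 * h - 1)) > 0" using gap_speed_pos[OF m(1)] m by simp
    from DERIV_pos_inc_left[OF has_derivative_gap[OF m(1)] this]
    obtain d where "d > 0" and d: "\<And>k. 0 < k \<Longrightarrow> k < d \<Longrightarrow> gap h N (m - k) < gap h N m" by blast
    have "gap h N b < 0" if "m - d < b" "b < m" for b using d[of "m - b"] that m(2) by simp
    then show ?thesis using \<open>d > 0\<close> by (auto simp: eventually_at_left_field intro!: exI[of _ "m - d"])
  qed
  moreover have "eventually (\<lambda>b. b \<in> {-mmax<..<m}) (at_left m)"
    using m0 mmax_pos by (intro eventually_at_leftI[of "- mmax"]) auto
  ultimately have "eventually (\<lambda>b. gap h N b < 0 \<and> b \<in> {-mmax<..<m}) (at_left m)" by (rule eventually_conj)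
  then obtain b where b: "gap h N b < 0" "-mmax < b" "b < m"
    using eventually_happens'[of "at_left m"] by (auto simp: trivial_limit_at_left_real)
  then obtain n where "-mmax \<le> n" "n \<le> b" "gap h N n = 0"
    using gap_IVT[of "-mmax" b h N] e m by auto
  then show ?thesis using b by (intro exI[of _ n]) auto
qed

text \<open>Just after m the power is negative, while at the right end it is nonnegative.\<close>

lemma zero_after_decreasing_zero:
  assumes m: "m \<in> {-mmax..mmax}" "gap h N m = 0" "crit m < 2 * h - 1" "m < mmax" and e: "gap h N mmax \<ge> 0"
  shows "\<exists>n. m < n \<and> n \<le> mmax \<and> gap h N n = 0 \<and> crit n > 2 * h - 1"
proof -
  have "eventually (\<lambda>b. gap h N b < 0) (at_right m)"
  proof -
    have "excess m * (6 * (excess m)\<^sup>2 - 1) * (crit m - (2 * h - 1)) < 0"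
      using gap_speed_pos[OF m(1)] m by (intro mult_pos_neg) auto
    from DERIV_neg_dec_right[OF has_derivative_gap[OF m(1)] this]
    obtain d where "d > 0" and d: "\<And>k. 0 < k \<Longrightarrow> k < d \<Longrightarrow> gap h N (m + k) < gap h N m" by blast
    have "gap h N b < 0" if "m < b" "b < m + d" for b using d[of "b - m"] that m(2) by simp
    then show ?thesis using \<open>d > 0\<close> by (auto simp: eventually_at_right_field intro!: exI[of _ "m + d"])
  qed
  moreover have "eventually (\<lambda>b. b \<in> {m<..<mmax}) (at_right m)"
    using m(4) by (intro eventually_at_rightI[of _ mmax]) auto
  ultimately have "eventually (\<lambda>b. gap h N b < 0 \<and> b \<in> {m<..<mmax}) (at_right m)" by (rule eventually_conj)
  then obtain b where b: "gap h N b < 0" "m < b" "b < mmax"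
    using eventually_happens'[of "at_right m"] by (auto simp: trivial_limit_at_right_real)
  then obtain n where n: "b \<le> n" "n \<le> mmax" "gap h N n = 0"
    using gap_IVT[of b mmax h N] e m by auto
  have "crit n > 2 * h - 1"
  proof (rule ccontr)
    assume "\<not> crit n > 2 * h - 1"
    then show False using gap_decreasing[of m n h N] b n m by auto
  qed
  then show ?thesis using b n by (intro exI[of _ n]) auto
qed

lemma crit_nonneg_imp_nonneg:
  assumes "m \<in> {-mmax..mmax}" "crit m \<ge> 0" shows "m \<ge> 0"
proof (rule ccontr)
  assume "\<not> m \<ge> 0"
  then have "crit m < crit 0" using crit_strict_mono[of m 0] assms mmax_pos by auto
  then show False using assms by (simp add: crit_eq[of 0])
qed

lemma shift_radius_mmax: "shift mmax = 1/2" "radius mmax = 1"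
proof -
  have I: "mmax \<in> {-mmax..mmax}" using mmax_pos by auto
  have "2 * (sqrt 2 / 2)\<^sup>2 = 1" by (simp add: power_divide)
  then show "shift mmax = 1/2" "radius mmax = 1" using xcut_squares[OF I] by (simp_all add: power_divide)
qed

lemma gap_ends: "gap h N mmax = N - 2 * h" "gap h N (- mmax) = N - 1"
  by (simp_all add: gap_def shift_radius_mmax)

section \<open>The sets D2 and J0 in terms of zeros\<close>

text \<open>These bounds say that the arguments of the arc cosines in \<^const>\<open>thetaf\<close> and \<^const>\<open>D2\<close> lie between -1 and 1.\<close>

lemma shift_le_radius:
  assumes m: "m \<in> {-mmax..mmax}"
  shows "\<bar>shift m\<bar> \<le> radius m" "\<bar>slope m\<bar> \<le> 1" "0 < radius m"
proof -
  have e: "2/3 \<le> excess m" "(excess m)\<^sup>2 \<le> 1/2" using excess_facts[OF m] by auto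
  have e1: "excess m < 1"
  proof (rule ccontr)
    assume "\<not> excess m < 1"
    then have "1 \<le> (excess m)\<^sup>2" by (simp add: one_le_power)
    then show False using e by simp
  qed
  have mm: "\<bar>m\<bar> \<le> 1/2" using m mmax_pos by auto
  have "\<bar>m\<bar> * (1 + excess m) \<le> 1/2 * 2" using mm e e1 by (intro mult_mono) auto
  also have "\<dots> \<le> 2 * excess m" using e by simp
  finally have "(\<bar>m\<bar> * (1 + excess m)) * excess m \<le> 2 * excess m * excess m" using e by (intro mult_right_mono) auto
  then show "\<bar>shift m\<bar> \<le> radius m"
    using e by (simp add: shift_def radius_def abs_mult power2_eq_square mult_ac)
  have D: "6 * (excess m)\<^sup>2 - 1 > 0" using slope_denominator_pos[OF m] .
  have "(2/3)\<^sup>2 \<le> (excess m)\<^sup>2" using e by (intro power_mono) auto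
  then have "1 \<le> 4 * (excess m)\<^sup>2" by (simp add: power2_eq_square)
  moreover have "\<bar>m\<bar> * (excess m)\<^sup>2 \<le> 1/2 * (excess m)\<^sup>2" using mm by (intro mult_right_mono) auto
  ultimately have "4 * \<bar>m\<bar> * (excess m)\<^sup>2 \<le> 6 * (excess m)\<^sup>2 - 1" by linarith
  then show "\<bar>slope m\<bar> \<le> 1" using D by (simp add: slope_def abs_mult)
  show "0 < radius m" using e by (simp add: radius_def)
qed

lemma thetaf_xcut: "m \<in> {-mmax..mmax} \<Longrightarrow> thetaf (xcut m) = arccos (- shift m / radius m)"
  by (simp add: thetaf_def cf_xcut rf_xcut)

lemma slope_xcut: "m \<in> {-mmax..mmax} \<Longrightarrow> - deriv rf (xcut m) / deriv cf (xcut m) = - slope m"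
  using deriv_cf_rf[of m] by simp

lemma F_xcut: "m \<in> {-mmax..mmax} \<Longrightarrow> F (xcut m, \<theta>) = (1/2 + shift m + radius m * cos \<theta>, radius m * sin \<theta>)"
  by (simp add: F_def cf_xcut rf_xcut)

lemma F_imp_gap_zero:
  assumes m: "m \<in> {-mmax..mmax}" and F: "F (xcut m, \<theta>) = (h, t)"
  shows "gap h (h\<^sup>2 + t\<^sup>2) m = 0" "crit m - (2 * h - 1) = - 2 * radius m * (slope m + cos \<theta>)"
proof -
  have h: "h = 1/2 + shift m + radius m * cos \<theta>" and t: "t = radius m * sin \<theta>" using F F_xcut[OF m] by auto
  have "(1/2 + w + r * c)\<^sup>2 + (r * s)\<^sup>2 - (1 + 2 * w) * (1/2 + w + r * c) + (1/2 + w)\<^sup>2 - r\<^sup>2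
      = r\<^sup>2 * (c\<^sup>2 + s\<^sup>2) - r\<^sup>2" for w r c s :: real
    by (simp add: power2_eq_square algebra_simps)
  then have "gap h (h\<^sup>2 + t\<^sup>2) m = (radius m)\<^sup>2 * ((cos \<theta>)\<^sup>2 + (sin \<theta>)\<^sup>2) - (radius m)\<^sup>2"
    unfolding gap_def h t .
  then show "gap h (h\<^sup>2 + t\<^sup>2) m = 0" by simp
  show "crit m - (2 * h - 1) = - 2 * radius m * (slope m + cos \<theta>)" unfolding crit_def h by (simp add: algebra_simps)
qed

text \<open>The polar angle of (h,t) about the centre of its circle; the condition h >= 1/2 is the upper bound on
  the angle in the definition of \<^const>\<open>D\<close>.\<close>

lemma gap_zero_imp_F:
  assumes m: "m \<in> {-mmax..mmax}" and h: "h \<ge> 1/2" and t: "t > 0" and g: "gap h (h\<^sup>2 + t\<^sup>2) m = 0"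
  defines "q \<equiv> (h - 1/2 - shift m) / radius m"
  shows "F (xcut m, arccos q) = (h, t)" "\<bar>q\<bar> \<le> 1" "arccos q \<in> {0..thetaf (xcut m)}" "radius m * q = h - 1/2 - shift m"
proof -
  have r: "0 < radius m" using shift_le_radius[OF m] by simp
  show rq: "radius m * q = h - 1/2 - shift m" using r by (simp add: q_def)
  have circ: "(radius m * q)\<^sup>2 + t\<^sup>2 = (radius m)\<^sup>2" using g unfolding rq gap_def by (simp add: power2_eq_square algebra_simps)
  then have "(radius m)\<^sup>2 * q\<^sup>2 \<le> (radius m)\<^sup>2 * 1" using zero_le_power2[of t] unfolding power_mult_distrib by linarith
  then have "q\<^sup>2 \<le> 1" using r by (simp add: mult_le_cancel_left)
  then show q1: "\<bar>q\<bar> \<le> 1" by (simp add: abs_square_le_1)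
  then have q: "-1 \<le> q" "q \<le> 1" by auto
  have "(t / radius m)\<^sup>2 = 1 - q\<^sup>2" using circ r by (simp add: power_divide power_mult_distrib field_simps)
  then have "sqrt (1 - q\<^sup>2) = t / radius m" using t r by (intro real_sqrt_unique) auto
  then have "sin (arccos q) = t / radius m" using q by (simp add: sin_arccos)
  then show "F (xcut m, arccos q) = (h, t)" using F_xcut[OF m] q rq r by (simp add: cos_arccos)
  have "- shift m / radius m \<le> q" unfolding q_def using h r by (intro divide_right_mono) auto
  moreover have "-1 \<le> - shift m / radius m" using shift_le_radius[OF m] by (simp add: field_simps abs_le_iff)
  ultimately show "arccos q \<in> {0..thetaf (xcut m)}"
    using q unfolding thetaf_xcut[OF m] by (auto intro: arccos_le_arccos arccos_lbound)
qed

text \<open>The lower bound on x in \<^const>\<open>D2\<close> means m >= 0. On the right-hand side it is implied, because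
  2h - 1 is nonnegative and \<open>crit\<close> is odd and increasing.\<close>

lemma mem_F_D2_iff:
  assumes h: "h \<ge> 1/2" and t: "t > 0"
  shows "(h, t) \<in> F ` D2 \<longleftrightarrow> (\<exists>m\<in>{-mmax..mmax}. gap h (h\<^sup>2 + t\<^sup>2) m = 0 \<and> 2 * h - 1 \<le> crit m)"
proof
  assume "(h, t) \<in> F ` D2"
  then obtain x \<theta> where x: "x \<in> {5/6..1}" and \<theta>: "arccos (- deriv rf x / deriv cf x) \<le> \<theta>" "\<theta> \<le> thetaf x"
    and F: "F (x, \<theta>) = (h, t)"
    by (auto simp: D2_def)
  have "x \<in> {sqrt 2 / 2..1}"
  proof -
    have "sqrt 2 \<le> 5/3" by (rule real_le_lsqrt) (auto simp: power2_eq_square)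
    then show ?thesis using x by auto
  qed
  then obtain m where m: "m \<in> {-mmax..mmax}" "x = xcut m" by (rule xcut_onto)
  have slope: "-1 \<le> - slope m" "- slope m \<le> 1" using shift_le_radius(2)[OF m(1)] by auto
  have lo: "arccos (- slope m) \<le> \<theta>" using \<theta>(1) unfolding m(2) slope_xcut[OF m(1)] .
  have "\<theta> \<le> pi"
  proof -
    have "-1 \<le> - shift m / radius m" "- shift m / radius m \<le> 1" using shift_le_radius[OF m(1)] by (auto simp: field_simps abs_le_iff)
    then have "thetaf x \<le> pi" unfolding m(2) thetaf_xcut[OF m(1)] by (rule arccos_ubound)
    then show ?thesis using \<theta> by simp
  qed
  then have "cos \<theta> \<le> cos (arccos (- slope m))"
    using lo slope by (intro cos_monotone_0_pi_le) (auto intro: arccos_lbound)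
  then have "cos \<theta> \<le> - slope m" using slope by (simp add: cos_arccos)
  then have "radius m * (slope m + cos \<theta>) \<le> 0" using shift_le_radius(3)[OF m(1)] by (simp add: mult_le_0_iff)
  then have "2 * h - 1 \<le> crit m" using F_imp_gap_zero(2)[OF m(1) F[unfolded m(2)]] by simp
  then show "\<exists>m\<in>{-mmax..mmax}. gap h (h\<^sup>2 + t\<^sup>2) m = 0 \<and> 2 * h - 1 \<le> crit m"
    using F_imp_gap_zero(1)[OF m(1) F[unfolded m(2)]] m(1) by blast
next
  assume "\<exists>m\<in>{-mmax..mmax}. gap h (h\<^sup>2 + t\<^sup>2) m = 0 \<and> 2 * h - 1 \<le> crit m"
  then obtain m where m: "m \<in> {-mmax..mmax}" "gap h (h\<^sup>2 + t\<^sup>2) m = 0" "2 * h - 1 \<le> crit m" by blast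
  define q where "q = (h - 1/2 - shift m) / radius m"
  note P = gap_zero_imp_F[OF m(1) h t m(2), folded q_def]
  have "m \<ge> 0" using crit_nonneg_imp_nonneg[OF m(1)] m(3) h by simp
  then have x: "xcut m \<in> {5/6..1}" using xcut_ge_iff[OF m(1)] xcut_ge(2)[OF m(1)] by simp
  have r: "0 < radius m" using shift_le_radius(3)[OF m(1)] .
  have "radius m * q \<le> radius m * (- slope m)" using m(3) unfolding P(4) crit_def by simp
  then have "q \<le> - slope m" using r by (simp only: mult_le_cancel_left_pos)
  then have "arccos (- slope m) \<le> arccos q" using P(2) shift_le_radius(2)[OF m(1)] by (intro arccos_le_arccos) auto
  then have "arccos (- deriv rf (xcut m) / deriv cf (xcut m)) \<le> arccos q" unfolding slope_xcut[OF m(1)] .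
  then have "(xcut m, arccos q) \<in> D2"
    using x P(3) unfolding D2_def mem_Collect_eq prod.case atLeastAtMost_iff by blast
  then show "(h, t) \<in> F ` D2" using P(1) by (metis imageI)
qed

text \<open>The Jacobian determinant is c'(x) r(x) (cos \<theta> + r'(x)/c'(x)), and c'(x) r(x) is positive.\<close>

lemma mem_F_J0_iff:
  assumes h: "h \<ge> 1/2" and t: "t > 0"
  shows "(h, t) \<in> F ` J0 \<longleftrightarrow> (\<exists>m\<in>{-mmax..mmax}. gap h (h\<^sup>2 + t\<^sup>2) m = 0 \<and> crit m = 2 * h - 1)"
proof -
  have jac: "jacobian_F (xcut m, \<theta>) = 0 \<longleftrightarrow> slope m + cos \<theta> = 0" if m: "m \<in> {-mmax..mmax}" for m \<theta>
  proof -
    have "jacobian_F (xcut m, \<theta>) = deriv cf (xcut m) * radius m * (slope m + cos \<theta>)"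
      by (simp add: jacobian_F_def deriv_cf_rf(2)[OF m] rf_xcut[OF m] algebra_simps)
    then show ?thesis using deriv_cf_rf(1)[OF m] shift_le_radius(3)[OF m] by simp
  qed
  show ?thesis
  proof
    assume "(h, t) \<in> F ` J0"
    then obtain x \<theta> where x: "x \<in> {sqrt 2 / 2..1}" and J: "jacobian_F (x, \<theta>) = 0" and F: "F (x, \<theta>) = (h, t)"
      by (auto simp: J0_def D_def)
    obtain m where m: "m \<in> {-mmax..mmax}" "x = xcut m" using x by (rule xcut_onto)
    have "crit m = 2 * h - 1"
      using F_imp_gap_zero(2)[OF m(1) F[unfolded m(2)]] J jac[OF m(1)] m(2) by simp
    then show "\<exists>m\<in>{-mmax..mmax}. gap h (h\<^sup>2 + t\<^sup>2) m = 0 \<and> crit m = 2 * h - 1"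
      using F_imp_gap_zero(1)[OF m(1) F[unfolded m(2)]] m(1) by blast
  next
    assume "\<exists>m\<in>{-mmax..mmax}. gap h (h\<^sup>2 + t\<^sup>2) m = 0 \<and> crit m = 2 * h - 1"
    then obtain m where m: "m \<in> {-mmax..mmax}" "gap h (h\<^sup>2 + t\<^sup>2) m = 0" "crit m = 2 * h - 1" by blast
    define q where "q = (h - 1/2 - shift m) / radius m"
    note P = gap_zero_imp_F[OF m(1) h t m(2), folded q_def]
    have "radius m * (slope m + cos (arccos q)) = 0" using F_imp_gap_zero(2)[OF m(1) P(1)] m(3) by simp
    then have "jacobian_F (xcut m, arccos q) = 0" unfolding jac[OF m(1)] using shift_le_radius(3)[OF m(1)] by simp
    then have "(xcut m, arccos q) \<in> J0" using P(3) xcut_ge(1,2)[OF m(1)] by (simp add: J0_def D_def)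
    then show "(h, t) \<in> F ` J0" using P(1) by (metis imageI)
  qed
qed

lemma eq_I1_iff:
  assumes h: "h \<ge> 1/2" and t: "t > 0"
  shows "(h, t) = I1 \<longleftrightarrow> gap h (h\<^sup>2 + t\<^sup>2) mmax = 0 \<and> crit mmax = 2 * h - 1"
proof -
  have I: "mmax \<in> {-mmax..mmax}" using mmax_pos by auto
  have slope: "-1 \<le> - slope mmax" "- slope mmax \<le> 1" using shift_le_radius(2)[OF I] by auto
  have I1: "I1 = F (xcut mmax, arccos (- slope mmax))"
    unfolding I1_def pf_def using slope_xcut[OF I] by simp
  show ?thesis
  proof
    assume "(h, t) = I1"
    then have F: "F (xcut mmax, arccos (- slope mmax)) = (h, t)" using I1 by simp
    show "gap h (h\<^sup>2 + t\<^sup>2) mmax = 0 \<and> crit mmax = 2 * h - 1"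
      using F_imp_gap_zero[OF I F] slope by (simp add: cos_arccos)
  next
    assume g: "gap h (h\<^sup>2 + t\<^sup>2) mmax = 0 \<and> crit mmax = 2 * h - 1"
    define q where "q = (h - 1/2 - shift mmax) / radius mmax"
    note P = gap_zero_imp_F[OF I h t conjunct1[OF g], folded q_def]
    have "radius mmax * (slope mmax + cos (arccos q)) = 0" using F_imp_gap_zero(2)[OF I P(1)] g by simp
    moreover have "cos (arccos q) = q" using P(2) by (simp add: cos_arccos abs_le_iff)
    ultimately have "q = - slope mmax" using shift_le_radius(3)[OF I] by simp
    then show "(h, t) = I1" using P(1) I1 by simp
  qed
qed

section \<open>Counting the quadrisections\<close>

lemma shape_rotate:
  assumes "shape A B C h N" "N - 2 * h + 1 > 0"
  shows "shape B C A ((1 - h) / (N - 2 * h + 1)) (1 / (N - 2 * h + 1))"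
proof -
  obtain s where s: "s > 0" "(B - A) \<bullet> (B - A) = s" "(B - A) \<bullet> (C - A) = s * h" "(C - A) \<bullet> (C - A) = s * N"
    using assms(1) unfolding shape_def by blast
  define u v where "u = B - A" and "v = C - A"
  have d: "C - B = v - u" "A - B = - u" by (simp_all add: u_def v_def)
  have uv: "u \<bullet> u = s" "u \<bullet> v = s * h" "v \<bullet> u = s * h" "v \<bullet> v = s * N"
    using s by (simp_all add: u_def v_def inner_commute)
  define e where "e = N - 2 * h + 1"
  have e: "e > 0" using assms(2) by (simp add: e_def)
  have "(v - u) \<bullet> (v - u) = s * e" "(v - u) \<bullet> (- u) = s * (1 - h)" "(- u) \<bullet> (- u) = s"
    by (simp_all add: inner_diff_left inner_diff_right uv e_def algebra_simps)
  then have "(v - u) \<bullet> (v - u) = s * e" "(v - u) \<bullet> (- u) = s * e * ((1 - h) / e)" "(- u) \<bullet> (- u) = s * e * (1 / e)"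
    using e by simp_all
  moreover have "s * e > 0" using s(1) e by simp
  ultimately show ?thesis unfolding shape_def d e_def[symmetric] by blast
qed

text \<open>By Lagrange's identity the squared determinant is the Gram determinant.\<close>

lemma shape_nondegenerate:
  assumes "shape A B C h (h\<^sup>2 + t\<^sup>2)" "t \<noteq> 0"
  shows "nondegenerate A B C"
proof -
  obtain s where s: "s > 0" "(B - A) \<bullet> (B - A) = s" "(B - A) \<bullet> (C - A) = s * h" "(C - A) \<bullet> (C - A) = s * (h\<^sup>2 + t\<^sup>2)"
    using assms(1) unfolding shape_def by blast
  have lagrange: "(cross2 u v)\<^sup>2 = (u \<bullet> u) * (v \<bullet> v) - (u \<bullet> v)\<^sup>2" for u v
    by (cases u; cases v) (simp add: cross2_def power2_eq_square algebra_simps)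
  have "(cross2 (B - A) (C - A))\<^sup>2 = (s * t)\<^sup>2" unfolding lagrange s by (simp add: power2_eq_square algebra_simps)
  then show ?thesis using s(1) assms(2) unfolding nondegenerate_def by auto
qed

text \<open>A similarity of the plane is a multiple of a linear isometry up to translation; its inverse maps convex hulls
  to convex hulls and multiplies inner products by a constant.\<close>

lemma similar_imp_shape:
  assumes "similar T (convex hull {(0, 0), (1, 0), (h, t)})"
  obtains A B C where "T = convex hull {A, B, C}" "shape A B C h (h\<^sup>2 + t\<^sup>2)"
proof -
  obtain f k where k: "k > 0" and f: "\<And>x y. dist (f x) (f y) = k * dist x y"
    and fT: "f ` T = convex hull {(0, 0), (1, 0), (h, t)}"
    using assms unfolding similar_def by blast
  define g where "g x = (1 / k) *\<^sub>R (f x - f 0)" for x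
  have g: "orthogonal_transformation g"
    unfolding orthogonal_transformation_isometry
  proof (intro conjI allI)
    show "g 0 = 0" by (simp add: g_def)
    show "dist (g x) (g y) = dist x y" for x y
    proof -
      have "g x - g y = (1 / k) *\<^sub>R (f x - f y)" by (simp add: g_def algebra_simps)
      then show ?thesis using f[of x y] k by (simp add: dist_norm)
    qed
  qed
  obtain g' where g': "orthogonal_transformation g'" "\<And>x. g' (g x) = x"
    using orthogonal_transformation_inv[OF g] orthogonal_transformation_inj[OF g] by (metis inv_f_f)
  have lin: "linear g'" using g'(1) by (rule orthogonal_transformation_linear)
  define L where "L w = (1 / k) *\<^sub>R g' w" for w
  have linL: "linear L" unfolding L_def[abs_def] using lin by (rule linear_compose_scale_right)
  have inv: "- L (f 0) + L (f x) = x" for x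
  proof -
    have "L (f x) - L (f 0) = g' (g x)"
      unfolding L_def g_def using lin by (simp add: linear_diff linear_scale scaleR_diff_right)
    then show ?thesis using g'(2) by simp
  qed
  have "T = (\<lambda>x. - L (f 0) + x) ` L ` f ` T"
    using inv by (simp add: image_image)
  also have "\<dots> = (\<lambda>x. - L (f 0) + x) ` (convex hull {L (0, 0), L (1, 0), L (h, t)})"
    unfolding fT by (simp add: convex_hull_linear_image[OF linL])
  also have "\<dots> = convex hull {- L (f 0) + L (0, 0), - L (f 0) + L (1, 0), - L (f 0) + L (h, t)}"
    by (subst convex_hull_translation[symmetric]) simp
  finally have T: "T = convex hull {- L (f 0) + L (0, 0), - L (f 0) + L (1, 0), - L (f 0) + L (h, t)}" .
  have inner: "(L w - L z) \<bullet> (L w' - L z) = (1 / k)\<^sup>2 * ((w - z) \<bullet> (w' - z))" for w w' z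
  proof -
    have "(L w - L z) \<bullet> (L w' - L z) = L (w - z) \<bullet> L (w' - z)" using linL by (simp add: linear_diff)
    also have "\<dots> = (1 / k)\<^sup>2 * (g' (w - z) \<bullet> g' (w' - z))" by (simp add: L_def power2_eq_square)
    also have "g' (w - z) \<bullet> g' (w' - z) = (w - z) \<bullet> (w' - z)"
      using g'(1) unfolding orthogonal_transformation_def by blast
    finally show ?thesis .
  qed
  have "shape (- L (f 0) + L (0, 0)) (- L (f 0) + L (1, 0)) (- L (f 0) + L (h, t)) h (h\<^sup>2 + t\<^sup>2)"
    unfolding shape_def add_diff_cancel_left inner using k
    by (intro exI[of _ "(1 / k)\<^sup>2"]) (simp add: power2_eq_square)
  then show ?thesis using that T by blast
qed

text \<open>Reversing the orientation of the base replaces h by 1 - h and m by -m. In the cyclic order the shortest side runs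
  from B to C, whereas C' refers to the opposite orientation.\<close>

lemma zeros_reflect:
  "card (zeros (1 - h) (N - 2 * h + 1)) = card {m \<in> {-mmax<..mmax}. gap h N m = 0}"
proof -
  have "gap (1 - h) (N - 2 * h + 1) m = gap h N (- m)" for m
    by (simp add: gap_def power2_eq_square algebra_simps)
  then have "{m \<in> {-mmax<..mmax}. gap h N m = 0} = uminus ` zeros (1 - h) (N - 2 * h + 1)"
    unfolding zeros_def by (auto simp: image_iff) (metis add.inverse_inverse neg_le_iff_le neg_less_iff_less minus_less_iff minus_le_iff)+
  then show ?thesis by (simp add: card_image)
qed

definition all_zeros :: "real \<Rightarrow> real \<Rightarrow> real set" where
  "all_zeros h N = {m \<in> {-mmax..mmax}. gap h N m = 0}"

lemma no_zeros:
  assumes "gap h N (- mmax) < 0" "gap h N mmax \<le> 0"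
  shows "zeros h N = {}"
proof -
  have "gap h N m < 0" if "m \<in> {-mmax..<mmax}" for m
    using that assms gap_quasiconvex[of "- mmax" m mmax h N] by (cases "m = - mmax") auto
  then show ?thesis unfolding zeros_def by fastforce
qed

lemma one_zero:
  assumes "gap h N (- mmax) \<ge> 0" "gap h N mmax < 0"
  shows "card (zeros h N) = 1"
proof -
  obtain m where m: "-mmax \<le> m" "m \<le> mmax" "gap h N m = 0"
    using gap_IVT[of "-mmax" mmax h N] assms mmax_pos by auto
  have "m \<noteq> mmax" using m assms by auto
  then have mz: "m \<in> zeros h N" using m by (simp add: zeros_def)
  have less: False if "m \<in> zeros h N" "n \<in> zeros h N" "m < n" for m n
    using that gap_quasiconvex[of m n mmax h N] assms by (auto simp: zeros_def)
  have "zeros h N = {m}" using mz less by (metis insertI1 linorder_neqE_linordered_idom singletonD set_eqI)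
  then show ?thesis by simp
qed

text \<open>In the first case the power increases at some zero, so there is another zero before it; in the second case a
  zero is the minimum. In the third case the power decreases at every zero, which is possible only at the right
  end, because the power is nonnegative there.\<close>

lemma card_all_zeros:
  assumes h: "h \<ge> 1/2" and t: "t > 0"
    and ends: "gap h (h\<^sup>2 + t\<^sup>2) (- mmax) \<ge> 0" "gap h (h\<^sup>2 + t\<^sup>2) mmax \<ge> 0"
  shows "(h, t) \<in> F ` D2 - F ` J0 \<Longrightarrow> card (all_zeros h (h\<^sup>2 + t\<^sup>2)) = 2"
    and "(h, t) \<in> F ` J0 \<Longrightarrow> card (all_zeros h (h\<^sup>2 + t\<^sup>2)) = 1"
    and "(h, t) \<notin> F ` D2 \<Longrightarrow> all_zeros h (h\<^sup>2 + t\<^sup>2) \<subseteq> {mmax}"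
proof -
  let ?N = "h\<^sup>2 + t\<^sup>2"
  show "card (all_zeros h ?N) = 2" if "(h, t) \<in> F ` D2 - F ` J0"
  proof -
    have "(h, t) \<in> F ` D2" "(h, t) \<notin> F ` J0" using that by auto
    then obtain m where m: "m \<in> {-mmax..mmax}" "gap h ?N m = 0" "2 * h - 1 < crit m"
      unfolding mem_F_D2_iff[OF h t] mem_F_J0_iff[OF h t] by (metis less_eq_real_def)
    obtain n where n: "-mmax \<le> n" "n < m" "gap h ?N n = 0" using zero_before_increasing_zero[OF m h ends(1)] by blast
    have "all_zeros h ?N = {n, m}" unfolding all_zeros_def using at_most_two_zeros[OF n(2,3) m(2) _ m(1)] n m by auto
    then show ?thesis using n by simp
  qed
  show "card (all_zeros h ?N) = 1" if "(h, t) \<in> F ` J0"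
    using that critical_zero_unique unfolding mem_F_J0_iff[OF h t] all_zeros_def by force
  show "all_zeros h ?N \<subseteq> {mmax}" if no: "(h, t) \<notin> F ` D2"
  proof
    fix x assume "x \<in> all_zeros h ?N"
    then have x: "x \<in> {-mmax..mmax}" "gap h ?N x = 0" by (auto simp: all_zeros_def)
    have lt: "crit y < 2 * h - 1" if "y \<in> {-mmax..mmax}" "gap h ?N y = 0" for y
      using no that unfolding mem_F_D2_iff[OF h t] by force
    show "x \<in> {mmax}"
    proof (rule ccontr)
      assume "x \<notin> {mmax}"
      then have "x < mmax" using x by auto
      then obtain n where "x < n" "n \<le> mmax" "gap h ?N n = 0" "crit n > 2 * h - 1"
        using zero_after_decreasing_zero[OF x lt[OF x] _ ends(2)] by blast
      then show False using lt[of n] x by auto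
    qed
  qed
qed

theorem theorem3:
  fixes T :: "(real \<times> real) set" and C C' :: "real \<times> real"
  assumes "is_triangle T"
    and "C \<in> R2_closure"
    and "similar T (convex hull {(0, 0), (1, 0), C})"
    and "C' = unit_inverse (1, 0) C"
  shows "(C' \<in> F ` D2 - F ` J0 \<longrightarrow> Quads T = 3) \<and>
         (C' \<in> F ` J0 \<and> C' \<noteq> I1 \<longrightarrow> Quads T = 2) \<and>
         (C' \<notin> F ` D2 \<or> C' = I1 \<longrightarrow> Quads T = 1)"
proof -
  obtain h t where C: "C = (h, t)" by (cases C)
  have h: "h \<ge> 1/2" and t: "t > 0" and long: "h\<^sup>2 + t\<^sup>2 \<ge> 1" and short: "(h - 1)\<^sup>2 + t\<^sup>2 \<le> 1"
    using assms(2) by (auto simp: R2_closure_def C)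
  define N where "N = h\<^sup>2 + t\<^sup>2"
  define d where "d = (h - 1)\<^sup>2 + t\<^sup>2"
  have d: "d = N - 2 * h + 1" by (simp add: d_def N_def power2_eq_square algebra_simps)
  have d0: "d > 0" unfolding d_def using t by (intro add_nonneg_pos) auto
  have N1: "N \<ge> 1" and d1: "d \<le> 1" using long short by (auto simp: N_def d_def)
  \<comment> \<open>d is the squared length of the shortest side BC, and N that of the longest side AC\<close>
  define h' t' where "h' = 1 + (h - 1) / d" and "t' = t / d"
  define N' where "N' = h'\<^sup>2 + t'\<^sup>2"
  have C': "C' = (h', t')"
  proof -
    have "(norm (h - 1, t))\<^sup>2 = d" by (simp add: norm_Pair d_def)
    then show ?thesis by (simp add: assms(4) C unit_inverse_def h'_def t'_def)
  qed
  have t': "t' > 0" using t d0 by (simp add: t'_def)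
  have N': "N' = N / d" "N' - 2 * h' + 1 = 1 / d"
  proof -
    have *: "d * ((h - 1) / d)\<^sup>2 + d * (t / d)\<^sup>2 = 1"
    proof -
      have "d * ((h - 1) / d)\<^sup>2 + d * (t / d)\<^sup>2 = ((h - 1)\<^sup>2 + t\<^sup>2) / d"
        using d0 by (simp add: power2_eq_square add_divide_distrib)
      also have "\<dots> = 1" using d0 unfolding d_def[symmetric] by simp
      finally show ?thesis .
    qed
    have "d * (N' - 2 * h' + 1) = d * ((h - 1) / d)\<^sup>2 + d * (t / d)\<^sup>2"
      unfolding N'_def h'_def t'_def by (simp add: power2_eq_square algebra_simps)
    then have "d * (N' - 2 * h' + 1) = 1" using * by simp
    then show 1: "N' - 2 * h' + 1 = 1 / d" using d0 by (simp add: field_simps)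
    have "N' = 1 / d + 2 * h' - 1" using 1 by simp
    also have "\<dots> = (1 + d + 2 * (h - 1)) / d" using d0 by (simp add: h'_def field_simps)
    also have "1 + d + 2 * (h - 1) = N" unfolding d by simp
    finally show "N' = N / d" .
  qed
  have h': "h' \<ge> 1/2"
  proof -
    have "2 * h' - 1 = (d + 2 * (h - 1)) / d" using d0 by (simp add: h'_def field_simps)
    also have "d + 2 * (h - 1) = N - 1" by (simp add: d)
    finally have "2 * h' - 1 = (N - 1) / d" .
    moreover have "(N - 1) / d \<ge> 0" using N1 d0 by simp
    ultimately show ?thesis by linarith
  qed
  obtain X Y Z where T: "T = convex hull {X, Y, Z}" and sh: "shape X Y Z h N"
    using assms(3) unfolding C N_def by (rule similar_imp_shape)
  have nd: "nondegenerate X Y Z" using shape_nondegenerate[OF sh[unfolded N_def]] t by simp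
  have sh2: "shape Y Z X (1 - h') (N' - 2 * h' + 1)"
  proof -
    have "(1 - h) / (N - 2 * h + 1) = 1 - h'" unfolding d[symmetric] h'_def by (simp add: diff_divide_distrib)
    then show ?thesis using shape_rotate[OF sh] d0 unfolding d[symmetric] N'(2) by simp
  qed
  have NN: "N > 0" using N1 by simp
  have sh3: "shape Z X Y ((N - h) / N) (d / N)"
  proof -
    have s: "shape Y Z X ((1 - h) / d) (1 / d)" using shape_rotate[OF sh] d0 unfolding d[symmetric] by simp
    have e: "1 / d - 2 * ((1 - h) / d) + 1 = N / d" using d0 d by (simp add: field_simps)
    have "1 - (1 - h) / d = (N - h) / d" using d0 d by (simp add: field_simps)
    then have "(1 - (1 - h) / d) / (N / d) = (N - h) / N" using d0 NN by simp
    moreover have "1 / (N / d) = d / N" by simp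
    ultimately show ?thesis using shape_rotate[OF s] d0 NN unfolding e by simp
  qed
  have count: "Quads T = card (zeros h N) + card {m \<in> {-mmax<..mmax}. gap h' N' m = 0} + card (zeros ((N - h) / N) (d / N))"
    using Quads_eq_zero_count[OF nd sh sh2 sh3 finite_zeros finite_zeros finite_zeros] unfolding T zeros_reflect .
  have ends: "gap h N (- mmax) = N - 1" "gap h N mmax = d - 1"
    "gap h' N' (- mmax) = (N - d) / d" "gap h' N' mmax = (1 - d) / d"
    "gap ((N - h) / N) (d / N) (- mmax) = (d - N) / N" "gap ((N - h) / N) (d / N) mmax = (1 - N) / N"
  proof -
    show "gap h N (- mmax) = N - 1" "gap h N mmax = d - 1" by (simp_all add: gap_ends d)
    show "gap h' N' (- mmax) = (N - d) / d" using d0 by (simp add: gap_ends N' field_simps)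
    have "N' - 2 * h' = 1 / d - 1" using N'(2) by simp
    then show "gap h' N' mmax = (1 - d) / d" using d0 by (simp add: gap_ends field_simps)
    show "gap ((N - h) / N) (d / N) (- mmax) = (d - N) / N" using NN by (simp add: gap_ends field_simps)
    show "gap ((N - h) / N) (d / N) mmax = (1 - N) / N" using NN d by (simp add: gap_ends field_simps)
  qed
  have e': "gap h' N' (- mmax) \<ge> 0" "gap h' N' mmax \<ge> 0" using ends(3,4) d0 d1 N1 by simp_all
  note Z = card_all_zeros[OF h' t' e'[unfolded N'_def], folded N'_def C']
  have J0_D2: "(h', t') \<in> F ` J0 \<Longrightarrow> (h', t') \<in> F ` D2"
    unfolding mem_F_D2_iff[OF h' t'] mem_F_J0_iff[OF h' t'] by force
  have finZ: "finite (all_zeros h' N')" unfolding all_zeros_def by (rule finite_all_zeros)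
  have I: "mmax \<in> {-mmax..mmax}" "- mmax \<in> {-mmax..mmax}" "- mmax < mmax" using mmax_pos by auto
  have I1: "C' = I1 \<longleftrightarrow> gap h' N' mmax = 0 \<and> crit mmax = 2 * h' - 1"
    unfolding C' N'_def by (rule eq_I1_iff[OF h' t'])
  have I1_J0: "C' \<in> F ` J0" if "C' = I1"
    using that I(1) unfolding I1 unfolding C' N'_def mem_F_J0_iff[OF h' t'] by blast
  have I1_iff: "C' = I1" if critical: "C' \<in> F ` J0" "gap h' N' mmax = 0"
  proof -
    obtain m where m: "m \<in> {-mmax..mmax}" "gap h' N' m = 0" "crit m = 2 * h' - 1"
      using critical(1) unfolding C' mem_F_J0_iff[OF h' t'] N'_def by blast
    then have "mmax = m" using critical_zero_unique[OF m] critical(2) I(1) by blast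
    then show ?thesis using I1 m critical(2) by simp
  qed
  consider (scalene_base) "d < 1" | (isosceles) "d = 1" "N > 1" | (equilateral) "d = 1" "N = 1" using d1 N1 by linarith
  then show ?thesis
  proof cases
    \<comment> \<open>the middle side contributes one zero, the longest none, the shortest all zeros of C'\<close>
    case scalene_base
    have 1: "card (zeros h N) = 1" using one_zero ends(1,2) N1 scalene_base by simp
    have 3: "zeros ((N - h) / N) (d / N) = {}"
      using no_zeros ends(5,6) NN N1 scalene_base by (simp add: divide_less_0_iff divide_le_0_iff)
    have pos: "gap h' N' (- mmax) > 0" "gap h' N' mmax > 0" using ends(3,4) d0 N1 scalene_base by simp_all
    have "{m \<in> {-mmax<..mmax}. gap h' N' m = 0} = all_zeros h' N'"
      using pos(1) unfolding all_zeros_def by (auto simp: less_le)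
    then have count': "Quads T = 1 + card (all_zeros h' N')" using count 1 3 by simp
    have "C' \<noteq> I1" using I1 pos(2) by auto
    moreover have "C' \<notin> F ` D2 \<Longrightarrow> all_zeros h' N' = {}"
      using Z(3) pos(2) unfolding all_zeros_def by fastforce
    ultimately show ?thesis using count' Z(1,2) by auto
  next
    \<comment> \<open>AB and BC have the same zeros; the one at the right end is counted only once\<close>
    case isosceles
    have same: "h' = h" "N' = N" using isosceles N' by (simp_all add: h'_def)
    have 3: "zeros ((N - h) / N) (d / N) = {}"
      using no_zeros ends(5,6) NN isosceles by (simp add: divide_less_0_iff divide_le_0_iff)
    have zero: "gap h' N' mmax = 0" using ends(4) isosceles by simp
    have pos: "gap h' N' (- mmax) > 0" using ends(3) isosceles by simp
    have 2: "{m \<in> {-mmax<..mmax}. gap h' N' m = 0} = all_zeros h' N'"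
      using pos unfolding all_zeros_def by (auto simp: less_le)
    have mem: "mmax \<in> all_zeros h' N'" using zero I by (simp add: all_zeros_def)
    have "zeros h N = all_zeros h' N' - {mmax}" unfolding same zeros_def all_zeros_def by auto
    then have count': "Quads T = (card (all_zeros h' N') - 1) + card (all_zeros h' N')"
      using count 2 3 mem finZ by (simp add: card_Diff_singleton)
    have "C' \<notin> F ` D2 \<Longrightarrow> all_zeros h' N' = {mmax}" using Z(3) mem by blast
    then show ?thesis using count' Z(1,2) I1_iff zero I1_J0 by auto
  next
    \<comment> \<open>every zero is a pair with a median, which neighbouring sides share\<close>
    case equilateral
    have same: "h' = h" "N' = N" using equilateral N' by (simp_all add: h'_def)
    have hh: "h = 1/2" using equilateral d by simp
    have third: "(N - h) / N = h" "d / N = N" using equilateral hh by simp_all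
    have zero: "gap h N mmax = 0" "gap h N (- mmax) = 0" using ends(1,2) equilateral by simp_all
    have all: "{m \<in> {-mmax..mmax}. gap h N m = 0} = {- mmax, mmax}"
      using at_most_two_zeros[OF I(3) zero(2,1) I(2,1)] .
    have "zeros h N = {m \<in> {-mmax..mmax}. gap h N m = 0} - {mmax}"
      "{m \<in> {-mmax<..mmax}. gap h N m = 0} = {m \<in> {-mmax..mmax}. gap h N m = 0} - {- mmax}"
      unfolding zeros_def by auto
    then have "zeros h N = {- mmax}" "{m \<in> {-mmax<..mmax}. gap h N m = 0} = {mmax}"
      unfolding all using I(3) by auto
    then have "Quads T = 3" using count unfolding same third by simp
    moreover have "crit mmax > 2 * h - 1"
      using crit_strict_mono[of 0 mmax] mmax_pos hh by (simp add: crit_eq[of 0])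
    then have "C' \<in> F ` D2"
      unfolding C' mem_F_D2_iff[OF h' t'] unfolding N'_def[symmetric] unfolding same
      using zero(1) I(1) by (intro bexI[of _ mmax]) auto
    moreover have "C' \<notin> F ` J0"
    proof
      assume "C' \<in> F ` J0"
      then have "card {- mmax, mmax} = 1" using Z(2) all unfolding all_zeros_def same by simp
      then show False using I(3) by simp
    qed
    ultimately show ?thesis using I1_J0 by auto
  qed
qed

end
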